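(* Let $G:=G_{1}\times G_{2}$ be a product of topological groups and $(V,\rho)$ a uniformly bounded strongly operator continuous Banach $G$-module. Assume that $G_{1}$ and $G_{2}$ admit Baire probability measures $\mu_{1}$ and $\mu_{2}$ and null sets $\mathcal{N}_{1}\subseteq G_{1}$, $\mathcal{N}_{2}\subseteq G_{2}$ (for $\mu_1$ and $\mu_2$ respectively) for which both $G_{1}\setminus\mathcal{N}_{1}$ and $G_{2}\setminus\mathcal{N}_{2}$ are contained in compact sets. Assume furthermore that $\Vert\rho_{\mu_{1}}\rho_{\mu_{2}}\Vert<1$ and that $V^{\mu_{1}}=V^{G_{1}}$ and $V^{\mu_{2}}=V^{G_{2}}$. Then there exists a topological isomorphism of continuous cohomology groups $H_{c}^{1}(G_{1}\times G_{2},V)\cong H_{c}^{1}(G_{1},V^{G_{2}})\oplus H_{c}^{1}(G_{2},V^{G_{1}})$.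
   Context: Banach spaces are real or complex; topological groups are not assumed Hausdorff. The Baire $\sigma$-algebra of a topological space $X$ is the smallest $\sigma$-algebra for which all continuous functions $X\to\mathbb{R}$ are measurable; a Baire probability measure on $X$ is a probability measure on it. A uniformly bounded Banach $G$-module $(V,\rho)$ is a Banach space $V$ with a group homomorphism $\rho:G\to \mathrm{GL}(V)$, $g\mapsto\rho_g$, into the invertible bounded operators such that $\sup_{g}\Vert\rho_g\Vert<\infty$. It is strongly operator continuous if for every $v\in V$ the map $g\mapsto\rho_g(v)$ is norm continuous. $V^{G_i}$ is the closed subspace of vectors fixed by $G_i$ (with $G_1,G_2$ viewed as subgroups of $G$); since $G_1,G_2$ commute, $V^{G_2}$ is a Banach $G_1$-module and $V^{G_1}$ a Banach $G_2$-module by restricting $\rho$. For $i=1,2$ the Markov operator $\rho_{\mu_i}\in\mathcal{B}(V)$ is determined by $\phi(\rho_{\mu_i}(v))=\int_{G_i}\phi(\rho_g(v))\,d\mu_i(g)$ for $v\in V$, $\phi\in V^*$ (it exists under the stated compactness assumption), and $V^{\mu_i}:=\{v\in V\mid\rho_{\mu_i}(v)=v\}$. For a uniformly bounded strongly operator continuous Banach $G$-module $(V,\rho)$, $C^n(G,V)$ is the space of continuous functions $G^n\to V$ (norm topology on $V$) with the compact-open topology, and $C^n(G,V)^G$ is the subspace of $f$ with $f(gg_1,\dots,gg_n)=\rho_g(f(g_1,\dots,g_n))$. Define $\partial^n:C^n(G,V)^G\to C^{n+1}(G,V)^G$ by $(\partial^nf)(g_1,\dots,g_{n+1})=\sum_{i=1}^{n+1}(-1)^{i+1}f(g_1,\dots,\widehat{g}_i,\dots,g_{n+1})$.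 Set $Z^n(G,V):=\ker(\partial^{n+1})\subseteq C^{n+1}(G,V)^G$, $B^n(G,V):=\mathrm{im}(\partial^n)\subseteq C^{n+1}(G,V)^G$, and $H_c^n(G,V):=Z^n(G,V)/B^n(G,V)$ with the quotient topology. *)

theory Defs
  imports "HOL-Probability.Probability"
begin

text \<open>
  The models of this class are exactly \<open>\<real>\<close> (take \<open>i = 0\<close>) and \<open>\<complex>\<close> (\<open>i * i = -1\<close>): multiplicativity
  of the norm leaves no choice for it.
\<close>

class real_or_complex = real_normed_field + banach + second_countable_topology +
  assumes real_or_complex:
    "\<exists>i. (i = 0 \<or> i * i = - 1) \<and> (\<forall>x. \<exists>a b. x = a *\<^sub>R 1 + b *\<^sub>R i)"

instance real :: real_or_complex
proof
  have "\<exists>a b. x = a *\<^sub>R 1 + b *\<^sub>R 0" for x :: real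
    by (intro exI[of _ x]) simp
  then show "\<exists>i::real. (i = 0 \<or> i * i = - 1) \<and> (\<forall>x. \<exists>a b. x = a *\<^sub>R 1 + b *\<^sub>R i)"
    by blast
qed

instance complex :: real_or_complex
proof
  have "x = Re x *\<^sub>R 1 + Im x *\<^sub>R \<i>" for x
    by (simp add: complex_eq_iff)
  then have "\<exists>a b. x = a *\<^sub>R 1 + b *\<^sub>R \<i>" for x
    by blast
  moreover have "\<i> * \<i> = - 1"
    by simp
  ultimately show "\<exists>i::complex. (i = 0 \<or> i * i = - 1) \<and> (\<forall>x. \<exists>a b. x = a *\<^sub>R 1 + b *\<^sub>R i)"
    by (intro exI[of _ \<i>] conjI allI disjI2)
qed

text \<open>
  A Banach space over \<open>'k\<close> is a type of class \<open>banach\<close> (its underlying real Banach space) with a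
  compatible scalar multiplication by \<open>'k\<close>.
\<close>

locale banach_space_over = vector_space scale
  for scale :: "'k::real_or_complex \<Rightarrow> 'v::banach \<Rightarrow> 'v" +
  assumes scale_of_real: "scale (of_real r) v = r *\<^sub>R v"
    and norm_scale: "norm (scale c v) = norm c * norm v"

definition bounded_klinear ::
  "('k \<Rightarrow> 'v \<Rightarrow> 'v) \<Rightarrow> ('k \<Rightarrow> 'w \<Rightarrow> 'w) \<Rightarrow> ('v::real_normed_vector \<Rightarrow> 'w::real_normed_vector) \<Rightarrow> bool"
where
  "bounded_klinear s s' T \<longleftrightarrow> bounded_linear T \<and> (\<forall>c v. T (s c v) = s' c (T v))"

definition GL :: "('k \<Rightarrow> 'v \<Rightarrow> 'v) \<Rightarrow> ('v::real_normed_vector \<Rightarrow> 'v) set" where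
  "GL s = {T. bij T \<and> bounded_klinear s s T \<and> bounded_klinear s s (inv T)}"


text \<open>
  Topological groups are types of class \<open>topological_group_add\<close>: the group law is written
  additively but is not assumed commutative, and the topology is not assumed Hausdorff.
\<close>

instance prod :: (topological_monoid_add, topological_monoid_add) topological_monoid_add
proof
  fix a b :: "'a \<times> 'b"
  have *: "filterlim fst (nhds a) (nhds a \<times>\<^sub>F nhds b)" "filterlim snd (nhds b) (nhds a \<times>\<^sub>F nhds b)"
    by (rule filterlim_fst filterlim_snd)+
  have "((\<lambda>x. (fst (fst x) + fst (snd x), snd (fst x) + snd (snd x)))
          \<longlongrightarrow> (fst a + fst b, snd a + snd b)) (nhds a \<times>\<^sub>F nhds b)"
    by (intro tendsto_Pair tendsto_add tendsto_fst tendsto_snd *)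
  then show "((\<lambda>x. fst x + snd x) \<longlongrightarrow> a + b) (nhds a \<times>\<^sub>F nhds b)"
    by (simp add: plus_prod_def)
qed

instance prod :: (topological_group_add, topological_group_add) topological_group_add
proof
  fix a :: "'a \<times> 'b"
  have "((\<lambda>x. (- fst x, - snd x)) \<longlongrightarrow> (- fst a, - snd a)) (nhds a)"
    by (intro tendsto_Pair tendsto_minus tendsto_fst tendsto_snd filterlim_ident)
  then show "(uminus \<longlongrightarrow> - a) (nhds a)"
    unfolding uminus_prod_def .
qed

definition uniformly_bounded_module ::
  "('k \<Rightarrow> 'v \<Rightarrow> 'v) \<Rightarrow> ('g::group_add \<Rightarrow> 'v::real_normed_vector \<Rightarrow> 'v) \<Rightarrow> bool" where
  "uniformly_bounded_module s \<rho> \<longleftrightarrow>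
     range \<rho> \<subseteq> GL s \<and> (\<forall>g h. \<rho> (g + h) = \<rho> g \<circ> \<rho> h) \<and> bdd_above (range (\<lambda>g. onorm (\<rho> g)))"

definition strongly_operator_continuous ::
  "('g::topological_space \<Rightarrow> 'v \<Rightarrow> 'v::real_normed_vector) \<Rightarrow> bool" where
  "strongly_operator_continuous \<rho> \<longleftrightarrow> (\<forall>v. continuous_on UNIV (\<lambda>g. \<rho> g v))"

definition fixed_vectors :: "('g \<Rightarrow> 'v \<Rightarrow> 'v) \<Rightarrow> 'v set" where
  "fixed_vectors \<rho> = {v. \<forall>g. \<rho> g v = v}"

definition restrict_left :: "('g \<times> 'h::zero \<Rightarrow> 'v \<Rightarrow> 'v) \<Rightarrow> 'g \<Rightarrow> 'v \<Rightarrow> 'v" where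
  "restrict_left \<rho> g = \<rho> (g, 0)"

definition restrict_right :: "('g::zero \<times> 'h \<Rightarrow> 'v \<Rightarrow> 'v) \<Rightarrow> 'h \<Rightarrow> 'v \<Rightarrow> 'v" where
  "restrict_right \<rho> h = \<rho> (0, h)"


definition baire :: "'g::topological_space measure" where
  "baire = sigma UNIV {f -` A | (f :: 'g \<Rightarrow> real) A. continuous_on UNIV f \<and> A \<in> sets borel}"

definition baire_prob :: "'g::topological_space measure \<Rightarrow> bool" where
  "baire_prob \<mu> \<longleftrightarrow> prob_space \<mu> \<and> sets \<mu> = sets baire"

text \<open>
  The description is proper when the orbit maps are continuous, \<open>\<rho>\<close> is uniformly bounded and \<open>\<mu>\<close> is a
  Baire probability measure that is carried by a compact set up to a null set: existence by vector
  integration, uniqueness by the Hahn-Banach theorem.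
\<close>

definition markov_operator ::
  "('k::real_or_complex \<Rightarrow> 'v \<Rightarrow> 'v) \<Rightarrow> ('g \<Rightarrow> 'v \<Rightarrow> 'v) \<Rightarrow> 'g measure \<Rightarrow> 'v::real_normed_vector \<Rightarrow> 'v"
where
  "markov_operator s \<rho> \<mu> =
     (THE P. bounded_klinear s s P \<and>
        (\<forall>v \<phi>. bounded_klinear s (*) \<phi> \<longrightarrow> \<phi> (P v) = (\<integral>g. \<phi> (\<rho> g v) \<partial>\<mu>)))"


text \<open>The underlying set is the \<open>topspace\<close> of the topology.\<close>

record ('k, 'a) top_vector_space =
  tvs_top :: "'a topology"
  tvs_add :: "'a \<Rightarrow> 'a \<Rightarrow> 'a"
  tvs_scale :: "'k \<Rightarrow> 'a \<Rightarrow> 'a"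

definition topological_isomorphism ::
  "('k, 'a) top_vector_space \<Rightarrow> ('k, 'b) top_vector_space \<Rightarrow> ('a \<Rightarrow> 'b) \<Rightarrow> bool" where
  "topological_isomorphism E F \<Phi> \<longleftrightarrow>
     homeomorphic_map (tvs_top E) (tvs_top F) \<Phi> \<and>
     (\<forall>x\<in>topspace (tvs_top E). \<forall>y\<in>topspace (tvs_top E).
        \<Phi> (tvs_add E x y) = tvs_add F (\<Phi> x) (\<Phi> y)) \<and>
     (\<forall>c. \<forall>x\<in>topspace (tvs_top E). \<Phi> (tvs_scale E c x) = tvs_scale F c (\<Phi> x))"

definition topologically_isomorphic ::
  "('k, 'a) top_vector_space \<Rightarrow> ('k, 'b) top_vector_space \<Rightarrow> bool" where
  "topologically_isomorphic E F \<longleftrightarrow> (\<exists>\<Phi>. topological_isomorphism E F \<Phi>)"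

definition direct_sum ::
  "('k, 'a) top_vector_space \<Rightarrow> ('k, 'b) top_vector_space \<Rightarrow> ('k, 'a \<times> 'b) top_vector_space" where
  "direct_sum E F =
     \<lparr>tvs_top = prod_topology (tvs_top E) (tvs_top F),
      tvs_add = (\<lambda>x y. (tvs_add E (fst x) (fst y), tvs_add F (snd x) (snd y))),
      tvs_scale = (\<lambda>c x. (tvs_scale E c (fst x), tvs_scale F c (snd x)))\<rparr>"

definition quotient_topology :: "'a topology \<Rightarrow> ('a \<Rightarrow> 'b) \<Rightarrow> 'b topology" where
  "quotient_topology X q =
     topology (\<lambda>U. U \<subseteq> q ` topspace X \<and> openin X {x \<in> topspace X. q x \<in> U})"

lemma istopology_quotient:
  "istopology (\<lambda>U. U \<subseteq> q ` topspace X \<and> openin X {x \<in> topspace X. q x \<in> U})"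
proof -
  have 1: "{x \<in> topspace X. q x \<in> S \<inter> T} =
      {x \<in> topspace X. q x \<in> S} \<inter> {x \<in> topspace X. q x \<in> T}" for S T
    by auto
  have 2: "{x \<in> topspace X. q x \<in> \<Union>K} = (\<Union>S\<in>K. {x \<in> topspace X. q x \<in> S})" for K
    by auto
  show ?thesis
    unfolding istopology_def 1 2 by (intro conjI allI impI openin_Int openin_Union) blast+
qed

lemma openin_quotient_topology:
  "openin (quotient_topology X q) U \<longleftrightarrow>
     U \<subseteq> q ` topspace X \<and> openin X {x \<in> topspace X. q x \<in> U}"
  unfolding quotient_topology_def by (simp add: topology_inverse'[OF istopology_quotient])

lemma topspace_quotient_topology: "topspace (quotient_topology X q) = q ` topspace X"
proof
  show "topspace (quotient_topology X q) \<subseteq> q ` topspace X"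
    by (auto simp: topspace_def[of "quotient_topology X q"] openin_quotient_topology)
  have "{x \<in> topspace X. q x \<in> q ` topspace X} = topspace X"
    by auto
  then show "q ` topspace X \<subseteq> topspace (quotient_topology X q)"
    by (intro openin_subset) (simp add: openin_quotient_topology)
qed

lemma quotient_map_quotient_topology: "quotient_map X (quotient_topology X q) q"
  by (auto simp: quotient_map_def topspace_quotient_topology openin_quotient_topology)

definition subspace_of ::
  "('k, 'a) top_vector_space \<Rightarrow> 'a set \<Rightarrow> ('k, 'a) top_vector_space" where
  "subspace_of E S = E\<lparr>tvs_top := subtopology (tvs_top E) S\<rparr>"

text \<open>
  Elements are the cosets \<open>x + B\<close>.  Adding \<open>B\<close> in the scalar multiplication makes
  \<open>c (x + B) = c x + B\<close> also for \<open>c = 0\<close>.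
\<close>

definition quotient_by ::
  "('k, 'a) top_vector_space \<Rightarrow> 'a set \<Rightarrow> ('k, 'a set) top_vector_space" where
  "quotient_by E B =
     \<lparr>tvs_top = quotient_topology (tvs_top E) (\<lambda>x. tvs_add E x ` B),
      tvs_add = (\<lambda>A A'. {tvs_add E x y | x y. x \<in> A \<and> y \<in> A'}),
      tvs_scale = (\<lambda>c A. {tvs_add E (tvs_scale E c x) b | x b. x \<in> A \<and> b \<in> B})\<rparr>"


text \<open>
  Points of \<open>G\<^sup>n\<close> are the functions \<open>{..<n} \<rightarrow>\<^sub>E UNIV\<close>, so coordinates are numbered from \<open>0\<close>.
  Coefficients are a subset \<open>W\<close> of the Banach space, to allow the closed submodules of fixed
  vectors; only the action on \<open>W\<close> matters.  Cochains are set to \<open>0\<close> outside \<open>G\<^sup>n\<close>.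
\<close>

definition group_power :: "nat \<Rightarrow> (nat \<Rightarrow> 'g::topological_space) topology" where
  "group_power n = product_topology (\<lambda>_. euclidean) {..<n}"

text \<open>
  For \<open>cochains n W\<close> the first index is the number of group arguments; cocycles and coboundaries of
  degree \<open>n\<close> have \<open>n + 1\<close> arguments.
\<close>

definition cochains :: "nat \<Rightarrow> 'v set \<Rightarrow> ((nat \<Rightarrow> 'g::topological_space) \<Rightarrow> 'v::real_normed_vector) set"
where
  "cochains n W = {f. continuous_map (group_power n) (top_of_set W) f \<and>
                      (\<forall>x. x \<notin> topspace (group_power n) \<longrightarrow> f x = 0)}"

definition compact_open ::
  "nat \<Rightarrow> 'v set \<Rightarrow> ((nat \<Rightarrow> 'g::topological_space) \<Rightarrow> 'v::real_normed_vector) topology" where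
  "compact_open n W = topology_generated_by
     {{f \<in> cochains n W. f ` K \<subseteq> U} | K U. compactin (group_power n) K \<and> openin (top_of_set W) U}"

definition invariant_cochains ::
  "('g \<Rightarrow> 'v \<Rightarrow> 'v) \<Rightarrow> nat \<Rightarrow> 'v set \<Rightarrow>
     ((nat \<Rightarrow> 'g::{topological_space, plus}) \<Rightarrow> 'v::real_normed_vector) set" where
  "invariant_cochains \<rho> n W =
     {f \<in> cochains n W. \<forall>g. \<forall>x\<in>topspace (group_power n). f (\<lambda>i\<in>{..<n}. g + x i) = \<rho> g (f x)}"

definition omit :: "nat \<Rightarrow> nat \<Rightarrow> (nat \<Rightarrow> 'g) \<Rightarrow> nat \<Rightarrow> 'g" where
  "omit n i x = (\<lambda>j\<in>{..<n}. if j < i then x j else x (Suc j))"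

definition coboundary ::
  "nat \<Rightarrow> ((nat \<Rightarrow> 'g::topological_space) \<Rightarrow> 'v::real_normed_vector) \<Rightarrow> (nat \<Rightarrow> 'g) \<Rightarrow> 'v" where
  "coboundary n f = (\<lambda>x. if x \<in> topspace (group_power (Suc n))
                         then \<Sum>i\<le>n. (- 1) ^ i *\<^sub>R f (omit n i x) else 0)"

definition cocycles ::
  "('g \<Rightarrow> 'v \<Rightarrow> 'v) \<Rightarrow> nat \<Rightarrow> 'v set \<Rightarrow>
     ((nat \<Rightarrow> 'g::{topological_space, plus}) \<Rightarrow> 'v::real_normed_vector) set" where
  "cocycles \<rho> n W = {f \<in> invariant_cochains \<rho> (Suc n) W. coboundary (Suc n) f = (\<lambda>_. 0)}"

definition coboundaries ::
  "('g \<Rightarrow> 'v \<Rightarrow> 'v) \<Rightarrow> nat \<Rightarrow> 'v set \<Rightarrow>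
     ((nat \<Rightarrow> 'g::{topological_space, plus}) \<Rightarrow> 'v::real_normed_vector) set" where
  "coboundaries \<rho> n W = coboundary n ` invariant_cochains \<rho> n W"

definition cochain_space ::
  "('k \<Rightarrow> 'v \<Rightarrow> 'v) \<Rightarrow> nat \<Rightarrow> 'v set \<Rightarrow>
     ('k, (nat \<Rightarrow> 'g::topological_space) \<Rightarrow> 'v::real_normed_vector) top_vector_space" where
  "cochain_space s n W =
     \<lparr>tvs_top = compact_open n W,
      tvs_add = (\<lambda>f h x. f x + h x),
      tvs_scale = (\<lambda>c f x. s c (f x))\<rparr>"

definition continuous_cohomology ::
  "('k \<Rightarrow> 'v \<Rightarrow> 'v) \<Rightarrow> ('g \<Rightarrow> 'v \<Rightarrow> 'v) \<Rightarrow> nat \<Rightarrow> 'v set \<Rightarrow>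
     ('k, ((nat \<Rightarrow> 'g::{topological_space, plus}) \<Rightarrow> 'v::real_normed_vector) set) top_vector_space" where
  "continuous_cohomology s \<rho> n W =
     quotient_by (subspace_of (cochain_space s (Suc n) W) (cocycles \<rho> n W)) (coboundaries \<rho> n W)"

end

theory Submission
  imports Defs
begin

text \<open>
  For a 1-cocycle \<open>f\<close> let \<open>b g = f (1, g)\<close>, with restrictions \<open>b\<^sub>1\<close> and \<open>b\<^sub>2\<close> to the factors, let \<open>P\<^sub>i\<close> be
  the Markov operators and \<open>\<beta>\<^sub>i = \<integral> b\<^sub>i d\<mu>\<^sub>i\<close>.  Since the factors commute,
  \<open>(1 - \<rho> g\<^sub>2) (b\<^sub>1 g\<^sub>1) = (1 - \<rho> g\<^sub>1) (b\<^sub>2 g\<^sub>2)\<close>, and integrating gives \<open>(1 - P\<^sub>2) \<beta>\<^sub>1 = (1 - P\<^sub>1) \<beta>\<^sub>2\<close>.  As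
  \<open>P\<^sub>1 P\<^sub>2\<close> is a strict contraction, there is a unique \<open>v\<close> with \<open>(1 - P\<^sub>1) v = \<beta>\<^sub>1\<close> and
  \<open>(1 - P\<^sub>2) v = \<beta>\<^sub>2\<close>, and it depends linearly and continuously on \<open>f\<close>.  After adding the coboundary
  of \<open>v\<close>, the values of \<open>b\<^sub>1\<close> are fixed by \<open>P\<^sub>2\<close>, hence by \<open>G\<^sub>2\<close>, and those of \<open>b\<^sub>2\<close> by \<open>G\<^sub>1\<close>.  This
  retraction is inverse, up to coboundaries, to \<open>(b\<^sub>1, b\<^sub>2) \<mapsto> b\<^sub>1 + b\<^sub>2\<close>.
\<close>

section \<open>Functionals separating points\<close>

text \<open>Why the corrected values are fixed: integrating the commutation relation over the second
  factor gives \<open>(1 - P\<^sub>2) (b\<^sub>1 g\<^sub>1) = (1 - \<rho> g\<^sub>1) \<beta>\<^sub>2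
  = (1 - \<rho> g\<^sub>1) (1 - P\<^sub>2) v\<close>. As \<open>P\<^sub>2\<close> commutes with
  \<open>\<rho> g\<^sub>1\<close>, the operator \<open>1 - P\<^sub>2\<close> kills
  \<open>b\<^sub>1 g\<^sub>1 + \<rho> g\<^sub>1 v - v\<close>. The hypotheses on fixed vectors turn
  this into invariance under the whole factor. For a pair that already takes values in the fixed
  vectors, \<open>v\<close> splits into a vector fixed by \<open>G\<^sub>2\<close> and one fixed by
  \<open>G\<^sub>1\<close>, so each component changes by a coboundary of its own coefficient module.
  The isomorphism has to be topological, although the cohomology spaces are quotients that need not
  be Hausdorff. The work is therefore done by continuous maps between cocycle spaces that are
  inverse to each other up to coboundaries. Their continuity rests on the compact carriers: the norm
  of \<open>v\<close> is controlled by the values of \<open>f\<close> on one fixed compact set.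
  Hahn-Banach enters because integrals of vector functions are tested only by functionals.\<close>

definition sublinear :: "('a::real_vector \<Rightarrow> real) \<Rightarrow> bool" where
  "sublinear q \<longleftrightarrow> (\<forall>x y. q (x + y) \<le> q x + q y) \<and> (\<forall>t>0. \<forall>x. q (t *\<^sub>R x) \<le> t * q x)"

text \<open>Inequalities suffice in the definition: applying the one for \<open>1/t\<close> to
  \<open>t x\<close> reverses the one for \<open>t\<close>, and the factors \<open>2\<close> and
  \<open>1/2\<close> squeeze \<open>q 0\<close> to \<open>0\<close>.\<close>

lemma sublinearD:
  assumes "sublinear q"
  shows "q (x + y) \<le> q x + q y" "t \<ge> 0 \<Longrightarrow> q (t *\<^sub>R x) = t * q x" "q 0 = 0" "- q (- x) \<le> q x"
proof -
  have le: "q (t *\<^sub>R x) \<le> t * q x" if "t > 0" for t x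
    using assms that by (auto simp: sublinear_def)
  show add: "q (x + y) \<le> q x + q y" for x y
    using assms by (auto simp: sublinear_def)
  have "q 0 \<le> 2 * q 0" "q 0 \<le> (1/2) * q 0"
    using le[of 2 0] le[of "1/2" 0] by auto
  then show 0: "q 0 = 0"
    by linarith
  show "- q (- x) \<le> q x"
    using add[of x "- x"] 0 by simp
  show "q (t *\<^sub>R x) = t * q x" if "t \<ge> 0"
  proof (cases "t = 0")
    case False
    with that have t: "t > 0" by simp
    have "q ((1/t) *\<^sub>R (t *\<^sub>R x)) \<le> (1/t) * q (t *\<^sub>R x)"
      using t by (intro le) simp
    then have "t * q x \<le> q (t *\<^sub>R x)"
      using t by (simp add: field_simps)
    with le[OF t, of x] show ?thesis by simp
  qed (use 0 in simp)
qed

text \<open>The minorant is the infimum over \<open>t \<ge> 0\<close> of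
  \<open>q (v + t y) - t q y\<close>, which is at least \<open>- q (- v)\<close> because
  \<open>t q y = q (t y) \<le> q (v + t y) + q (- v)\<close>. Taking \<open>t = 0\<close> gives
  \<open>q' \<le> q\<close>, and \<open>t = 1\<close> at \<open>v = - y\<close> gives the last
  claim.\<close>

lemma sublinear_minorant:
  assumes q: "sublinear q"
  obtains q' where "sublinear q'" "q' \<le> q" "q' (- y) \<le> - q y"
proof -
  define a where "a v t = q (v + t *\<^sub>R y) - t * q y" for v t
  define q' where "q' v = (INF t\<in>{0..}. a v t)" for v
  have "- q (- v) \<le> a v t" if "t \<ge> 0" for v t
    using sublinearD(1)[OF q, of "v + t *\<^sub>R y" "- v"] sublinearD(2)[OF q that, of y]
    by (simp add: a_def)
  then have bdd: "bdd_below (a v ` {0..})" for v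
    by (intro bdd_belowI2[of _ "- q (- v)"]) auto
  have low: "q' v \<le> a v t" if "t \<ge> 0" for v t
    unfolding q'_def using that by (intro cINF_lower bdd) auto
  have great: "c \<le> q' v" if "\<And>t. t \<ge> 0 \<Longrightarrow> c \<le> a v t" for c v
    unfolding q'_def using that by (intro cINF_greatest) auto
  have "q' (v + w) \<le> q' v + q' w" for v w
  proof -
    have "q' (v + w) \<le> a v s + a w t" if "s \<ge> 0" "t \<ge> 0" for s t
    proof -
      have "q' (v + w) \<le> a (v + w) (s + t)"
        using that by (intro low) simp
      also have "\<dots> \<le> a v s + a w t"
        using sublinearD(1)[OF q, of "v + s *\<^sub>R y" "w + t *\<^sub>R y"]
        by (simp add: a_def algebra_simps)
      finally show ?thesis .
    qed
    then have "q' (v + w) - a v s \<le> q' w" if "s \<ge> 0" for s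
      using that by (intro great) (simp add: algebra_simps)
    then have "q' (v + w) - q' w \<le> q' v"
      by (intro great) (simp add: algebra_simps)
    then show ?thesis by simp
  qed
  moreover have "q' (t *\<^sub>R v) \<le> t * q' v" if t: "t > 0" for t v
  proof -
    have "q' (t *\<^sub>R v) / t \<le> a v s" if "s \<ge> 0" for s
    proof -
      have "a (t *\<^sub>R v) (t * s) = t * a v s"
        using sublinearD(2)[OF q, of t "v + s *\<^sub>R y"] t by (simp add: a_def algebra_simps)
      moreover have "q' (t *\<^sub>R v) \<le> a (t *\<^sub>R v) (t * s)"
        using t that by (intro low) simp
      ultimately show ?thesis
        using t by (simp add: field_simps)
    qed
    then have "q' (t *\<^sub>R v) / t \<le> q' v"
      by (rule great)
    then show ?thesis
      using t by (simp add: field_simps)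
  qed
  ultimately have "sublinear q'"
    by (simp add: sublinear_def)
  moreover have "q' \<le> q"
    using low[of 0] by (auto simp: le_fun_def a_def)
  moreover have "q' (- y) \<le> - q y"
    using low[of 1 "- y"] sublinearD(3)[OF q] by (simp add: a_def)
  ultimately show thesis ..
qed

text \<open>A minimal sublinear functional is linear, because \<open>sublinear_minorant\<close> cannot improve it.\<close>

lemma linear_minorant:
  assumes p: "sublinear p"
  obtains f where "linear f" "f \<le> p"
proof -
  define A where "A = {q. sublinear q \<and> q \<le> p}"
  \<comment> \<open>Zorn's lemma is applied to the reversed pointwise order, so its maximal element
    is a minimal sublinear functional below \<open>p\<close>.\<close>
  have "\<exists>m\<in>A. \<forall>a\<in>A. a \<le> m \<longrightarrow> a = m"
  proof (rule predicate_Zorn)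
    show "partial_order_on A (relation_of (\<lambda>a b. b \<le> a) A)"
      by (rule partial_order_on_relation_ofI) auto
    fix C assume C: "C \<in> Chains (relation_of (\<lambda>a b. b \<le> a) A)"
    then have CA: "C \<subseteq> A"
      by (auto simp: Chains_def relation_of_def)
    have comp: "a \<le> b \<or> b \<le> a" if "a \<in> C" "b \<in> C" for a b
      using C that by (auto simp: Chains_def relation_of_def)
    show "\<exists>u\<in>A. \<forall>a\<in>C. u \<le> a"
    proof (cases "C = {}")
      case True
      with p show ?thesis by (auto simp: A_def)
    next
      case False
      define u where "u v = (INF q\<in>C. q v)" for v
      have "- p (- v) \<le> q v" if "q \<in> C" for q v
      proof -
        have "sublinear q" "q (- v) \<le> p (- v)"
          using that CA by (auto simp: A_def le_fun_def)
        with sublinearD(4)[of q v] show ?thesis by simp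
      qed
      then have "bdd_below ((\<lambda>q. q v) ` C)" for v
        by (intro bdd_belowI2[of _ "- p (- v)"]) auto
      then have low: "u v \<le> q v" if "q \<in> C" for q v
        unfolding u_def using that by (intro cINF_lower)
      have great: "c \<le> u v" if "\<And>q. q \<in> C \<Longrightarrow> c \<le> q v" for c v
        unfolding u_def using that False by (intro cINF_greatest) auto
      \<comment> \<open>Subadditivity of a pointwise infimum needs one functional below both
        \<open>a\<close> and \<open>b\<close>; in a chain the smaller of the two serves.\<close>
      have "u (v + w) \<le> a v + b w" if ab: "a \<in> C" "b \<in> C" for a b v w
      proof -
        obtain c where c: "c \<in> C" "c \<le> a" "c \<le> b"
          using comp[OF ab] ab by blast
        have "u (v + w) \<le> c (v + w)"
          using c low by blast
        also have "\<dots> \<le> c v + c w"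
          using c CA sublinearD(1) by (auto simp: A_def)
        also have "\<dots> \<le> a v + b w"
          using c by (intro add_mono) (auto simp: le_fun_def)
        finally show ?thesis .
      qed
      then have "u (v + w) - a v \<le> b w" if "a \<in> C" "b \<in> C" for a b v w
        using that by (simp add: diff_le_eq add.commute)
      then have "u (v + w) - a v \<le> u w" if "a \<in> C" for a v w
        using that by (intro great)
      then have "u (v + w) - u w \<le> u v" for v w
        by (intro great) (simp add: algebra_simps)
      moreover have "u (t *\<^sub>R v) \<le> t * u v" if t: "t > 0" for t v
      proof -
        have "u (t *\<^sub>R v) / t \<le> a v" if "a \<in> C" for a
          using low[OF that, of "t *\<^sub>R v"] that CA sublinearD(2)[of a t v] t
          by (auto simp: A_def field_simps)
        then have "u (t *\<^sub>R v) / t \<le> u v"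
          by (rule great)
        then show ?thesis
          using t by (simp add: field_simps)
      qed
      ultimately have "sublinear u"
        by (simp add: sublinear_def algebra_simps)
      moreover have "u \<le> p"
      proof -
        obtain a where a: "a \<in> C"
          using False by blast
        then have "u \<le> a"
          using low by (simp add: le_fun_def)
        also have "a \<le> p"
          using a CA by (auto simp: A_def)
        finally show ?thesis .
      qed
      ultimately show ?thesis
        using low by (auto simp: A_def le_fun_def)
    qed
  qed
  then obtain m where m: "sublinear m" "m \<le> p" and min: "\<And>a. a \<in> A \<Longrightarrow> a \<le> m \<Longrightarrow> a = m"
    by (auto simp: A_def)
  have neg: "m (- y) = - m y" for y
  proof -
    obtain q where q: "sublinear q" "q \<le> m" "q (- y) \<le> - m y"
      using sublinear_minorant[OF m(1)] .
    then have "q \<in> A"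
      using m order_trans[of q m p] by (simp add: A_def)
    then have "q = m"
      using min q(2) by simp
    with q sublinearD(4)[OF m(1), of "- y"] show ?thesis by simp
  qed
  have "linear m"
  proof (rule linearI)
    show "m (x + y) = m x + m y" for x y
      using sublinearD(1)[OF m(1), of x y] sublinearD(1)[OF m(1), of "x + y" "- y"] neg[of y] by simp
    show "m (r *\<^sub>R x) = r *\<^sub>R m x" for r x
      using sublinearD(2)[OF m(1), of r x] sublinearD(2)[OF m(1), of "- r" x] neg[of "r *\<^sub>R x"]
      by (cases "r \<ge> 0") auto
  qed
  then show thesis
    using that m by simp
qed

text \<open>Hahn-Banach without extension from a subspace: the norm is first lowered to a sublinear
  \<open>p\<close> with \<open>p (- x) \<le> - norm x\<close>. Every linear \<open>f\<close> below
  \<open>p\<close> then satisfies \<open>f x = - f (- x) \<ge> norm x\<close>.\<close>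

lemma norming_functional:
  fixes x :: "'a::real_normed_vector"
  obtains f where "bounded_linear f" "\<And>v. \<bar>f v\<bar> \<le> norm v" "f x = norm x"
proof -
  have "sublinear (norm :: 'a \<Rightarrow> real)"
    by (auto simp: sublinear_def norm_triangle_ineq)
  then obtain p where p: "sublinear p" "p \<le> norm" "p (- x) \<le> - norm x"
    by (rule sublinear_minorant)
  obtain f where f: "linear f" "f \<le> p"
    using linear_minorant[OF p(1)] .
  have le: "f v \<le> norm v" for v
    using f p by (auto simp: le_fun_def intro: order_trans)
  have abs: "\<bar>f v\<bar> \<le> norm v" for v
    using le[of v] le[of "- v"] linear_neg[OF f(1), of v] by simp
  have "bounded_linear f"
    using f(1) abs by (intro bounded_linear.intro bounded_linear_axioms.intro exI[of _ 1]) auto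
  moreover have "f x = norm x"
    using f p le[of x] linear_neg[OF f(1), of x] le_funD[OF f(2), of "- x"] by linarith
  ultimately show thesis
    using abs that by blast
qed

lemma functionals_separate:
  fixes x y :: "'a::real_normed_vector"
  assumes "\<And>f :: 'a \<Rightarrow> real. bounded_linear f \<Longrightarrow> f x = f y"
  shows "x = y"
proof -
  obtain f where f: "bounded_linear f" "f (x - y) = norm (x - y)"
    by (rule norming_functional)
  interpret f: bounded_linear f by fact
  show ?thesis
    using f assms[OF f(1)] by (simp add: f.diff)
qed

lemma (in banach_space_over) bounded_linear_scale: "bounded_linear (scale c)"
proof (rule bounded_linear_intro)
  show "scale c (x + y) = scale c x + scale c y" for x y
    by (rule scale_right_distrib)
  show "scale c (r *\<^sub>R x) = r *\<^sub>R scale c x" for r x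
    by (metis scale_left_commute scale_of_real)
  show "norm (scale c x) \<le> norm x * norm c" for x
    by (simp add: norm_scale)
qed

text \<open>
  The functional is \<open>x \<mapsto> f x - i f (i x)\<close>, for the element \<open>i\<close> of \<open>real_or_complex\<close> and a
  real functional \<open>f\<close>.
\<close>

lemma (in banach_space_over) bounded_klinear_functionals_separate:
  assumes eq: "\<And>\<phi>. bounded_klinear scale (*) \<phi> \<Longrightarrow> \<phi> x = \<phi> y"
  shows "x = y"
proof (rule functionals_separate)
  fix f :: "'v \<Rightarrow> real" assume "bounded_linear f"
  then interpret f: bounded_linear f .
  obtain i :: 'k where i: "i = 0 \<or> i * i = - 1" and span: "\<And>c. \<exists>a b. c = a *\<^sub>R 1 + b *\<^sub>R i"
    using real_or_complex[where 'a='k] by metis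
  have scaleR: "scale c (r *\<^sub>R v) = r *\<^sub>R scale c v" for c r v
    by (metis scale_left_commute scale_of_real)
  have scale_scaleR: "scale (r *\<^sub>R c) v = r *\<^sub>R scale c v" for c r v
    by (metis scaleR_conv_of_real scale_of_real scale_scale)
  define \<phi> where "\<phi> v = of_real (f v) - i * of_real (f (scale i v))" for v
  have "bounded_linear \<phi>"
    unfolding \<phi>_def
    by (rule bounded_linear_sub bounded_linear_const_mult
        bounded_linear_compose[OF bounded_linear_of_real]
        bounded_linear_compose[OF f.bounded_linear_axioms bounded_linear_scale]
        f.bounded_linear_axioms)+
  then interpret \<phi>: bounded_linear \<phi> .
  \<comment> \<open>Since \<open>1\<close> and \<open>i\<close> span the scalars over the reals,
    this identity and real linearity give linearity over \<open>'k\<close>.\<close>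
  have \<phi>i: "\<phi> (scale i v) = i * \<phi> v" for v
    using i
  proof
    assume "i = 0"
    then show ?thesis by (simp add: \<phi>_def f.zero)
  next
    assume ii: "i * i = - 1"
    then have "scale i (scale i v) = - v"
      by (simp add: scale_scale)
    then have "\<phi> (scale i v) = of_real (f (scale i v)) + i * of_real (f v)"
      by (simp add: \<phi>_def f.neg)
    also have "\<dots> = i * \<phi> v"
      by (simp add: \<phi>_def right_diff_distrib flip: mult.assoc) (simp add: ii)
    finally show ?thesis .
  qed
  have "\<phi> (scale c v) = c * \<phi> v" for c v
  proof -
    obtain a b where c: "c = a *\<^sub>R 1 + b *\<^sub>R i"
      using span by blast
    then have "scale c v = a *\<^sub>R v + b *\<^sub>R scale i v"
      by (simp only: scale_left_distrib scale_scaleR scale_one)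
    then show ?thesis
      by (simp add: \<phi>.add \<phi>.scaleR \<phi>i c distrib_right)
  qed
  then have "bounded_klinear scale (*) \<phi>"
    using \<open>bounded_linear \<phi>\<close> by (simp add: bounded_klinear_def)
  then have "\<phi> (x - y) = 0"
    using eq \<phi>.diff by simp
  then have 0: "of_real (f (x - y)) = i * of_real (f (scale i (x - y)))"
    by (simp add: \<phi>_def)
  have "f (x - y) = 0"
    using i
  proof
    assume "i = 0"
    then show ?thesis using 0 by simp
  next
    assume ii: "i * i = - 1"
    let ?a = "f (x - y)" and ?b = "f (scale i (x - y))"
    \<comment> \<open>Squaring \<open>a = i b\<close> with real \<open>a\<close> and
      \<open>b\<close> gives \<open>a\<^sup>2 = - b\<^sup>2\<close>, hence both vanish.\<close>
    have "of_real (?a * ?a) = (i * of_real ?b) * (i * (of_real ?b :: 'k))"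
      by (simp only: of_real_mult 0)
    also have "\<dots> = (i * i) * (of_real ?b * of_real ?b)"
      by (simp add: ac_simps)
    also have "\<dots> = of_real (- (?b * ?b))"
      by (simp add: ii)
    finally have "?a * ?a = - (?b * ?b)"
      by (simp only: of_real_eq_iff)
    then have "?a * ?a + ?b * ?b = 0"
      by linarith
    then show ?thesis
      by (simp only: sum_squares_eq_zero_iff)
  qed
  then show "f x = f y"
    by (simp add: f.diff)
qed

section \<open>Integrals of continuous vector functions\<close>

lemma finite_cover_of_compact:
  fixes f :: "'a::topological_space \<Rightarrow> 'v::metric_space"
  assumes "compact K" "continuous_on UNIV f" "e > 0"
  obtains F where "finite F" "\<And>x. x \<in> K \<Longrightarrow> \<exists>c\<in>F. dist (f x) c < e"
proof -
  have "compact (f ` K)"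
    using assms(1,2) by (intro compact_continuous_image) (auto intro: continuous_on_subset)
  then obtain F where F: "finite F" "f ` K \<subseteq> (\<Union>c\<in>F. ball c e)"
    using assms(3) unfolding compact_eq_totally_bounded by metis
  have "\<exists>c\<in>F. dist (f x) c < e" if "x \<in> K" for x
  proof -
    have "f x \<in> (\<Union>c\<in>F. ball c e)"
      using F(2) that by blast
    then show ?thesis
      by (simp add: dist_commute)
  qed
  with F(1) show thesis
    by (rule that)
qed

locale compactly_carried =
  fixes \<mu> :: "'g::topological_space measure" and N K :: "'g set"
  assumes baire_prob: "baire_prob \<mu>"
    and null: "N \<in> null_sets \<mu>"
    and compact: "compact K"
    and carrier: "UNIV - N \<subseteq> K"
begin

sublocale prob_space \<mu>
  using baire_prob by (simp add: baire_prob_def)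

lemma sets_eq: "sets \<mu> = sets baire"
  using baire_prob by (simp add: baire_prob_def)

lemma space_eq: "space \<mu> = UNIV"
  using sets_eq_imp_space_eq[OF sets_eq] by (simp add: baire_def space_measure_of_conv)

text \<open>No measurability of \<open>K\<close> is involved: its complement lies in the null set
  \<open>N\<close>, which is all that \<open>AE\<close> asks for.\<close>

lemma AE_carrier: "AE x in \<mu>. x \<in> K"
  using carrier by (intro AE_I'[OF null]) auto

lemma continuous_borel_measurable_real:
  assumes "continuous_on UNIV (f :: 'g \<Rightarrow> real)"
  shows "f \<in> borel_measurable \<mu>"
proof (rule measurableI)
  fix A :: "real set" assume "A \<in> sets borel"
  then have "f -` A \<in> {f -` A | (f :: 'g \<Rightarrow> real) A. continuous_on UNIV f \<and> A \<in> sets borel}"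
    using assms by blast
  then show "f -` A \<inter> space \<mu> \<in> sets \<mu>"
    by (simp add: sets_eq space_eq baire_def)
qed simp

text \<open>An open set in a metric space is the set where a continuous real function is positive.\<close>

lemma continuous_borel_measurable:
  fixes f :: "'g \<Rightarrow> 'a::metric_space"
  assumes f: "continuous_on UNIV f"
  shows "f \<in> borel_measurable \<mu>"
proof (rule borel_measurableI)
  fix S :: "'a set" assume S: "open S"
  show "f -` S \<inter> space \<mu> \<in> sets \<mu>"
  proof (cases "S = UNIV")
    case True
    then show ?thesis by simp
  next
    case False
    then have ne: "- S \<noteq> {}" by auto
    have pos: "f x \<in> S \<longleftrightarrow> 0 < infdist (f x) (- S)" for x
      using in_closed_iff_infdist_zero[of "- S" "f x"] S ne infdist_nonneg[of "f x" "- S"]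
      by (auto simp: less_le)
    have "(\<lambda>x. infdist (f x) (- S)) \<in> borel_measurable \<mu>"
      using f by (intro continuous_borel_measurable_real continuous_on_infdist)
    then have "{x \<in> space \<mu>. 0 < infdist (f x) (- S)} \<in> sets \<mu>"
      by measurable
    also have "{x \<in> space \<mu>. 0 < infdist (f x) (- S)} = f -` S \<inter> space \<mu>"
      by (auto simp: pos)
    finally show ?thesis .
  qed
qed

lemma bounded_on_carrier:
  fixes f :: "'g \<Rightarrow> 'a::real_normed_vector"
  assumes "continuous_on UNIV f"
  obtains B where "\<And>x. x \<in> K \<Longrightarrow> norm (f x) \<le> B"
proof -
  have "compact (f ` K)"
    using assms compact by (intro compact_continuous_image) (auto intro: continuous_on_subset)
  then have "bounded (f ` K)"
    by (rule compact_imp_bounded)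
  then show thesis
    using that by (auto simp: bounded_iff)
qed

lemma integrable_continuous:
  fixes f :: "'g \<Rightarrow> 'a::{banach, second_countable_topology}"
  assumes "continuous_on UNIV f"
  shows "integrable \<mu> f"
proof -
  obtain B where B: "\<And>x. x \<in> K \<Longrightarrow> norm (f x) \<le> B"
    by (rule bounded_on_carrier[OF assms]) (rule that)
  show ?thesis
    using AE_carrier B
    by (intro integrable_const_bound[of _ B] continuous_borel_measurable assms) auto
qed

lemma simple_approximation:
  fixes f :: "'g \<Rightarrow> 'v::metric_space"
  assumes f: "continuous_on UNIV f" and e: "e > 0"
  obtains s where "simple_function \<mu> s" "\<And>x. x \<in> K \<Longrightarrow> dist (f x) (s x) < e"
proof -
  obtain F where F: "finite F" "\<And>x. x \<in> K \<Longrightarrow> \<exists>c\<in>F. dist (f x) c < e"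
    by (rule finite_cover_of_compact[OF compact f e]) (rule that)
  \<comment> \<open>Stated for all points close to \<open>F\<close> instead of for \<open>K\<close>,
    so that it makes sense for the smaller sets met in the induction.\<close>
  have "\<exists>s. simple_function \<mu> s \<and> (\<forall>x. (\<exists>c\<in>F. dist (f x) c < e) \<longrightarrow> dist (f x) (s x) < e)"
    using F(1)
  proof induction
    case empty
    have "simple_function \<mu> (\<lambda>_. undefined :: 'v)" by simp
    then show ?case by blast
  next
    case (insert c F)
    then obtain s where s: "simple_function \<mu> s"
        "\<And>x. (\<exists>c\<in>F. dist (f x) c < e) \<Longrightarrow> dist (f x) (s x) < e"
      by blast
    let ?A = "{x. dist (f x) c < e}"
    have "(\<lambda>x. dist (f x) c) \<in> borel_measurable \<mu>"
      using f by (intro continuous_borel_measurable_real continuous_on_dist continuous_on_const)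
    then have "{x \<in> space \<mu>. dist (f x) c < e} \<in> sets \<mu>"
      by measurable
    then have "simple_function \<mu> (\<lambda>x. if x \<in> ?A then c else s x)"
      using s(1) by (intro simple_function_If_set) (auto simp: space_eq)
    moreover have "dist (f x) (if x \<in> ?A then c else s x) < e"
        if "\<exists>c\<in>insert c F. dist (f x) c < e" for x
      using s(2)[of x] that by auto
    ultimately show ?case
      by (intro exI[of _ "\<lambda>x. if x \<in> ?A then c else s x"]) auto
  qed
  then show thesis
    using F(2) that by blast
qed

end

text \<open>
  The Bochner integral of the library needs a separable codomain, which Banach spaces need not be;
  the integral of a vector function is therefore characterised by its real functionals.
\<close>

definition weak_integral :: "'g measure \<Rightarrow> ('g \<Rightarrow> 'v::real_normed_vector) \<Rightarrow> 'v" where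
  "weak_integral M f = (THE I. \<forall>\<phi>. bounded_linear \<phi> \<longrightarrow> \<phi> I = (\<integral>x. \<phi> (f x) \<partial>M :: real))"

lemma weak_integral_eqI:
  fixes f :: "'g \<Rightarrow> 'v::real_normed_vector"
  assumes "\<And>\<phi>. bounded_linear \<phi> \<Longrightarrow> \<phi> I = (\<integral>x. \<phi> (f x) \<partial>M :: real)"
  shows "weak_integral M f = I"
  unfolding weak_integral_def
proof (rule the_equality)
  show "\<forall>\<phi>. bounded_linear \<phi> \<longrightarrow> \<phi> I = (\<integral>x. \<phi> (f x) \<partial>M :: real)"
  proof (intro allI impI)
    fix \<phi> :: "'v \<Rightarrow> real" assume \<phi>: "bounded_linear \<phi>"
    show "\<phi> I = (\<integral>x. \<phi> (f x) \<partial>M)"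
      by (rule assms[OF \<phi>])
  qed
  show "J = I" if "\<forall>\<phi>. bounded_linear \<phi> \<longrightarrow> \<phi> J = (\<integral>x. \<phi> (f x) \<partial>M :: real)" for J
  proof (rule functionals_separate)
    fix \<phi> :: "'v \<Rightarrow> real" assume \<phi>: "bounded_linear \<phi>"
    show "\<phi> J = \<phi> I"
      unfolding assms[OF \<phi>] by (rule that[rule_format, OF \<phi>])
  qed
qed

lemma continuous_on_bounded_linear:
  assumes "bounded_linear T" "continuous_on S f"
  shows "continuous_on S (\<lambda>x. T (f x))"
  by (rule continuous_on_compose2[OF linear_continuous_on[OF assms(1)] assms(2) subset_UNIV])

section \<open>Existence and basic properties of the weak integral\<close>

context compactly_carried
begin

lemma integrable_functional:
  fixes f :: "'g \<Rightarrow> 'v::banach" and \<phi> :: "'v \<Rightarrow> real"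
  assumes "continuous_on UNIV f" "bounded_linear \<phi>"
  shows "integrable \<mu> (\<lambda>x. \<phi> (f x))"
  by (rule integrable_continuous[OF continuous_on_bounded_linear[OF assms(2,1)]])

text \<open>\<open>c\<close> is the integral of a simple approximation, a finite sum that needs no
  separability. The error depends on the functional only through its bound \<open>B\<close>; this
  uniformity is what yields estimates in norm.\<close>

lemma weak_integral_approximation:
  fixes f :: "'g \<Rightarrow> 'v::banach"
  assumes f: "continuous_on UNIV f" and e: "e > 0"
  obtains c where
    "\<And>\<phi> B. \<lbrakk>bounded_linear \<phi>; \<And>v. \<bar>\<phi> v\<bar> \<le> B * norm v; B \<ge> 0\<rbrakk> \<Longrightarrow> \<bar>\<phi> c - (\<integral>x. \<phi> (f x) \<partial>\<mu>)\<bar> \<le> B * e"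
proof -
  obtain s where s: "simple_function \<mu> s" "\<And>x. x \<in> K \<Longrightarrow> dist (f x) (s x) < e"
    by (rule simple_approximation[OF f e]) (rule that)
  have sb: "Bochner_Integration.simple_bochner_integrable \<mu> s"
    using s(1) by (rule simple_bochner_integrable.intros) simp
  show thesis
  proof
    fix \<phi> :: "'v \<Rightarrow> real" and B
    assume \<phi>: "bounded_linear \<phi>" and B: "\<And>v. \<bar>\<phi> v\<bar> \<le> B * norm v" "B \<ge> 0"
    interpret \<phi>: bounded_linear \<phi> by fact
    let ?c = "Bochner_Integration.simple_bochner_integral \<mu> s"
    have "Bochner_Integration.simple_bochner_integrable \<mu> (\<lambda>x. \<phi> (s x))"
      using simple_bochner_integrable_compose2[of "\<lambda>x _. \<phi> x", OF _ sb sb] by (simp add: \<phi>.zero)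
    then have hs: "has_bochner_integral \<mu> (\<lambda>x. \<phi> (s x)) (\<phi> ?c)"
      using has_bochner_integral_simple_bochner_integrable
        simple_bochner_integral_linear[OF \<phi>.linear_axioms sb] by fastforce
    have int: "integrable \<mu> (\<lambda>x. \<phi> (f x))"
      by (rule integrable_functional[OF f \<phi>])
    have "\<bar>\<phi> (s x) - \<phi> (f x)\<bar> \<le> B * e" if "x \<in> K" for x
    proof -
      have "\<bar>\<phi> (s x) - \<phi> (f x)\<bar> \<le> B * norm (s x - f x)"
        using B(1)[of "s x - f x"] by (simp add: \<phi>.diff)
      also have "\<dots> \<le> B * e"
        using s(2)[OF that] B(2) by (intro mult_left_mono) (auto simp: dist_norm norm_minus_commute)
      finally show ?thesis .
    qed
    then have AE: "AE x in \<mu>. \<bar>\<phi> (s x) - \<phi> (f x)\<bar> \<le> B * e"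
      using AE_carrier by auto
    have "\<phi> ?c - (\<integral>x. \<phi> (f x) \<partial>\<mu>) = (\<integral>x. \<phi> (s x) - \<phi> (f x) \<partial>\<mu>)"
      using hs int by (simp add: has_bochner_integral_iff)
    also have "\<bar>\<dots>\<bar> \<le> (\<integral>x. \<bar>\<phi> (s x) - \<phi> (f x)\<bar> \<partial>\<mu>)"
      by (rule integral_abs_bound)
    also have "\<dots> \<le> B * e"
      using hs int AE by (intro integral_le_const) (auto simp: has_bochner_integral_iff)
    finally show "\<bar>\<phi> ?c - (\<integral>x. \<phi> (f x) \<partial>\<mu>)\<bar> \<le> B * e" .
  qed
qed

text \<open>Approximations \<open>c n\<close> with error \<open>1 / (n + 1)\<close> form a Cauchy
  sequence, as seen by testing \<open>c m - c n\<close> with a norming functional, for which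
  \<open>B = 1\<close>. Completeness provides the limit.\<close>

lemma weak_integral_exists:
  fixes f :: "'g \<Rightarrow> 'v::banach"
  assumes f: "continuous_on UNIV f"
  obtains I where "\<And>\<phi>. bounded_linear \<phi> \<Longrightarrow> \<phi> I = (\<integral>x. \<phi> (f x) \<partial>\<mu> :: real)"
proof -
  define approx where "approx c e \<longleftrightarrow> (\<forall>\<phi> B. bounded_linear \<phi> \<longrightarrow> (\<forall>v. \<bar>\<phi> v\<bar> \<le> B * norm v) \<longrightarrow> B \<ge> 0 \<longrightarrow>
      \<bar>\<phi> c - (\<integral>x. \<phi> (f x) \<partial>\<mu>)\<bar> \<le> B * e)" for c e
  have "\<exists>c. approx c (inverse (real (Suc n)))" for n
    by (rule weak_integral_approximation[OF f, of "inverse (real (Suc n))"]) (auto simp: approx_def)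
  then obtain c where "\<And>n. approx (c n) (inverse (real (Suc n)))"
    by metis
  then have c: "\<bar>\<phi> (c n) - (\<integral>x. \<phi> (f x) \<partial>\<mu>)\<bar> \<le> B * inverse (real (Suc n))"
    if "bounded_linear \<phi>" "\<And>v. \<bar>\<phi> v\<bar> \<le> B * norm v" "B \<ge> 0" for n \<phi> B
    using that by (auto simp: approx_def)
  have dist: "dist (c m) (c n) \<le> inverse (real (Suc m)) + inverse (real (Suc n))" for m n
  proof -
    obtain \<phi> where \<phi>: "bounded_linear \<phi>" "\<And>v. \<bar>\<phi> v\<bar> \<le> norm v" "\<phi> (c m - c n) = norm (c m - c n)"
      by (rule norming_functional) (rule that)
    interpret \<phi>: bounded_linear \<phi> by fact
    show ?thesis
      using c[of \<phi> 1 m] c[of \<phi> 1 n] \<phi> by (simp add: dist_norm \<phi>.diff)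
  qed
  have lim: "(\<lambda>n. inverse (real (Suc n))) \<longlonglongrightarrow> 0"
    by (rule LIMSEQ_inverse_real_of_nat)
  have "Cauchy c"
  proof (rule metric_CauchyI)
    fix e :: real assume "e > 0"
    then obtain M where M: "\<And>n. n \<ge> M \<Longrightarrow> inverse (real (Suc n)) < e / 2"
      using LIMSEQ_D[OF lim, of "e / 2"] by auto
    show "\<exists>M. \<forall>m\<ge>M. \<forall>n\<ge>M. dist (c m) (c n) < e"
      using M dist by (intro exI[of _ M]) (smt (verit) field_sum_of_halves)
  qed
  then obtain I where I: "c \<longlonglongrightarrow> I"
    using Cauchy_convergent convergent_def by blast
  have "\<phi> I = (\<integral>x. \<phi> (f x) \<partial>\<mu>)" if \<phi>: "bounded_linear \<phi>" for \<phi> :: "'v \<Rightarrow> real"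
  proof -
    interpret \<phi>: bounded_linear \<phi> by fact
    obtain B where B: "B \<ge> 0" "\<And>v. \<bar>\<phi> v\<bar> \<le> B * norm v"
      using \<phi>.nonneg_bounded by (auto simp: mult.commute)
    have "(\<lambda>n. \<phi> (c n)) \<longlonglongrightarrow> \<phi> I"
      using I by (rule \<phi>.tendsto)
    moreover have "(\<lambda>n. \<phi> (c n) - (\<integral>x. \<phi> (f x) \<partial>\<mu>)) \<longlonglongrightarrow> 0"
    proof (rule Lim_null_comparison)
      show "\<forall>\<^sub>F n in sequentially. norm (\<phi> (c n) - (\<integral>x. \<phi> (f x) \<partial>\<mu>)) \<le> B * inverse (real (Suc n))"
        using c[OF \<phi> B(2,1)] by (auto intro!: always_eventually)
      show "(\<lambda>n. B * inverse (real (Suc n))) \<longlonglongrightarrow> 0"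
        using tendsto_mult_left[OF lim, of B] by simp
    qed
    then have "(\<lambda>n. \<phi> (c n)) \<longlonglongrightarrow> (\<integral>x. \<phi> (f x) \<partial>\<mu>)"
      by (simp add: LIM_zero_iff)
    ultimately show ?thesis
      by (rule LIMSEQ_unique)
  qed
  then show thesis
    by (rule that)
qed

lemma functional_weak_integral:
  fixes f :: "'g \<Rightarrow> 'v::banach"
  assumes "continuous_on UNIV f" "bounded_linear \<phi>"
  shows "\<phi> (weak_integral \<mu> f) = (\<integral>x. \<phi> (f x) \<partial>\<mu> :: real)"
proof -
  obtain I where I: "\<And>\<phi>. bounded_linear \<phi> \<Longrightarrow> \<phi> I = (\<integral>x. \<phi> (f x) \<partial>\<mu> :: real)"
    by (rule weak_integral_exists[OF assms(1)]) (rule that)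
  have "weak_integral \<mu> f = I"
    by (rule weak_integral_eqI) (rule I)
  with I[OF assms(2)] show ?thesis
    by simp
qed

lemma weak_integral_bounded_linear:
  fixes f :: "'g \<Rightarrow> 'v::banach" and T :: "'v \<Rightarrow> 'w::banach"
  assumes f: "continuous_on UNIV f" and T: "bounded_linear T"
  shows "weak_integral \<mu> (\<lambda>x. T (f x)) = T (weak_integral \<mu> f)"
proof (rule weak_integral_eqI)
  fix \<phi> :: "'w \<Rightarrow> real" assume "bounded_linear \<phi>"
  then have "bounded_linear (\<lambda>v. \<phi> (T v))"
    using T by (rule bounded_linear_compose)
  from functional_weak_integral[OF f this]
  show "\<phi> (T (weak_integral \<mu> f)) = (\<integral>x. \<phi> (T (f x)) \<partial>\<mu>)" .
qed

text \<open>Connects with the Bochner integrals of scalar functions that occur in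
  \<open>markov_operator\<close>.\<close>

lemma weak_integral_eq_integral:
  fixes f :: "'g \<Rightarrow> 'w::{banach, second_countable_topology}"
  assumes "continuous_on UNIV f"
  shows "weak_integral \<mu> f = (\<integral>x. f x \<partial>\<mu>)"
proof (rule weak_integral_eqI)
  fix \<phi> :: "'w \<Rightarrow> real" assume \<phi>: "bounded_linear \<phi>"
  show "\<phi> (\<integral>x. f x \<partial>\<mu>) = (\<integral>x. \<phi> (f x) \<partial>\<mu>)"
    by (rule integral_bounded_linear[OF \<phi> integrable_continuous[OF assms], symmetric])
qed

lemma weak_integral_add:
  fixes f h :: "'g \<Rightarrow> 'v::banach"
  assumes f: "continuous_on UNIV f" and h: "continuous_on UNIV h"
  shows "weak_integral \<mu> (\<lambda>x. f x + h x) = weak_integral \<mu> f + weak_integral \<mu> h"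
proof (rule weak_integral_eqI)
  fix \<phi> :: "'v \<Rightarrow> real" assume \<phi>: "bounded_linear \<phi>"
  then interpret bounded_linear \<phi> .
  have "integrable \<mu> (\<lambda>x. \<phi> (f x))" "integrable \<mu> (\<lambda>x. \<phi> (h x))"
    by (rule integrable_functional[OF f \<phi>] integrable_functional[OF h \<phi>])+
  then show "\<phi> (weak_integral \<mu> f + weak_integral \<mu> h) = (\<integral>x. \<phi> (f x + h x) \<partial>\<mu>)"
    by (simp add: add functional_weak_integral[OF f \<phi>] functional_weak_integral[OF h \<phi>])
qed

lemma weak_integral_const: "weak_integral \<mu> (\<lambda>_. c) = (c :: 'v::banach)"
proof (rule weak_integral_eqI)
  fix \<phi> :: "'v \<Rightarrow> real"
  show "\<phi> c = (\<integral>x. \<phi> c \<partial>\<mu>)"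
    by (simp add: prob_space)
qed

lemma weak_integral_diff:
  fixes f h :: "'g \<Rightarrow> 'v::banach"
  assumes f: "continuous_on UNIV f" and h: "continuous_on UNIV h"
  shows "weak_integral \<mu> (\<lambda>x. f x - h x) = weak_integral \<mu> f - weak_integral \<mu> h"
  using weak_integral_add[of "\<lambda>x. f x - h x" h] f h
  by (simp add: continuous_on_diff)

text \<open>A norming functional reduces this to a real integral. The bound is asked for on
  \<open>K\<close> only, so integration is controlled by values on a compact set, as the
  compact-open topology demands.\<close>

lemma norm_weak_integral_le:
  fixes f :: "'g \<Rightarrow> 'v::banach"
  assumes f: "continuous_on UNIV f" and B: "\<And>x. x \<in> K \<Longrightarrow> norm (f x) \<le> B"
  shows "norm (weak_integral \<mu> f) \<le> B"
proof -
  obtain \<phi> where \<phi>: "bounded_linear \<phi>" "\<And>v. \<bar>\<phi> v\<bar> \<le> norm v"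
      "\<phi> (weak_integral \<mu> f) = norm (weak_integral \<mu> f)"
    by (rule norming_functional) (rule that)
  have "\<phi> (f x) \<le> B" if "x \<in> K" for x
    using \<phi>(2)[of "f x"] B[OF that] by linarith
  then have "AE x in \<mu>. \<phi> (f x) \<le> B"
    using AE_carrier by auto
  moreover have "integrable \<mu> (\<lambda>x. \<phi> (f x))"
    by (rule integrable_functional[OF f \<phi>(1)])
  ultimately have "(\<integral>x. \<phi> (f x) \<partial>\<mu>) \<le> B"
    by (intro integral_le_const)
  then show ?thesis
    using functional_weak_integral[OF f \<phi>(1)] \<phi>(3) by simp
qed

end

section \<open>The compact-open topology\<close>

lemma cochains_continuous_map:
  assumes "f \<in> cochains n W"
  shows "continuous_map (group_power n) euclidean f"
  using assms by (auto simp: cochains_def continuous_map_in_subtopology)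

lemma cochains_in: "f \<in> cochains n W \<Longrightarrow> x \<in> topspace (group_power n) \<Longrightarrow> f x \<in> W"
  by (auto simp: cochains_def continuous_map_in_subtopology)

lemma cochainsI:
  assumes "continuous_map (group_power n) euclidean f"
    and "\<And>x. x \<in> topspace (group_power n) \<Longrightarrow> f x \<in> W"
    and "\<And>x. x \<notin> topspace (group_power n) \<Longrightarrow> f x = 0"
  shows "f \<in> cochains n W"
  using assms by (auto simp: cochains_def continuous_map_in_subtopology)

lemma cochains_compact_image:
  assumes "f \<in> cochains n W" "compactin (group_power n) K"
  shows "compact (f ` K)"
  using image_compactin[OF assms(2) cochains_continuous_map[OF assms(1)]] by simp

text \<open>The distance to the complement of \<open>T\<close> is positive on \<open>K\<close> and
  attains its minimum there; that minimum is \<open>e\<close>. The case \<open>T = UNIV\<close> is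
  set apart because \<open>infdist\<close> to the empty set is \<open>0\<close> by
  convention.\<close>

lemma compact_open_separation:
  fixes K T :: "'v::metric_space set"
  assumes K: "compact K" and T: "open T" and "K \<subseteq> T"
  obtains e where "e > 0" "\<And>x y. x \<in> K \<Longrightarrow> dist x y < e \<Longrightarrow> y \<in> T"
proof (cases "K = {} \<or> T = UNIV")
  case True
  then show thesis
    by (intro that[of 1]) auto
next
  case False
  then have ne: "K \<noteq> {}" "- T \<noteq> {}"
    by auto
  have "continuous_on K (\<lambda>x. infdist x (- T))"
    by (intro continuous_on_infdist continuous_on_id)
  then obtain a where a: "a \<in> K" "\<And>x. x \<in> K \<Longrightarrow> infdist a (- T) \<le> infdist x (- T)"
    using continuous_attains_inf[OF K ne(1)] by blast
  have "a \<notin> - T"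
    using a(1) assms(3) by blast
  then have "infdist a (- T) > 0"
    using T ne(2) in_closed_iff_infdist_zero[of "- T" a] infdist_nonneg[of a "- T"]
    by (simp add: less_le closed_def)
  moreover have "y \<in> T" if "x \<in> K" "dist x y < infdist a (- T)" for x y
    using a(2)[OF that(1)] infdist_le[of y "- T" x] that(2) by fastforce
  ultimately show thesis
    by (rule that)
qed

text \<open>
  For the converse, a compact set is covered by its intersections with preimages of closed balls;
  these are compact also when the topology is not Hausdorff.
\<close>

lemma openin_compact_open:
  "openin (compact_open n W) S \<longleftrightarrow> S \<subseteq> cochains n W \<and>
     (\<forall>f\<in>S. \<exists>K e. compactin (group_power n) K \<and> e > 0 \<and>
        (\<forall>h\<in>cochains n W. (\<forall>x\<in>K. dist (f x) (h x) < e) \<longrightarrow> h \<in> S))"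
    (is "_ \<longleftrightarrow> ?nbhd S")
proof
  assume "openin (compact_open n W) S"
  then have "generate_topology_on
      {{f \<in> cochains n W. f ` K \<subseteq> U} | K U. compactin (group_power n) K \<and> openin (top_of_set W) U} S"
    by (simp add: compact_open_def openin_topology_generated_by_iff)
  then show "?nbhd S"
  proof induction
    case Empty
    show ?case by simp
  next
    case (Int a b)
    have "\<exists>K e. compactin (group_power n) K \<and> e > 0 \<and>
        (\<forall>h\<in>cochains n W. (\<forall>x\<in>K. dist (f x) (h x) < e) \<longrightarrow> h \<in> a \<inter> b)"
      if f: "f \<in> a" "f \<in> b" for f
    proof -
      obtain K e where 1: "compactin (group_power n) K" "e > 0"
          "\<forall>h\<in>cochains n W. (\<forall>x\<in>K. dist (f x) (h x) < e) \<longrightarrow> h \<in> a"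
        using Int.IH(1) f(1) by blast
      obtain K' e' where 2: "compactin (group_power n) K'" "e' > 0"
          "\<forall>h\<in>cochains n W. (\<forall>x\<in>K'. dist (f x) (h x) < e') \<longrightarrow> h \<in> b"
        using Int.IH(2) f(2) by blast
      have "compactin (group_power n) (K \<union> K')" "min e e' > 0"
        using 1 2 by (auto intro: compactin_Un)
      moreover have "\<forall>h\<in>cochains n W. (\<forall>x\<in>K \<union> K'. dist (f x) (h x) < min e e') \<longrightarrow> h \<in> a \<inter> b"
        using 1(3) 2(3) by simp
      ultimately show ?thesis by blast
    qed
    then show ?case
      using Int.IH by blast
  next
    case (UN \<K>)
    have "\<Union>\<K> \<subseteq> cochains n W"
      using UN.IH by blast
    moreover have "\<exists>K e. compactin (group_power n) K \<and> e > 0 \<and>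
        (\<forall>h\<in>cochains n W. (\<forall>x\<in>K. dist (f x) (h x) < e) \<longrightarrow> h \<in> \<Union>\<K>)"
      if f: "f \<in> \<Union>\<K>" for f
    proof -
      obtain a where a: "a \<in> \<K>" "f \<in> a"
        using f by blast
      obtain K e where "compactin (group_power n) K" "e > 0"
          "\<forall>h\<in>cochains n W. (\<forall>x\<in>K. dist (f x) (h x) < e) \<longrightarrow> h \<in> a"
        using UN.IH[OF a(1)] a(2) by blast
      with a(1) show ?thesis by blast
    qed
    ultimately show ?case by blast
  next
    case (Basis s)
    then obtain K U where K: "compactin (group_power n) K" and U: "openin (top_of_set W) U"
        and s: "s = {f \<in> cochains n W. f ` K \<subseteq> U}"
      by blast
    obtain T where T: "open T" "U = W \<inter> T"
      using U by (auto simp: openin_open)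
    have "\<exists>K e. compactin (group_power n) K \<and> e > 0 \<and>
        (\<forall>h\<in>cochains n W. (\<forall>x\<in>K. dist (f x) (h x) < e) \<longrightarrow> h \<in> s)"
      if "f \<in> s" for f
    proof -
      have f: "f \<in> cochains n W" "f ` K \<subseteq> T"
        using that s T by auto
      then obtain e where e: "e > 0" "\<And>v w. v \<in> f ` K \<Longrightarrow> dist v w < e \<Longrightarrow> w \<in> T"
        using compact_open_separation[OF cochains_compact_image[OF _ K] T(1)] by metis
      have "h \<in> s" if h: "h \<in> cochains n W" "\<forall>x\<in>K. dist (f x) (h x) < e" for h
      proof -
        have "h x \<in> T" if "x \<in> K" for x
          using e(2)[of "f x" "h x"] h(2) that by simp
        moreover have "h x \<in> W" if "x \<in> K" for x
          using cochains_in[OF h(1)] compactin_subset_topspace[OF K] that by blast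
        ultimately show ?thesis
          using h(1) by (auto simp: s T(2))
      qed
      with K e(1) show ?thesis by blast
    qed
    then show ?case
      by (auto simp: s)
  qed
next
  assume nbhd: "?nbhd S"
  show "openin (compact_open n W) S"
  proof (subst openin_subopen, rule ballI)
    fix f assume "f \<in> S"
    then obtain K e where f: "f \<in> cochains n W" and K: "compactin (group_power n) K" and e: "e > 0"
        and S: "\<And>h. h \<in> cochains n W \<Longrightarrow> (\<forall>x\<in>K. dist (f x) (h x) < e) \<Longrightarrow> h \<in> S"
      using nbhd by blast
    have "compact (f ` K)"
      using f K by (rule cochains_compact_image)
    then obtain F where F: "finite F" "f ` K \<subseteq> (\<Union>c\<in>F. ball c (e/3))"
      using e unfolding compact_eq_totally_bounded by (meson divide_pos_pos zero_less_numeral)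
    \<comment> \<open>\<open>f\<close> maps \<open>P c\<close> into the closed ball of radius
      \<open>e/3\<close>, hence into the open ball of radius \<open>2*e/3\<close> that defines
      \<open>Q c\<close>. A member of \<open>Q c\<close> is thus within \<open>2*e/3\<close> of
      \<open>c\<close> wherever \<open>f\<close> is within \<open>e/3\<close>, and the two add up to
      \<open>e\<close>.\<close>
    define P where "P c = {x \<in> topspace (group_power n). f x \<in> cball c (e/3)} \<inter> K" for c
    define Q where "Q c = {h \<in> cochains n W. h ` P c \<subseteq> W \<inter> ball c (2*e/3)}" for c
    have "compactin (group_power n) (P c)" for c
      unfolding P_def using K cochains_continuous_map[OF f]
      by (intro closed_Int_compactin closedin_continuous_map_preimage[where Y=euclidean]) auto
    moreover have "openin (top_of_set W) (W \<inter> ball c (2*e/3))" for c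
      by (simp add: openin_open_Int)
    ultimately have "openin (compact_open n W) (Q c)" for c
      unfolding compact_open_def Q_def by (intro topology_generated_by_Basis) blast
    then have "openin (compact_open n W) ((\<Inter>c\<in>F. Q c) \<inter> topspace (compact_open n W))" (is "openin _ ?T")
      using F(1) by (intro openin_INT)
    moreover have Kn: "K \<subseteq> topspace (group_power n)"
      using K by (rule compactin_subset_topspace)
    have "f \<in> Q c" for c
    proof -
      have "f x \<in> W \<inter> ball c (2*e/3)" if "x \<in> P c" for x
        using that e cochains_in[OF f] by (auto simp: P_def)
      with f show ?thesis by (auto simp: Q_def)
    qed
    moreover have top: "topspace (compact_open n W) = cochains n W"
    proof -
      have "{f \<in> cochains n W. f ` {} \<subseteq> {}} \<in>
        {{f \<in> cochains n W. f ` K \<subseteq> U} | K U. compactin (group_power n) K \<and> openin (top_of_set W) U}"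
        by blast
      then show ?thesis
        by (auto simp: compact_open_def topology_generated_by_topspace)
    qed
    ultimately have "f \<in> ?T"
      using f by auto
    moreover have "?T \<subseteq> S"
    proof
      fix h assume h: "h \<in> ?T"
      have "dist (f x) (h x) < e" if x: "x \<in> K" for x
      proof -
        obtain c where c: "c \<in> F" "dist c (f x) < e/3"
          using F(2) x by auto
        then have "x \<in> P c"
          using x Kn by (auto simp: P_def)
        moreover have "h \<in> Q c"
          using h c(1) by auto
        ultimately have "dist c (h x) < 2*e/3"
          by (auto simp: Q_def)
        with c(2) show ?thesis
          using dist_triangle3[of "f x" "h x" c] by simp
      qed
      with h show "h \<in> S"
        by (intro S) (auto simp: top)
    qed
    ultimately show "\<exists>T. openin (compact_open n W) T \<and> f \<in> T \<and> T \<subseteq> S"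
      using \<open>openin (compact_open n W) ?T\<close> by blast
  qed
qed

lemma topspace_compact_open [simp]: "topspace (compact_open n W) = cochains n W"
proof
  show "topspace (compact_open n W) \<subseteq> cochains n W"
    using openin_compact_open[of n W "topspace (compact_open n W)"] openin_topspace by blast
  have "openin (compact_open n W) (cochains n W)"
    by (auto simp: openin_compact_open intro!: exI[of _ "{}"] exI[of _ "1::real"])
  then show "cochains n W \<subseteq> topspace (compact_open n W)"
    by (rule openin_subset)
qed

lemma compact_open_neighbourhood:
  assumes f: "f \<in> cochains n W" and K: "compactin (group_power n) K" and e: "e > 0"
  obtains U where "openin (compact_open n W) U" "f \<in> U"
    "\<And>h x. h \<in> U \<Longrightarrow> x \<in> K \<Longrightarrow> dist (f x) (h x) < e"
proof
  \<comment> \<open>The bound \<open>d < e\<close> is uniform on \<open>K\<close>; it leaves room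
    for a perturbation of size \<open>(e - d) / 2\<close>, and this makes the set open.\<close>
  let ?U = "{h \<in> cochains n W. \<exists>d<e. \<forall>x\<in>K. dist (f x) (h x) \<le> d}"
  have "\<exists>K' r. compactin (group_power n) K' \<and> r > 0 \<and>
      (\<forall>h'\<in>cochains n W. (\<forall>x\<in>K'. dist (h x) (h' x) < r) \<longrightarrow> h' \<in> ?U)" if h: "h \<in> ?U" for h
  proof -
    obtain d where d: "d < e" "\<forall>x\<in>K. dist (f x) (h x) \<le> d"
      using h by blast
    have "dist (f x) (h' x) \<le> (d + e) / 2" if "x \<in> K" "\<forall>x\<in>K. dist (h x) (h' x) < (e - d) / 2" for h' x
    proof -
      have "dist (f x) (h x) \<le> d" "dist (h x) (h' x) < (e - d) / 2"
        using d that by auto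
      then have "dist (f x) (h' x) \<le> d + (e - d) / 2"
        using dist_triangle[of "f x" "h' x" "h x"] by linarith
      then show ?thesis by (simp add: field_simps)
    qed
    moreover have "(d + e) / 2 < e"
      using d(1) by simp
    ultimately have "h' \<in> ?U" if "h' \<in> cochains n W" "\<forall>x\<in>K. dist (h x) (h' x) < (e - d) / 2" for h'
      using that by blast
    then show ?thesis
      using d(1) K by (intro exI[of _ K] exI[of _ "(e - d) / 2"]) auto
  qed
  then show "openin (compact_open n W) ?U"
    unfolding openin_compact_open by blast
  show "f \<in> ?U"
    using f e by (auto intro!: exI[of _ 0])
  show "dist (f x) (h x) < e" if "h \<in> ?U" "x \<in> K" for h x
    using that by (auto intro: order_le_less_trans)
qed

lemma continuous_map_into_compact_open:
  fixes L :: "'x \<Rightarrow> (nat \<Rightarrow> 'g::topological_space) \<Rightarrow> 'v::real_normed_vector"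
  assumes "\<And>x. x \<in> topspace X \<Longrightarrow> L x \<in> cochains n W"
    and "\<And>x K e. \<lbrakk>x \<in> topspace X; compactin (group_power n) K; e > 0\<rbrakk> \<Longrightarrow>
      \<exists>U. openin X U \<and> x \<in> U \<and> (\<forall>y\<in>U. \<forall>p\<in>K. dist (L x p) (L y p) < e)"
  shows "continuous_map X (compact_open n W) L"
  unfolding continuous_map
proof (intro conjI allI impI)
  show "L ` topspace X \<subseteq> topspace (compact_open n W)"
    using assms(1) by auto
  fix S :: "((nat \<Rightarrow> 'g) \<Rightarrow> 'v) set" assume S: "openin (compact_open n W) S"
  show "openin X {x \<in> topspace X. L x \<in> S}"
  proof (subst openin_subopen, rule ballI)
    fix x assume x: "x \<in> {x \<in> topspace X. L x \<in> S}"
    then obtain K e where K: "compactin (group_power n) K" "e > 0"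
        "\<forall>h\<in>cochains n W. (\<forall>p\<in>K. dist (L x p) (h p) < e) \<longrightarrow> h \<in> S"
      using S unfolding openin_compact_open by blast
    obtain U where U: "openin X U" "x \<in> U" "\<forall>y\<in>U. \<forall>p\<in>K. dist (L x p) (L y p) < e"
      using assms(2)[OF _ K(1,2)] x by blast
    have "U \<subseteq> {x \<in> topspace X. L x \<in> S}"
      using openin_subset[OF U(1)] U(3) K(3) assms(1) by blast
    with U show "\<exists>T. openin X T \<and> x \<in> T \<and> T \<subseteq> {x \<in> topspace X. L x \<in> S}"
      by blast
  qed
qed

text \<open>Closeness on compact sets is the whole content of the topology, so an estimate from one
  compact set to another implies continuity. Translations, pullbacks and corrected restrictions are
  treated in this form.\<close>

lemma continuous_map_compact_open_lipschitz:
  fixes L :: "((nat \<Rightarrow> 'g::topological_space) \<Rightarrow> 'v::real_normed_vector) \<Rightarrow>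
      (nat \<Rightarrow> 'h::topological_space) \<Rightarrow> 'w::real_normed_vector"
  assumes S: "S \<subseteq> cochains n W" and L: "\<And>f. f \<in> S \<Longrightarrow> L f \<in> cochains m W'"
    and lip: "\<And>K'. compactin (group_power m) K' \<Longrightarrow> \<exists>K C. compactin (group_power n) K \<and> C \<ge> 0 \<and>
      (\<forall>f\<in>S. \<forall>h\<in>S. \<forall>B\<ge>0. (\<forall>x\<in>K. dist (f x) (h x) \<le> B) \<longrightarrow> (\<forall>x\<in>K'. dist (L f x) (L h x) \<le> C * B))"
  shows "continuous_map (subtopology (compact_open n W) S) (compact_open m W') L"
proof (rule continuous_map_into_compact_open)
  show "L f \<in> cochains m W'" if "f \<in> topspace (subtopology (compact_open n W) S)" for f
    using that L by simp
  fix f :: "(nat \<Rightarrow> 'g) \<Rightarrow> 'v" and K' :: "(nat \<Rightarrow> 'h) set" and e :: real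
  assume f: "f \<in> topspace (subtopology (compact_open n W) S)"
    and K': "compactin (group_power m) K'" and e: "e > 0"
  obtain K C where K: "compactin (group_power n) K" "C \<ge> 0" and
      lip': "\<forall>f\<in>S. \<forall>h\<in>S. \<forall>B\<ge>0. (\<forall>x\<in>K. dist (f x) (h x) \<le> B) \<longrightarrow> (\<forall>x\<in>K'. dist (L f x) (L h x) \<le> C * B)"
    using lip[OF K'] by blast
  \<comment> \<open>Dividing by \<open>C + 1\<close> covers \<open>C = 0\<close> and makes the final
    estimate strict.\<close>
  have pos: "e / (C + 1) > 0" and Ce: "C * (e / (C + 1)) < e"
    using e K(2) by (auto simp: field_simps)
  obtain U where U: "openin (compact_open n W) U" "f \<in> U"
      "\<And>h x. h \<in> U \<Longrightarrow> x \<in> K \<Longrightarrow> dist (f x) (h x) < e / (C + 1)"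
    by (rule compact_open_neighbourhood[OF _ K(1) pos, of f W]) (use f in auto)
  have "dist (L f p) (L h p) < e" if h: "h \<in> U \<inter> S" and p: "p \<in> K'" for h p
  proof -
    have "\<forall>x\<in>K. dist (f x) (h x) \<le> e / (C + 1)"
      using U(3) h by (auto intro: less_imp_le)
    then have "dist (L f p) (L h p) \<le> C * (e / (C + 1))"
      using lip'[rule_format, of f h "e / (C + 1)" p] f h p pos by simp
    with Ce show ?thesis by linarith
  qed
  moreover have "openin (subtopology (compact_open n W) S) (U \<inter> S)"
    using U(1) by (rule openin_subtopology_Int)
  ultimately show "\<exists>U. openin (subtopology (compact_open n W) S) U \<and> f \<in> U \<and>
      (\<forall>y\<in>U. \<forall>p\<in>K'. dist (L f p) (L y p) < e)"
    using U(2) f by (intro exI[of _ "U \<inter> S"]) auto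
qed

lemma cochains_add:
  assumes "f \<in> cochains n W" "h \<in> cochains n W" "\<And>v w. v \<in> W \<Longrightarrow> w \<in> W \<Longrightarrow> v + w \<in> W"
  shows "(\<lambda>x. f x + h x) \<in> cochains n W"
proof (rule cochainsI)
  show "continuous_map (group_power n) euclidean (\<lambda>x. f x + h x)"
    using assms(1,2) by (intro continuous_map_add cochains_continuous_map)
  show "f x + h x \<in> W" if "x \<in> topspace (group_power n)" for x
    using that by (intro assms(3) cochains_in[OF assms(1)] cochains_in[OF assms(2)])
  show "f x + h x = 0" if "x \<notin> topspace (group_power n)" for x
    using that assms(1,2) by (simp add: cochains_def)
qed

lemma continuous_map_compact_open_add:
  fixes W :: "'v::real_normed_vector set"
  assumes W: "\<And>v w. v \<in> W \<Longrightarrow> w \<in> W \<Longrightarrow> v + w \<in> W"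
  shows "continuous_map (prod_topology (compact_open n W) (compact_open n W))
    (compact_open n W :: ((nat \<Rightarrow> 'g::topological_space) \<Rightarrow> 'v) topology)
    (\<lambda>p x. fst p x + snd p x)"
proof (rule continuous_map_into_compact_open)
  show "(\<lambda>x. fst p x + snd p x) \<in> cochains n W"
    if "p \<in> topspace (prod_topology (compact_open n W) (compact_open n W))" for p
    using that W by (intro cochains_add) auto
  fix p :: "((nat \<Rightarrow> 'g) \<Rightarrow> 'v) \<times> ((nat \<Rightarrow> 'g) \<Rightarrow> 'v)" and K :: "(nat \<Rightarrow> 'g) set" and e :: real
  assume p: "p \<in> topspace (prod_topology (compact_open n W) (compact_open n W))"
    and K: "compactin (group_power n) K" and e: "e > 0"
  obtain U where U: "openin (compact_open n W) U" "fst p \<in> U"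
      "\<And>h x. h \<in> U \<Longrightarrow> x \<in> K \<Longrightarrow> dist (fst p x) (h x) < e / 2"
    by (rule compact_open_neighbourhood[OF _ K, of "fst p" W "e / 2"]) (use p e in auto)
  obtain U' where U': "openin (compact_open n W) U'" "snd p \<in> U'"
      "\<And>h x. h \<in> U' \<Longrightarrow> x \<in> K \<Longrightarrow> dist (snd p x) (h x) < e / 2"
    by (rule compact_open_neighbourhood[OF _ K, of "snd p" W "e / 2"]) (use p e in auto)
  have "dist (fst p x + snd p x) (fst q x + snd q x) < e" if "q \<in> U \<times> U'" "x \<in> K" for q x
  proof -
    have "dist (fst p x) (fst q x) < e / 2" "dist (snd p x) (snd q x) < e / 2"
      using that U(3) U'(3) by auto
    then show ?thesis
      using dist_triangle_add[of "fst p x" "snd p x" "fst q x" "snd q x"] by linarith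
  qed
  moreover have "openin (prod_topology (compact_open n W) (compact_open n W)) (U \<times> U')"
    using U(1) U'(1) by (simp add: openin_prod_Times_iff)
  moreover have "p \<in> U \<times> U'"
    using U(2) U'(2) by (simp add: mem_Times_iff)
  ultimately show "\<exists>U. openin (prod_topology (compact_open n W) (compact_open n W)) U \<and> p \<in> U \<and>
      (\<forall>q\<in>U. \<forall>x\<in>K. dist (fst p x + snd p x) (fst q x + snd q x) < e)"
    by blast
qed

section \<open>Commuting contractions and Markov operators\<close>

text \<open>
  As \<open>P\<close> and \<open>Q\<close> commute, a fixed point of \<open>v \<mapsto> P (Q v) + b + P c\<close> solves both equations.
\<close>

locale commuting_contraction =
  fixes P Q :: "'v::banach \<Rightarrow> 'v"
  assumes P: "bounded_linear P" and Q: "bounded_linear Q"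
    and commute: "P (Q v) = Q (P v)"
    and contraction: "onorm (P \<circ> Q) < 1"
begin

lemma bounded_linear_PQ: "bounded_linear (P \<circ> Q)"
  using bounded_linear_compose[OF P Q] by (simp add: o_def)

lemma norm_PQ_le: "norm (P (Q v)) \<le> onorm (P \<circ> Q) * norm v"
  using onorm[OF bounded_linear_PQ, of v] by simp

lemma P_diff: "P (v - w) = P v - P w"
  and P_add: "P (v + w) = P v + P w"
  and Q_diff: "Q (v - w) = Q v - Q w"
  and Q_add: "Q (v + w) = Q v + Q w"
  using P Q by (simp_all add: linear_diff linear_add bounded_linear.linear)

lemma fixed_point_eq_0:
  assumes "P (Q v) = v"
  shows "v = 0"
proof (rule ccontr)
  assume "v \<noteq> 0"
  then have "onorm (P \<circ> Q) * norm v < 1 * norm v"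
    using contraction by (intro mult_strict_right_mono) auto
  with norm_PQ_le[of v] assms show False by simp
qed

definition solves :: "'v \<Rightarrow> 'v \<Rightarrow> 'v \<Rightarrow> bool" where
  "solves b c v \<longleftrightarrow> v - P v = b \<and> v - Q v = c"

text \<open>Substituting \<open>v = Q v + c\<close> into \<open>v = P v + b\<close>. Both uniqueness
  and the norm bound are read off from this equation.\<close>

lemma solves_fixed_point:
  assumes "solves b c v"
  shows "v = P (Q v) + (b + P c)"
proof -
  have "P c = P v - P (Q v)"
    using assms P_diff[of v "Q v"] by (simp add: solves_def)
  then show ?thesis
    using assms by (simp add: solves_def algebra_simps)
qed

lemma solves_diff: "solves b c v \<Longrightarrow> solves b' c' v' \<Longrightarrow> solves (b - b') (c - c') (v - v')"
  by (auto simp: solves_def P_diff Q_diff)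

lemma solves_add:
  "solves b c v \<Longrightarrow> solves b' c' v' \<Longrightarrow> solves (b + b') (c + c') (v + v')"
  by (auto simp: solves_def P_add Q_add)

lemma solves_unique: "solves b c v \<Longrightarrow> solves b c v' \<Longrightarrow> v = v'"
  using solves_fixed_point[OF solves_diff, of b c v b c v'] fixed_point_eq_0[of "v - v'"]
    linear_0[OF bounded_linear.linear[OF P]] by simp

text \<open>The fixed point comes from the contraction principle. By \<open>compat\<close> and
  commutation, its defect \<open>v - Q v - c\<close> in the second equation is again fixed by
  \<open>P \<circ> Q\<close>, so it vanishes; the fixed point equation then turns into the first
  equation.\<close>

lemma solves_exists:
  assumes compat: "b - Q b = c - P c"
  shows "\<exists>v. solves b c v"
proof -
  have "\<exists>!v. P (Q v) + (b + P c) = v"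
  proof (rule banach_fix_type[OF onorm_pos_le[OF bounded_linear_PQ] contraction])
    show "\<forall>v w. dist (P (Q v) + (b + P c)) (P (Q w) + (b + P c)) \<le> onorm (P \<circ> Q) * dist v w"
      using norm_PQ_le by (simp add: dist_norm flip: P_diff Q_diff)
  qed
  then obtain v where v: "P (Q v) + (b + P c) = v"
    by metis
  have Qv: "Q (P (Q v)) + (Q b + Q (P c)) = Q v"
    using arg_cong[OF v, of Q] by (simp only: Q_add)
  let ?e = "(v - Q v) - c"
  have "v - Q v = (P (Q v) + (b + P c)) - (Q (P (Q v)) + (Q b + Q (P c)))"
    by (simp only: v Qv)
  also have "\<dots> = P (Q ?e) + c"
    using compat by (simp add: P_diff Q_diff P_add Q_add commute algebra_simps)
  finally have "P (Q ?e) = ?e"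
    by (simp add: algebra_simps)
  then have "?e = 0"
    by (rule fixed_point_eq_0)
  then have c: "v - Q v = c"
    by simp
  moreover have "v - P v = b"
  proof -
    have "P c = P v - P (Q v)"
      unfolding c[symmetric] by (rule P_diff)
    with v show ?thesis
      by (metis add.commute add_diff_cancel_left' diff_add_cancel add.assoc)
  qed
  ultimately show ?thesis
    by (auto simp: solves_def)
qed

text \<open>Taking norms in \<open>v = P (Q v) + (b + P c)\<close> and absorbing the first summand
  on the left leaves the factor \<open>1 - onorm (P \<circ> Q)\<close>. The numerator bounds
  \<open>b + P c\<close> for \<open>b\<close> and \<open>c\<close> in the unit ball.\<close>

definition resolvent_bound :: real where
  "resolvent_bound = (1 + onorm P) / (1 - onorm (P \<circ> Q))"

lemma resolvent_bound_nonneg: "resolvent_bound \<ge> 0"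
  using contraction onorm_pos_le[OF P] by (simp add: resolvent_bound_def)

lemma norm_solves_le:
  assumes "solves b c v" and "norm b \<le> B" "norm c \<le> B"
  shows "norm v \<le> resolvent_bound * B"
proof -
  have "norm v \<le> norm (P (Q v)) + norm (b + P c)"
    using solves_fixed_point[OF assms(1)] norm_triangle_ineq[of "P (Q v)" "b + P c"] by simp
  also have "\<dots> \<le> onorm (P \<circ> Q) * norm v + (norm b + onorm P * norm c)"
    using norm_PQ_le onorm[OF P, of c] norm_triangle_ineq[of b "P c"] by (intro add_mono) auto
  also have "\<dots> \<le> onorm (P \<circ> Q) * norm v + (B + onorm P * B)"
    using assms(2) mult_left_mono[OF assms(3) onorm_pos_le[OF P]] by linarith
  finally have "(1 - onorm (P \<circ> Q)) * norm v \<le> (1 + onorm P) * B"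
    by (simp add: algebra_simps)
  then show ?thesis
    using contraction by (simp add: resolvent_bound_def field_simps)
qed

end

text \<open>\<open>markov_operator\<close> tests with functionals linear over \<open>'k\<close>, the
  weak integral with real ones. A functional over \<open>'k\<close> is a bounded real linear map
  into a separable space, so it passes through the weak integral and there meets the Bochner
  integral. Uniqueness holds because functionals over \<open>'k\<close> separate points.\<close>

lemma (in compactly_carried) markov_operator_eq_weak_integral:
  fixes scale :: "'k::real_or_complex \<Rightarrow> 'v::banach \<Rightarrow> 'v"
  assumes scale: "banach_space_over scale"
    and klinear: "\<And>g. bounded_klinear scale scale (\<sigma> g)"
    and bound: "\<And>g v. norm (\<sigma> g v) \<le> M * norm v"
    and cont: "\<And>v. continuous_on UNIV (\<lambda>g. \<sigma> g v)"
  shows "markov_operator scale \<sigma> \<mu> = (\<lambda>v. weak_integral \<mu> (\<lambda>g. \<sigma> g v))" (is "_ = ?P")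
    and "bounded_klinear scale scale (\<lambda>v. weak_integral \<mu> (\<lambda>g. \<sigma> g v))"
proof -
  interpret banach_space_over scale by fact
  have lin: "bounded_linear (\<sigma> g)" and sc: "\<sigma> g (scale c v) = scale c (\<sigma> g v)" for g c v
    using klinear by (auto simp: bounded_klinear_def)
  have "bounded_linear ?P"
  proof (rule bounded_linear_intro)
    show "?P (v + w) = ?P v + ?P w" for v w
      using weak_integral_add[OF cont cont] by (simp add: linear_add[OF bounded_linear.linear[OF lin]])
    show "?P (r *\<^sub>R v) = r *\<^sub>R ?P v" for r v
      using weak_integral_bounded_linear[OF cont bounded_linear_scaleR_right]
      by (simp add: linear_scale[OF bounded_linear.linear[OF lin]])
    show "norm (?P v) \<le> norm v * M" for v
      using bound by (intro norm_weak_integral_le cont) (simp add: mult.commute)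
  qed
  moreover have "?P (scale c v) = scale c (?P v)" for c v
    unfolding sc by (rule weak_integral_bounded_linear[OF cont bounded_linear_scale])
  ultimately show klin: "bounded_klinear scale scale ?P"
    by (simp add: bounded_klinear_def)
  have eval: "\<phi> (?P v) = (\<integral>g. \<phi> (\<sigma> g v) \<partial>\<mu>)" if "bounded_klinear scale (*) \<phi>" for \<phi> :: "'v \<Rightarrow> 'k" and v
  proof -
    have \<phi>: "bounded_linear \<phi>"
      using that by (simp add: bounded_klinear_def)
    show ?thesis
      unfolding weak_integral_bounded_linear[OF cont \<phi>, symmetric]
      by (rule weak_integral_eq_integral[OF continuous_on_bounded_linear[OF \<phi> cont]])
  qed
  show "markov_operator scale \<sigma> \<mu> = ?P"
    unfolding markov_operator_def
  proof (rule the_equality)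
    show "bounded_klinear scale scale ?P \<and>
        (\<forall>v \<phi>. bounded_klinear scale (*) \<phi> \<longrightarrow> \<phi> (?P v) = (\<integral>g. \<phi> (\<sigma> g v) \<partial>\<mu>))"
      using klin eval by auto
    fix R assume R: "bounded_klinear scale scale R \<and>
        (\<forall>v \<phi>. bounded_klinear scale (*) \<phi> \<longrightarrow> \<phi> (R v) = (\<integral>g. \<phi> (\<sigma> g v) \<partial>\<mu>))"
    show "R = ?P"
    proof
      fix v
      show "R v = ?P v"
      proof (rule bounded_klinear_functionals_separate)
        fix \<phi> :: "'v \<Rightarrow> 'k" assume \<phi>: "bounded_klinear scale (*) \<phi>"
        then have "\<phi> (R v) = (\<integral>g. \<phi> (\<sigma> g v) \<partial>\<mu>)"
          using R by blast
        then show "\<phi> (R v) = \<phi> (?P v)"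
          by (simp only: eval[OF \<phi>])
      qed
    qed
  qed
qed

section \<open>Quotients of cochain spaces\<close>

lemma open_map_product:
  assumes f: "open_map X X' f" and h: "open_map Y Y' h"
  shows "open_map (prod_topology X Y) (prod_topology X' Y') (\<lambda>p. (f (fst p), h (snd p)))"
  unfolding open_map_def
proof (intro allI impI)
  fix S assume S: "openin (prod_topology X Y) S"
  show "openin (prod_topology X' Y') ((\<lambda>p. (f (fst p), h (snd p))) ` S)" (is "openin _ ?T")
    unfolding openin_prod_topology_alt
  proof (intro allI impI)
    fix a b assume "(a, b) \<in> ?T"
    then obtain p where p: "p \<in> S" "(a, b) = (f (fst p), h (snd p))"
      by (rule imageE)
    have "(fst p, snd p) \<in> S"
      using p(1) by simp
    then obtain U V where U: "openin X U" "openin Y V" "fst p \<in> U" "snd p \<in> V" "U \<times> V \<subseteq> S"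
      using S[unfolded openin_prod_topology_alt, rule_format, of "fst p" "snd p"] by metis
    have "(f u, h v) \<in> ?T" if "u \<in> U" "v \<in> V" for u v
      using U(5) that by (intro image_eqI[of _ _ "(u, v)"]) auto
    then have "f ` U \<times> h ` V \<subseteq> ?T"
      by blast
    moreover have "openin X' (f ` U)" "openin Y' (h ` V)"
      using f h U(1,2) by (simp_all add: open_map_def)
    moreover have "a \<in> f ` U" "b \<in> h ` V"
      using p(2) U(3,4) by simp_all
    ultimately show "\<exists>U V. openin X' U \<and> openin Y' V \<and> a \<in> U \<and> b \<in> V \<and> U \<times> V \<subseteq> ?T"
      by metis
  qed
qed

text \<open>Isolates what the quotient construction uses: \<open>Z\<close> and \<open>B\<close> are
  linear subspaces of cochains. It is instantiated for the product group and for each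
  factor.\<close>

locale cochain_quotient =
  fixes scale :: "'k::real_or_complex \<Rightarrow> 'v::banach \<Rightarrow> 'v" and n :: nat and W :: "'v set"
    and Z B :: "((nat \<Rightarrow> 'g::topological_space) \<Rightarrow> 'v) set"
  assumes scale: "banach_space_over scale"
    and Z_cochains: "Z \<subseteq> cochains n W"
    and Z_add: "f \<in> Z \<Longrightarrow> h \<in> Z \<Longrightarrow> (\<lambda>x. f x + h x) \<in> Z"
    and Z_scale: "f \<in> Z \<Longrightarrow> (\<lambda>x. scale c (f x)) \<in> Z"
    and B_Z: "B \<subseteq> Z"
    and B_nonempty: "B \<noteq> {}"
    and B_add: "f \<in> B \<Longrightarrow> h \<in> B \<Longrightarrow> (\<lambda>x. f x + h x) \<in> B"
    and B_scale: "f \<in> B \<Longrightarrow> (\<lambda>x. scale c (f x)) \<in> B"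
begin

sublocale S: banach_space_over scale
  by (rule scale)

definition coset :: "((nat \<Rightarrow> 'g) \<Rightarrow> 'v) \<Rightarrow> ((nat \<Rightarrow> 'g) \<Rightarrow> 'v) set" where
  "coset f = (\<lambda>b x. f x + b x) ` B"

abbreviation top :: "((nat \<Rightarrow> 'g) \<Rightarrow> 'v) topology" where
  "top \<equiv> subtopology (compact_open n W) Z"

abbreviation "quot \<equiv> quotient_by (subspace_of (cochain_space scale n W) Z) B"

lemma topspace_top [simp]: "topspace top = Z"
  using Z_cochains by auto

lemma B_0: "(\<lambda>_. 0) \<in> B"
proof -
  obtain b where "b \<in> B"
    using B_nonempty by blast
  from B_scale[OF this, of 0] show ?thesis by simp
qed

lemma B_minus: "b \<in> B \<Longrightarrow> (\<lambda>x. - b x) \<in> B"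
  using B_scale[of b "- 1"] by (simp add: S.scale_minus_left)

lemma B_diff: "b \<in> B \<Longrightarrow> b' \<in> B \<Longrightarrow> (\<lambda>x. b x - b' x) \<in> B"
  using B_add[OF _ B_minus, of b b'] by simp

lemma coset_memI: "(\<lambda>x. h x - f x) \<in> B \<Longrightarrow> h \<in> coset f"
  unfolding coset_def by (rule image_eqI) auto

lemma coset_mem_iff: "h \<in> coset f \<longleftrightarrow> (\<lambda>x. h x - f x) \<in> B"
proof
  assume "h \<in> coset f"
  then obtain b where "b \<in> B" "h = (\<lambda>x. f x + b x)"
    by (auto simp: coset_def)
  then show "(\<lambda>x. h x - f x) \<in> B" by simp
qed (rule coset_memI)

lemma coset_self: "f \<in> coset f"
  by (simp add: coset_mem_iff B_0)

lemma coset_eq_iff: "coset f = coset h \<longleftrightarrow> (\<lambda>x. f x - h x) \<in> B"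
proof
  assume "coset f = coset h"
  then show "(\<lambda>x. f x - h x) \<in> B"
    using coset_self[of f] by (simp add: coset_mem_iff)
next
  assume fh: "(\<lambda>x. f x - h x) \<in> B"
  have "(\<lambda>x. k x - h x) \<in> B \<longleftrightarrow> (\<lambda>x. k x - f x) \<in> B" for k
    using B_add[OF fh, of "\<lambda>x. k x - f x"] B_diff[OF _ fh, of "\<lambda>x. k x - h x"]
    by (auto simp: algebra_simps)
  then show "coset f = coset h"
    by (auto simp: coset_mem_iff)
qed

lemma tvs_top_quot: "tvs_top quot = quotient_topology top coset"
  by (simp add: quotient_by_def subspace_of_def cochain_space_def coset_def[abs_def])

lemma tvs_add_quot: "tvs_add quot (coset f) (coset h) = coset (\<lambda>x. f x + h x)"
proof -
  have "tvs_add quot (coset f) (coset h) = {(\<lambda>x. a x + b x) | a b. a \<in> coset f \<and> b \<in> coset h}"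
    by (simp add: quotient_by_def subspace_of_def cochain_space_def)
  also have "\<dots> = coset (\<lambda>x. f x + h x)"
  proof (intro equalityI subsetI)
    fix k assume "k \<in> {(\<lambda>x. a x + b x) | a b. a \<in> coset f \<and> b \<in> coset h}"
    then obtain a b where "k = (\<lambda>x. a x + b x)" "(\<lambda>x. a x - f x) \<in> B" "(\<lambda>x. b x - h x) \<in> B"
      by (auto simp: coset_mem_iff)
    then show "k \<in> coset (\<lambda>x. f x + h x)"
      using B_add[of "\<lambda>x. a x - f x" "\<lambda>x. b x - h x"] by (simp add: coset_mem_iff algebra_simps)
  next
    fix k assume "k \<in> coset (\<lambda>x. f x + h x)"
    then have "(\<lambda>x. k x - h x) \<in> coset f"
      by (simp add: coset_mem_iff algebra_simps)
    moreover have "k = (\<lambda>x. (k x - h x) + h x)"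
      by simp
    ultimately show "k \<in> {(\<lambda>x. a x + b x) | a b. a \<in> coset f \<and> b \<in> coset h}"
      using coset_self[of h] unfolding mem_Collect_eq by (intro exI conjI)
  qed
  finally show ?thesis .
qed

lemma tvs_scale_quot: "tvs_scale quot c (coset f) = coset (\<lambda>x. scale c (f x))"
proof -
  have "tvs_scale quot c (coset f) = {(\<lambda>x. scale c (a x) + b x) | a b. a \<in> coset f \<and> b \<in> B}"
    by (simp add: quotient_by_def subspace_of_def cochain_space_def)
  also have "\<dots> = coset (\<lambda>x. scale c (f x))"
  proof (intro equalityI subsetI)
    fix k assume "k \<in> {(\<lambda>x. scale c (a x) + b x) | a b. a \<in> coset f \<and> b \<in> B}"
    then obtain a b where "k = (\<lambda>x. scale c (a x) + b x)" "(\<lambda>x. a x - f x) \<in> B" "b \<in> B"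
      by (auto simp: coset_mem_iff)
    then show "k \<in> coset (\<lambda>x. scale c (f x))"
      using B_add[OF B_scale[of "\<lambda>x. a x - f x" c], of b]
      by (simp add: coset_mem_iff S.scale_right_diff_distrib algebra_simps)
  next
    fix k assume "k \<in> coset (\<lambda>x. scale c (f x))"
    then have "(\<lambda>x. k x - scale c (f x)) \<in> B"
      by (simp add: coset_mem_iff)
    \<comment> \<open>The summand from \<open>B\<close> carries the whole difference, so there is no
      division by \<open>c\<close> and \<open>c = 0\<close> is covered.\<close>
    moreover have "k = (\<lambda>x. scale c (f x) + (k x - scale c (f x)))"
      by simp
    ultimately show "k \<in> {(\<lambda>x. scale c (a x) + b x) | a b. a \<in> coset f \<and> b \<in> B}"
      using coset_self[of f] unfolding mem_Collect_eq by (intro exI conjI)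
  qed
  finally show ?thesis .
qed

lemma topspace_quot: "topspace (tvs_top quot) = coset ` Z"
  by (simp add: tvs_top_quot topspace_quotient_topology del: topspace_subtopology)

lemma quotient_map_coset: "quotient_map top (tvs_top quot) coset"
  unfolding tvs_top_quot by (rule quotient_map_quotient_topology)

lemma continuous_map_translate:
  assumes b: "b \<in> Z"
  shows "continuous_map top top (\<lambda>f x. f x + b x)"
  unfolding continuous_map_in_subtopology
proof
  show "continuous_map top (compact_open n W) (\<lambda>f x. f x + b x)"
  proof (rule continuous_map_compact_open_lipschitz[OF Z_cochains])
    show "(\<lambda>x. f x + b x) \<in> cochains n W" if "f \<in> Z" for f
      using Z_add[OF that b] Z_cochains by blast
    show "\<exists>K C. compactin (group_power n) K \<and> C \<ge> 0 \<and> (\<forall>f\<in>Z. \<forall>h\<in>Z. \<forall>B\<ge>0.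
        (\<forall>x\<in>K. dist (f x) (h x) \<le> B) \<longrightarrow> (\<forall>x\<in>K'. dist (f x + b x) (h x + b x) \<le> C * B))"
      if "compactin (group_power n) K'" for K'
      using that by (intro exI[of _ K'] exI[of _ 1]) auto
  qed
  show "(\<lambda>f x. f x + b x) \<in> topspace top \<rightarrow> Z"
    using Z_add[OF _ b] by auto
qed

text \<open>The saturation of an open set is a union of its translates by elements of
  \<open>B\<close>, and each of them is open since translation is continuous.\<close>

lemma open_map_coset: "open_map top (tvs_top quot) coset"
  unfolding open_map_def
proof (intro allI impI)
  fix U assume U: "openin top U"
  have UZ: "U \<subseteq> Z"
    using openin_subset[OF U] by simp
  have "{f \<in> topspace top. coset f \<in> coset ` U} = (\<Union>b\<in>B. {f \<in> topspace top. (\<lambda>x. f x + b x) \<in> U})"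
  proof (intro equalityI subsetI)
    fix f assume "f \<in> {f \<in> topspace top. coset f \<in> coset ` U}"
    then obtain u where f: "f \<in> topspace top" "u \<in> U" "coset u = coset f"
      by auto
    then have "(\<lambda>x. u x - f x) \<in> B" "(\<lambda>x. f x + (u x - f x)) \<in> U"
      by (auto simp: coset_eq_iff)
    with f(1) show "f \<in> (\<Union>b\<in>B. {f \<in> topspace top. (\<lambda>x. f x + b x) \<in> U})"
      by (intro UN_I[of "\<lambda>x. u x - f x"] CollectI conjI)
  next
    fix f assume "f \<in> (\<Union>b\<in>B. {f \<in> topspace top. (\<lambda>x. f x + b x) \<in> U})"
    then obtain b where b: "b \<in> B" "f \<in> topspace top" "(\<lambda>x. f x + b x) \<in> U"
      by blast
    then have "coset (\<lambda>x. f x + b x) = coset f"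
      by (simp add: coset_eq_iff)
    with b show "f \<in> {f \<in> topspace top. coset f \<in> coset ` U}"
      by (metis (mono_tags, lifting) imageI mem_Collect_eq)
  qed
  moreover have open_b: "openin top {f \<in> topspace top. (\<lambda>x. f x + b x) \<in> U}" if "b \<in> B" for b
    using openin_continuous_map_preimage[OF continuous_map_translate U] that B_Z by blast
  ultimately have "openin top {f \<in> topspace top. coset f \<in> coset ` U}"
    by (simp only:) (intro openin_Union ballI, blast)
  moreover have "coset ` U \<subseteq> coset ` topspace top"
    unfolding topspace_top using UZ by blast
  ultimately show "openin (tvs_top quot) (coset ` U)"
    unfolding tvs_top_quot openin_quotient_topology by blast
qed

end

text \<open>
  Continuity of the map induced by \<open>J\<close> uses that coset projections are open: products of quotient
  maps need not be quotient maps.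
\<close>

lemma topological_isomorphism_of_quotients:
  fixes scale :: "'k::real_or_complex \<Rightarrow> 'v::banach \<Rightarrow> 'v"
  assumes Q: "cochain_quotient scale n W Z B"
    and Q1: "cochain_quotient scale n W1 Z1 B1"
    and Q2: "cochain_quotient scale n W2 Z2 B2"
    and \<Pi>1: "continuous_map (subtopology (compact_open n W) Z) (subtopology (compact_open n W1) Z1) \<Pi>1"
    and \<Pi>2: "continuous_map (subtopology (compact_open n W) Z) (subtopology (compact_open n W2) Z2) \<Pi>2"
    and J: "continuous_map (prod_topology (subtopology (compact_open n W1) Z1)
        (subtopology (compact_open n W2) Z2)) (subtopology (compact_open n W) Z) J"
    and \<Pi>1_add: "\<And>f h. f \<in> Z \<Longrightarrow> h \<in> Z \<Longrightarrow> \<Pi>1 (\<lambda>x. f x + h x) = (\<lambda>x. \<Pi>1 f x + \<Pi>1 h x)"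
    and \<Pi>2_add: "\<And>f h. f \<in> Z \<Longrightarrow> h \<in> Z \<Longrightarrow> \<Pi>2 (\<lambda>x. f x + h x) = (\<lambda>x. \<Pi>2 f x + \<Pi>2 h x)"
    and \<Pi>1_scale: "\<And>f c. f \<in> Z \<Longrightarrow> \<Pi>1 (\<lambda>x. scale c (f x)) = (\<lambda>x. scale c (\<Pi>1 f x))"
    and \<Pi>2_scale: "\<And>f c. f \<in> Z \<Longrightarrow> \<Pi>2 (\<lambda>x. scale c (f x)) = (\<lambda>x. scale c (\<Pi>2 f x))"
    and \<Pi>1_B: "\<And>b. b \<in> B \<Longrightarrow> \<Pi>1 b \<in> B1"
    and \<Pi>2_B: "\<And>b. b \<in> B \<Longrightarrow> \<Pi>2 b \<in> B2"
    and J_add: "\<And>f1 f2 h1 h2. f1 \<in> Z1 \<Longrightarrow> f2 \<in> Z2 \<Longrightarrow> h1 \<in> Z1 \<Longrightarrow> h2 \<in> Z2 \<Longrightarrow>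
        J (\<lambda>x. f1 x + h1 x, \<lambda>x. f2 x + h2 x) = (\<lambda>x. J (f1, f2) x + J (h1, h2) x)"
    and J_B: "\<And>b1 b2. b1 \<in> B1 \<Longrightarrow> b2 \<in> B2 \<Longrightarrow> J (b1, b2) \<in> B"
    and J_\<Pi>: "\<And>f. f \<in> Z \<Longrightarrow> (\<lambda>x. J (\<Pi>1 f, \<Pi>2 f) x - f x) \<in> B"
    and \<Pi>1_J: "\<And>f1 f2. f1 \<in> Z1 \<Longrightarrow> f2 \<in> Z2 \<Longrightarrow> (\<lambda>x. \<Pi>1 (J (f1, f2)) x - f1 x) \<in> B1"
    and \<Pi>2_J: "\<And>f1 f2. f1 \<in> Z1 \<Longrightarrow> f2 \<in> Z2 \<Longrightarrow> (\<lambda>x. \<Pi>2 (J (f1, f2)) x - f2 x) \<in> B2"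
  shows "topologically_isomorphic (quotient_by (subspace_of (cochain_space scale n W) Z) B)
    (direct_sum (quotient_by (subspace_of (cochain_space scale n W1) Z1) B1)
      (quotient_by (subspace_of (cochain_space scale n W2) Z2) B2))"
proof -
  interpret Q: cochain_quotient scale n W Z B by fact
  interpret Q1: cochain_quotient scale n W1 Z1 B1 by fact
  interpret Q2: cochain_quotient scale n W2 Z2 B2 by fact
  have \<Pi>1_Z: "\<Pi>1 f \<in> Z1" and \<Pi>2_Z: "\<Pi>2 f \<in> Z2" if "f \<in> Z" for f
    using \<Pi>1 \<Pi>2 that Q.topspace_top by (auto simp: continuous_map_in_subtopology Pi_iff)
  have J_Z: "J (f1, f2) \<in> Z" if "f1 \<in> Z1" "f2 \<in> Z2" for f1 f2
    using J that Q1.topspace_top Q2.topspace_top by (auto simp: continuous_map_in_subtopology Pi_iff)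
  define q12 where "q12 p = (Q1.coset (fst p), Q2.coset (snd p))" for p
  define \<pi> where "\<pi> f = (Q1.coset (\<Pi>1 f), Q2.coset (\<Pi>2 f))" for f
  let ?T = "tvs_top Q.quot" and ?T12 = "prod_topology (tvs_top Q1.quot) (tvs_top Q2.quot)"
  have cont1: "continuous_map Q1.top (tvs_top Q1.quot) Q1.coset"
    and cont2: "continuous_map Q2.top (tvs_top Q2.quot) Q2.coset"
    by (intro quotient_imp_continuous_map Q1.quotient_map_coset Q2.quotient_map_coset)+
  have \<pi>_cont: "continuous_map Q.top ?T12 \<pi>"
    unfolding \<pi>_def
    using continuous_map_compose[OF \<Pi>1 cont1] continuous_map_compose[OF \<Pi>2 cont2]
    by (simp add: continuous_map_paired o_def)
  have \<pi>_cong: "\<pi> f = \<pi> h" if "f \<in> topspace Q.top" "h \<in> topspace Q.top" "Q.coset f = Q.coset h" for f h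
  proof -
    have fh: "f \<in> Z" "h \<in> Z" "(\<lambda>x. f x - h x) \<in> B"
      using that unfolding Q.topspace_top Q.coset_eq_iff by auto
    then have d: "(\<lambda>x. f x - h x) \<in> Z"
      using Q.B_Z by blast
    \<comment> \<open>Additivity applied to this sum identifies the difference of the images with
      the image of \<open>f - h\<close>, a coboundary.\<close>
    have f: "(\<lambda>x. h x + (f x - h x)) = f"
      by simp
    have "\<Pi>1 f = (\<lambda>x. \<Pi>1 h x + \<Pi>1 (\<lambda>x. f x - h x) x)" "\<Pi>2 f = (\<lambda>x. \<Pi>2 h x + \<Pi>2 (\<lambda>x. f x - h x) x)"
      using \<Pi>1_add[OF fh(2) d] \<Pi>2_add[OF fh(2) d] unfolding f by simp_all
    then have "(\<lambda>x. \<Pi>1 f x - \<Pi>1 h x) = \<Pi>1 (\<lambda>x. f x - h x)" "(\<lambda>x. \<Pi>2 f x - \<Pi>2 h x) = \<Pi>2 (\<lambda>x. f x - h x)"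
      by (simp_all add: fun_eq_iff)
    then show ?thesis
      using \<Pi>1_B[OF fh(3)] \<Pi>2_B[OF fh(3)] by (simp add: \<pi>_def Q1.coset_eq_iff Q2.coset_eq_iff)
  qed
  obtain \<Phi> where \<Phi>: "continuous_map ?T ?T12 \<Phi>"
      and "\<And>f. f \<in> topspace Q.top \<Longrightarrow> \<Phi> (Q.coset f) = \<pi> f"
    by (rule quotient_map_lift_exists[OF Q.quotient_map_coset \<pi>_cont]) (erule (2) \<pi>_cong, rule that)
  then have \<Phi>q: "\<Phi> (Q.coset f) = (Q1.coset (\<Pi>1 f), Q2.coset (\<Pi>2 f))" if "f \<in> Z" for f
    using that unfolding Q.topspace_top \<pi>_def by blast
  let ?X12 = "prod_topology Q1.top Q2.top"
  have X12: "topspace ?X12 = Z1 \<times> Z2"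
    unfolding topspace_prod_topology Q1.topspace_top Q2.topspace_top ..
  have q12: "quotient_map ?X12 ?T12 q12"
  proof (rule continuous_open_imp_quotient_map)
    show "continuous_map ?X12 ?T12 q12"
      unfolding q12_def
      by (intro continuous_map_pairedI continuous_map_compose[OF continuous_map_fst cont1, unfolded o_def]
          continuous_map_compose[OF continuous_map_snd cont2, unfolded o_def])
    show "open_map ?X12 ?T12 q12"
      unfolding q12_def by (intro open_map_product Q1.open_map_coset Q2.open_map_coset)
    show "q12 ` topspace ?X12 = topspace ?T12"
      unfolding X12 by (force simp: Q1.topspace_quot Q2.topspace_quot q12_def)
  qed
  have J_cont: "continuous_map ?X12 ?T (\<lambda>p. Q.coset (J p))"
    using continuous_map_compose[OF J quotient_imp_continuous_map[OF Q.quotient_map_coset]]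
    by (simp add: o_def)
  have J_cong: "Q.coset (J p) = Q.coset (J r)"
    if pr: "p \<in> topspace ?X12" "r \<in> topspace ?X12" "q12 p = q12 r" for p r
  proof -
    obtain f1 f2 h1 h2 where p: "p = (f1, f2)" and r: "r = (h1, h2)"
      by (metis surj_pair)
    then have Z: "f1 \<in> Z1" "f2 \<in> Z2" "h1 \<in> Z1" "h2 \<in> Z2"
      using pr unfolding X12 by auto
    have B: "(\<lambda>x. f1 x - h1 x) \<in> B1" "(\<lambda>x. f2 x - h2 x) \<in> B2"
      using pr(3) by (auto simp: q12_def p r Q1.coset_eq_iff Q2.coset_eq_iff)
    then have d: "(\<lambda>x. f1 x - h1 x) \<in> Z1" "(\<lambda>x. f2 x - h2 x) \<in> Z2"
      using Q1.B_Z Q2.B_Z by auto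
    have "J (f1, f2) = (\<lambda>x. J (h1, h2) x + J (\<lambda>x. f1 x - h1 x, \<lambda>x. f2 x - h2 x) x)"
      using J_add[OF Z(3,4) d] by simp
    then have "(\<lambda>x. J (f1, f2) x - J (h1, h2) x) = J (\<lambda>x. f1 x - h1 x, \<lambda>x. f2 x - h2 x)"
      by (simp add: fun_eq_iff)
    then show ?thesis
      using J_B[OF B] by (simp add: p r Q.coset_eq_iff)
  qed
  obtain \<Psi> where \<Psi>: "continuous_map ?T12 ?T \<Psi>"
      and "\<And>p. p \<in> topspace ?X12 \<Longrightarrow> \<Psi> (q12 p) = Q.coset (J p)"
    by (rule quotient_map_lift_exists[OF q12 J_cont]) (erule (2) J_cong, rule that)
  then have \<Psi>q: "\<Psi> (Q1.coset f1, Q2.coset f2) = Q.coset (J (f1, f2))" if "f1 \<in> Z1" "f2 \<in> Z2" for f1 f2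
    using that unfolding X12 q12_def by force
  have "homeomorphic_maps ?T ?T12 \<Phi> \<Psi>"
    unfolding homeomorphic_maps_def
  proof (intro conjI ballI \<Phi> \<Psi>)
    fix A assume "A \<in> topspace ?T"
    then obtain f where f: "f \<in> Z" "A = Q.coset f"
      unfolding Q.topspace_quot by blast
    then show "\<Psi> (\<Phi> A) = A"
      by (simp add: \<Phi>q \<Psi>q \<Pi>1_Z \<Pi>2_Z Q.coset_eq_iff J_\<Pi>)
  next
    fix A assume "A \<in> topspace ?T12"
    then obtain f1 f2 where f: "f1 \<in> Z1" "f2 \<in> Z2" "A = (Q1.coset f1, Q2.coset f2)"
      by (auto simp: Q1.topspace_quot Q2.topspace_quot)
    then show "\<Phi> (\<Psi> A) = A"
      by (simp add: \<Phi>q \<Psi>q J_Z Q1.coset_eq_iff Q2.coset_eq_iff \<Pi>1_J \<Pi>2_J)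
  qed
  then have "homeomorphic_map ?T ?T12 \<Phi>"
    using homeomorphic_maps_map by blast
  moreover have "\<Phi> (tvs_add Q.quot A A') = tvs_add (direct_sum Q1.quot Q2.quot) (\<Phi> A) (\<Phi> A')"
    if A: "A \<in> topspace ?T" "A' \<in> topspace ?T" for A A'
  proof -
    obtain f h where "f \<in> Z" "A = Q.coset f" "h \<in> Z" "A' = Q.coset h"
      using A unfolding Q.topspace_quot by blast
    then show ?thesis
      by (simp add: Q.tvs_add_quot \<Phi>q Q.Z_add \<Pi>1_add \<Pi>2_add direct_sum_def Q1.tvs_add_quot Q2.tvs_add_quot)
  qed
  moreover have "\<Phi> (tvs_scale Q.quot c A) = tvs_scale (direct_sum Q1.quot Q2.quot) c (\<Phi> A)"
    if A: "A \<in> topspace ?T" for A c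
  proof -
    obtain f where "f \<in> Z" "A = Q.coset f"
      using A unfolding Q.topspace_quot by blast
    then show ?thesis
      by (simp add: Q.tvs_scale_quot \<Phi>q Q.Z_scale \<Pi>1_scale \<Pi>2_scale direct_sum_def
          Q1.tvs_scale_quot Q2.tvs_scale_quot)
  qed
  ultimately show ?thesis
    unfolding topologically_isomorphic_def topological_isomorphism_def
    by (intro exI[of _ \<Phi>]) (simp add: direct_sum_def)
qed

section \<open>One-cocycles\<close>

lemma topspace_group_power: "topspace (group_power n) = extensional {..<n}"
  by (auto simp: group_power_def PiE_def)

lemma continuous_map_into_group_power:
  "continuous_map X (group_power n) F \<longleftrightarrow>
    F ` topspace X \<subseteq> extensional {..<n} \<and> (\<forall>i<n. continuous_map X euclidean (\<lambda>x. F x i))"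
  by (auto simp: group_power_def continuous_map_componentwise)

lemma continuous_map_group_power_component:
  "i < n \<Longrightarrow> continuous_map (group_power n) euclidean (\<lambda>x. x i)"
  unfolding group_power_def by (intro continuous_map_product_projection) simp

definition pair_point :: "'g \<Rightarrow> 'g \<Rightarrow> nat \<Rightarrow> 'g" where
  "pair_point x y = (\<lambda>i\<in>{..<2}. if i = 0 then x else y)"

lemma pair_point_simps [simp]:
  "pair_point x y 0 = x" "pair_point x y (Suc 0) = y"
  by (simp_all add: pair_point_def)

lemma pair_point_in [simp]: "pair_point x y \<in> topspace (group_power 2)"
  by (simp add: topspace_group_power pair_point_def)

lemma pair_point_eqI: "f 0 = x \<Longrightarrow> f 1 = y \<Longrightarrow> (\<lambda>i\<in>{..<2}. f i) = pair_point x y"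
  by (auto simp: pair_point_def fun_eq_iff less_2_cases_iff)

lemma pair_point_cases:
  assumes "x \<in> topspace (group_power 2)"
  obtains a b where "x = pair_point a b"
proof -
  have "x = (\<lambda>i\<in>{..<2}. x i)"
    using assms by (simp add: topspace_group_power extensional_restrict)
  then show thesis
    using that pair_point_eqI[of x "x 0" "x 1"] by simp
qed

lemma cochains_outside: "f \<in> cochains n W \<Longrightarrow> x \<notin> topspace (group_power n) \<Longrightarrow> f x = 0"
  by (simp add: cochains_def)

lemma cochains_eqI:
  assumes "f \<in> cochains 2 W" "h \<in> cochains 2 W'"
    and "\<And>a b. f (pair_point a b) = h (pair_point a b)"
  shows "f = h"
proof
  show "f x = h x" for x
    using assms by (cases "x \<in> topspace (group_power 2)") (auto elim: pair_point_cases simp: cochains_outside)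
qed

lemma continuous_map_pair_point:
  assumes "continuous_map X euclidean a" "continuous_map X euclidean b"
  shows "continuous_map X (group_power 2) (\<lambda>x. pair_point (a x) (b x))"
  unfolding continuous_map_into_group_power
  using assms by (auto simp: less_2_cases_iff pair_point_def)

lemma continuous_on_cochain_pair_point:
  assumes "f \<in> cochains 2 W" "continuous_on UNIV a" "continuous_on UNIV b"
  shows "continuous_on UNIV (\<lambda>x. f (pair_point (a x) (b x)))"
proof -
  have "continuous_map euclidean euclidean (f \<circ> (\<lambda>x. pair_point (a x) (b x)))"
    using assms by (intro continuous_map_compose[OF continuous_map_pair_point cochains_continuous_map]) auto
  then show ?thesis
    by (simp add: o_def)
qed

lemma compactin_pair_point:
  assumes "compact K" "continuous_on UNIV a" "continuous_on UNIV b"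
  shows "compactin (group_power 2) ((\<lambda>x. pair_point (a x) (b x)) ` K)"
  using assms by (intro image_compactin[of euclidean] continuous_map_pair_point) auto

text \<open>Taken along the inclusions of the factors to restrict cocycles, and along
  \<open>fst\<close> and \<open>snd\<close> to extend them to the product.\<close>

definition pullback ::
  "nat \<Rightarrow> ('g::topological_space \<Rightarrow> 'h) \<Rightarrow> ((nat \<Rightarrow> 'h) \<Rightarrow> 'v::zero) \<Rightarrow> (nat \<Rightarrow> 'g) \<Rightarrow> 'v" where
  "pullback n \<phi> f = (\<lambda>x. if x \<in> topspace (group_power n) then f (\<lambda>i\<in>{..<n}. \<phi> (x i)) else 0)"

lemma pullback_pair_point [simp]:
  "pullback 2 \<phi> f (pair_point a b) = f (pair_point (\<phi> a) (\<phi> b))"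
  by (simp add: pullback_def pair_point_eqI)

lemma continuous_map_group_power_map:
  assumes "continuous_on UNIV \<phi>"
  shows "continuous_map (group_power n) (group_power n) (\<lambda>x. \<lambda>i\<in>{..<n}. \<phi> (x i))"
proof -
  have "continuous_map (group_power n) euclidean (\<lambda>x. \<phi> (x i))" if "i < n" for i
    using continuous_map_compose[OF continuous_map_group_power_component[OF that], of euclidean \<phi>] assms
    by (simp add: o_def)
  then show ?thesis
    by (auto simp: continuous_map_into_group_power)
qed

lemma pullback_cochains:
  assumes \<phi>: "continuous_on UNIV \<phi>" and f: "f \<in> cochains n W" and W: "W \<subseteq> W'"
  shows "pullback n \<phi> f \<in> cochains n W'"
proof (rule cochainsI)
  have "continuous_map (group_power n) euclidean (f \<circ> (\<lambda>x. \<lambda>i\<in>{..<n}. \<phi> (x i)))"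
    by (rule continuous_map_compose[OF continuous_map_group_power_map[OF \<phi>] cochains_continuous_map[OF f]])
  then show "continuous_map (group_power n) euclidean (pullback n \<phi> f)"
    by (rule continuous_map_eq) (simp add: pullback_def)
  show "pullback n \<phi> f x \<in> W'" if "x \<in> topspace (group_power n)" for x
    using that W cochains_in[OF f, of "\<lambda>i\<in>{..<n}. \<phi> (x i)"]
    by (auto simp: pullback_def topspace_group_power)
qed (simp add: pullback_def)

lemma continuous_map_pullback:
  fixes f :: "(nat \<Rightarrow> 'h::topological_space) \<Rightarrow> 'v::real_normed_vector"
    and \<phi> :: "'g::topological_space \<Rightarrow> 'h"
  assumes \<phi>: "continuous_on UNIV \<phi>" and S: "S \<subseteq> cochains n W" and W: "W \<subseteq> W'"
  shows "continuous_map (subtopology (compact_open n W) S)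
    (compact_open n W' :: ((nat \<Rightarrow> 'g) \<Rightarrow> 'v) topology) (pullback n \<phi>)"
proof (rule continuous_map_compact_open_lipschitz[OF S])
  show "pullback n \<phi> f \<in> cochains n W'" if "f \<in> S" for f
    using pullback_cochains[OF \<phi> _ W] S that by blast
  fix K' :: "(nat \<Rightarrow> 'g) set" assume K': "compactin (group_power n) K'"
  let ?K = "(\<lambda>x. \<lambda>i\<in>{..<n}. \<phi> (x i)) ` K'"
  have "compactin (group_power n) ?K"
    by (rule image_compactin[OF K' continuous_map_group_power_map[OF \<phi>]])
  moreover have "dist (pullback n \<phi> f x) (pullback n \<phi> h x) \<le> 1 * B"
    if "\<forall>x\<in>?K. dist (f x) (h x) \<le> B" "x \<in> K'" for f h x and B :: real
    using that compactin_subset_topspace[OF K'] by (auto simp: pullback_def)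
  ultimately show "\<exists>K C. compactin (group_power n) K \<and> C \<ge> 0 \<and> (\<forall>f\<in>S. \<forall>h\<in>S. \<forall>B\<ge>0.
      (\<forall>x\<in>K. dist (f x) (h x) \<le> B) \<longrightarrow> (\<forall>x\<in>K'. dist (pullback n \<phi> f x) (pullback n \<phi> h x) \<le> C * B))"
    by (intro exI[of _ ?K] exI[of _ 1]) auto
qed

section \<open>Cocycles and coboundaries of degree one\<close>

lemma omit_pair_point:
  "omit 2 0 x = pair_point (x 1) (x 2)" "omit 2 1 x = pair_point (x 0) (x 2)"
  "omit 2 2 x = pair_point (x 0) (x 1)"
  unfolding omit_def by (rule pair_point_eqI; simp add: numeral_2_eq_2)+

lemma coboundary_2_eq_0_iff:
  fixes f :: "(nat \<Rightarrow> 'g::topological_space) \<Rightarrow> 'v::real_normed_vector"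
  shows "coboundary 2 f = (\<lambda>_. 0) \<longleftrightarrow>
    (\<forall>x y z. f (pair_point y z) - f (pair_point x z) + f (pair_point x y) = 0)" (is "?l \<longleftrightarrow> ?r")
proof -
  have eq: "(\<Sum>i\<le>2. (- 1) ^ i *\<^sub>R f (omit 2 i x)) =
      f (pair_point (x 1) (x 2)) - f (pair_point (x 0) (x 2)) + f (pair_point (x 0) (x 1))" for x
  proof -
    have "{..2::nat} = {0, 1, 2}" by auto
    then show ?thesis by (simp add: omit_pair_point omit_pair_point(2)[simplified])
  qed
  show ?thesis
  proof
    assume l: ?l
    show ?r
    proof (intro allI)
      fix x y z :: 'g
      let ?p = "\<lambda>i\<in>{..<Suc 2}. if i = 0 then x else if i = 1 then y else z"
      have "?p \<in> topspace (group_power (Suc 2))"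
        by (simp add: topspace_group_power)
      then have "(\<Sum>i\<le>2. (- 1) ^ i *\<^sub>R f (omit 2 i ?p)) = 0"
        using fun_cong[OF l, of ?p] by (simp add: coboundary_def)
      then show "f (pair_point y z) - f (pair_point x z) + f (pair_point x y) = 0"
        unfolding eq by simp
    qed
  next
    assume ?r
    then show ?l
      unfolding coboundary_def eq by auto
  qed
qed

lemma cocycles_1_iff:
  "f \<in> cocycles \<sigma> 1 W \<longleftrightarrow> f \<in> cochains 2 W \<and>
    (\<forall>g x y. f (pair_point (g + x) (g + y)) = \<sigma> g (f (pair_point x y))) \<and>
    (\<forall>x y z. f (pair_point y z) - f (pair_point x z) + f (pair_point x y) = 0)"
proof -
  have "f (\<lambda>i\<in>{..<2}. g + pair_point a b i) = f (pair_point (g + a) (g + b))" for g a b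
    by (simp add: pair_point_eqI)
  then have "(\<forall>g. \<forall>x\<in>topspace (group_power 2). f (\<lambda>i\<in>{..<2}. g + x i) = \<sigma> g (f x)) \<longleftrightarrow>
    (\<forall>g x y. f (pair_point (g + x) (g + y)) = \<sigma> g (f (pair_point x y)))"
    by (metis pair_point_cases pair_point_in)
  then show ?thesis
    by (simp add: cocycles_def invariant_cochains_def coboundary_2_eq_0_iff Suc_1 del: One_nat_def)
qed

locale continuous_action =
  fixes \<sigma> :: "'g::topological_group_add \<Rightarrow> 'v::banach \<Rightarrow> 'v" and M :: real
  assumes bounded_linear: "bounded_linear (\<sigma> g)"
    and action_add: "\<sigma> (g + h) v = \<sigma> g (\<sigma> h v)"
    and action_0: "\<sigma> 0 v = v"
    and norm_action_le: "norm (\<sigma> g v) \<le> M * norm v"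
    and bound_nonneg: "M \<ge> 0"
    and continuous_orbit: "continuous_on UNIV (\<lambda>g. \<sigma> g v)"
begin

text \<open>The coboundary of the invariant cochain \<open>g \<mapsto> \<sigma> g v\<close>. Here
  \<open>v\<close> ranges over the whole space, because the correcting vector need not lie in the
  coefficient module of either factor.\<close>

definition orbit_coboundary :: "'v \<Rightarrow> (nat \<Rightarrow> 'g) \<Rightarrow> 'v" where
  "orbit_coboundary v = (\<lambda>x. if x \<in> topspace (group_power 2) then \<sigma> (x 1) v - \<sigma> (x 0) v else 0)"

lemma orbit_coboundary_pair_point [simp]:
  "orbit_coboundary v (pair_point a b) = \<sigma> b v - \<sigma> a v"
  by (simp add: orbit_coboundary_def)

lemma action_diff: "\<sigma> g (v - w) = \<sigma> g v - \<sigma> g w"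
  and action_plus: "\<sigma> g (v + w) = \<sigma> g v + \<sigma> g w"
  by (rule linear_diff linear_add, rule bounded_linear.linear, rule bounded_linear)+

lemma continuous_map_orbit:
  assumes "i < n"
  shows "continuous_map (group_power n) euclidean (\<lambda>x. \<sigma> (x i) v)"
  using continuous_map_compose[OF continuous_map_group_power_component[OF assms], of euclidean "\<lambda>g. \<sigma> g v"]
    continuous_orbit by (simp add: o_def)

lemma orbit_coboundary_cochains:
  assumes "\<And>a b. \<sigma> b v - \<sigma> a v \<in> W"
  shows "orbit_coboundary v \<in> cochains 2 W"
proof (rule cochainsI)
  have "continuous_map (group_power 2) euclidean (\<lambda>x. \<sigma> (x 1) v - \<sigma> (x 0) v)"
    by (intro continuous_map_diff continuous_map_orbit) auto
  then show "continuous_map (group_power 2) euclidean (orbit_coboundary v)"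
    by (rule continuous_map_eq) (simp add: orbit_coboundary_def)
qed (use assms in \<open>auto simp: orbit_coboundary_def\<close>)

lemma orbit_coboundary_cocycles:
  assumes "\<And>a b. \<sigma> b v - \<sigma> a v \<in> W"
  shows "orbit_coboundary v \<in> cocycles \<sigma> 1 W"
  unfolding cocycles_1_iff
  using orbit_coboundary_cochains[OF assms] by (simp add: action_add action_diff)

text \<open>An invariant cochain in one argument is determined by its value \<open>v\<close> at the
  neutral element: at \<open>g\<close> it equals \<open>\<sigma> g v\<close>.\<close>

lemma coboundaries_1:
  assumes W: "\<And>g v. v \<in> W \<Longrightarrow> \<sigma> g v \<in> W"
  shows "coboundaries \<sigma> 1 W = orbit_coboundary ` W"
proof (intro equalityI subsetI)
  have cob: "coboundary 1 f x = (if x \<in> topspace (group_power 2) then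
      f (\<lambda>i\<in>{..<1}. x 1) - f (\<lambda>i\<in>{..<1}. x 0) else 0)" for f :: "(nat \<Rightarrow> 'g) \<Rightarrow> 'v" and x
  proof -
    have "omit 1 0 x = (\<lambda>i\<in>{..<1}. x 1)" "omit 1 1 x = (\<lambda>i\<in>{..<1}. x 0)"
      by (auto simp: omit_def fun_eq_iff)
    moreover have "{..1::nat} = {0, 1}" by auto
    ultimately show ?thesis
      by (simp add: coboundary_def numeral_2_eq_2)
  qed
  {
    fix c :: "(nat \<Rightarrow> 'g) \<Rightarrow> 'v" assume "c \<in> coboundaries \<sigma> 1 W"
    then obtain f where f: "f \<in> invariant_cochains \<sigma> 1 W" and c: "c = coboundary 1 f"
      by (auto simp: coboundaries_def)
    let ?p = "\<lambda>g. \<lambda>i\<in>{..<1::nat}. g :: 'g"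
    have p: "?p g \<in> topspace (group_power 1)" for g
      by (simp add: topspace_group_power)
    have inv: "f (?p g) = \<sigma> g (f (?p 0))" for g
    proof -
      have "f (\<lambda>i\<in>{..<1}. g + ?p 0 i) = \<sigma> g (f (?p 0))"
        using f p unfolding invariant_cochains_def by blast
      moreover have "(\<lambda>i\<in>{..<1}. g + ?p 0 i) = ?p g"
        by (auto simp: fun_eq_iff)
      ultimately show ?thesis by simp
    qed
    have "c x = orbit_coboundary (f (?p 0)) x" for x
      unfolding c cob orbit_coboundary_def inv[of "x 1"] inv[of "x 0"] by (rule refl)
    then have "c = orbit_coboundary (f (?p 0))"
      by (rule ext)
    moreover have "f \<in> cochains 1 W"
      using f unfolding invariant_cochains_def by blast
    then have "f (?p 0) \<in> W"
      using p by (rule cochains_in)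
    ultimately show "c \<in> orbit_coboundary ` W"
      by blast
  next
    fix c assume "c \<in> orbit_coboundary ` W"
    then obtain v where v: "v \<in> W" and c: "c = orbit_coboundary v"
      by blast
    let ?f = "\<lambda>x. if x \<in> topspace (group_power 1) then \<sigma> (x 0) v else 0"
    have "?f \<in> cochains 1 W"
    proof (rule cochainsI)
      have "continuous_map (group_power 1) euclidean (\<lambda>x. \<sigma> (x 0) v)"
        by (rule continuous_map_orbit) simp
      then show "continuous_map (group_power 1) euclidean ?f"
        by (rule continuous_map_eq) simp
    qed (use W v in auto)
    then have "?f \<in> invariant_cochains \<sigma> 1 W"
      by (auto simp: invariant_cochains_def topspace_group_power action_add)
    moreover have "c = coboundary 1 ?f"
      unfolding c by (rule ext) (simp add: cob orbit_coboundary_def topspace_group_power del: One_nat_def)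
    ultimately show "c \<in> coboundaries \<sigma> 1 W"
      by (auto simp: coboundaries_def)
  }
qed

end

text \<open>The point \<open>(a, b)\<close> is the left translate by \<open>a\<close> of
  \<open>(0, - a + b)\<close>, so by invariance a cocycle is determined by
  \<open>b g = f (0, g)\<close>. The coefficient sets may differ.\<close>

lemma cocycles_eqI:
  fixes f h :: "(nat \<Rightarrow> 'g::topological_group_add) \<Rightarrow> 'v::real_normed_vector"
  assumes f: "f \<in> cocycles \<sigma> 1 W" and h: "h \<in> cocycles \<sigma> 1 W'"
    and eq: "\<And>x. f (pair_point 0 x) = h (pair_point 0 x)"
  shows "f = h"
proof (rule cochains_eqI)
  show "f \<in> cochains 2 W" "h \<in> cochains 2 W'"
    using f h unfolding cocycles_1_iff by blast+
  show "f (pair_point a b) = h (pair_point a b)" for a b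
  proof -
    have "f (pair_point (a + 0) (a + (- a + b))) = h (pair_point (a + 0) (a + (- a + b)))"
      using f h eq[of "- a + b"] unfolding cocycles_1_iff by metis
    then show ?thesis
      by (simp flip: add.assoc)
  qed
qed

lemma cocycle_trans:
  fixes f :: "(nat \<Rightarrow> 'g::topological_group_add) \<Rightarrow> 'v::real_normed_vector"
  assumes "f \<in> cocycles \<sigma> 1 W"
  shows "f (pair_point x z) = f (pair_point x y) + f (pair_point y z)"
proof -
  have "f (pair_point y z) - f (pair_point x z) + f (pair_point x y) = 0"
    using assms unfolding cocycles_1_iff by blast
  then show ?thesis
    by (simp add: algebra_simps eq_neg_iff_add_eq_0)
qed

lemma cocycle_translate:
  fixes f :: "(nat \<Rightarrow> 'g::topological_group_add) \<Rightarrow> 'v::real_normed_vector"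
  assumes "f \<in> cocycles \<sigma> 1 W"
  shows "f (pair_point g (g + x)) = \<sigma> g (f (pair_point 0 x))"
proof -
  have "f (pair_point (g + 0) (g + x)) = \<sigma> g (f (pair_point 0 x))"
    using assms unfolding cocycles_1_iff by blast
  then show ?thesis by simp
qed

lemma cocycle_diagonal:
  fixes f :: "(nat \<Rightarrow> 'g::topological_group_add) \<Rightarrow> 'v::real_normed_vector"
  assumes "f \<in> cocycles \<sigma> 1 W"
  shows "f (pair_point x x) = 0"
  using cocycle_trans[OF assms, of x x x] by simp

lemma cocycles_cochains: "f \<in> cocycles \<sigma> 1 W \<Longrightarrow> f \<in> cochains 2 W"
  unfolding cocycles_1_iff by blast

lemma cochains_scale:
  fixes scale :: "'k::real_or_complex \<Rightarrow> 'v::banach \<Rightarrow> 'v"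
  assumes "banach_space_over scale" "f \<in> cochains n W" "\<And>v. v \<in> W \<Longrightarrow> scale c v \<in> W"
  shows "(\<lambda>x. scale c (f x)) \<in> cochains n W"
proof -
  interpret banach_space_over scale by fact
  show ?thesis
  proof (rule cochainsI)
    have "continuous_map (group_power n) euclidean (scale c \<circ> f)"
      using linear_continuous_on[OF bounded_linear_scale, of UNIV c]
      by (intro continuous_map_compose[OF cochains_continuous_map[OF assms(2)]]) simp
    then show "continuous_map (group_power n) euclidean (\<lambda>x. scale c (f x))"
      by (simp add: o_def)
  qed (use assms(3) cochains_in[OF assms(2)] in \<open>auto simp: cochains_outside[OF assms(2)]\<close>)
qed

context continuous_action
begin

lemma orbit_coboundary_add:
  "(\<lambda>x. orbit_coboundary v x + orbit_coboundary w x) = orbit_coboundary (v + w)"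
  by (auto simp: orbit_coboundary_def action_plus)

lemma cochain_quotient_cohomology:
  fixes scale :: "'k::real_or_complex \<Rightarrow> 'v \<Rightarrow> 'v"
  assumes scale: "banach_space_over scale"
    and klinear: "\<And>g c v. \<sigma> g (scale c v) = scale c (\<sigma> g v)"
    and W_0: "0 \<in> W" and W_add: "\<And>v w. v \<in> W \<Longrightarrow> w \<in> W \<Longrightarrow> v + w \<in> W"
    and W_scale: "\<And>c v. v \<in> W \<Longrightarrow> scale c v \<in> W"
    and W_action: "\<And>g v. v \<in> W \<Longrightarrow> \<sigma> g v \<in> W"
  shows "cochain_quotient scale 2 W (cocycles \<sigma> 1 W) (coboundaries \<sigma> 1 W)"
proof -
  interpret S: banach_space_over scale by fact
  have W_diff: "v - w \<in> W" if "v \<in> W" "w \<in> W" for v w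
    using W_add[OF that(1) W_scale[OF that(2), of "- 1"]] by (simp add: S.scale_minus_left)
  have B: "coboundaries \<sigma> 1 W = orbit_coboundary ` W"
    using W_action by (rule coboundaries_1)
  show ?thesis
  proof
    show "cocycles \<sigma> 1 W \<subseteq> cochains 2 W"
      using cocycles_cochains by blast
    show "(\<lambda>x. f x + h x) \<in> cocycles \<sigma> 1 W" if "f \<in> cocycles \<sigma> 1 W" "h \<in> cocycles \<sigma> 1 W" for f h
      unfolding cocycles_1_iff
    proof (intro conjI allI)
      show "(\<lambda>x. f x + h x) \<in> cochains 2 W"
        using that cocycles_cochains W_add by (intro cochains_add)
      show "f (pair_point (g + x) (g + y)) + h (pair_point (g + x) (g + y))
          = \<sigma> g (f (pair_point x y) + h (pair_point x y))" for g x y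
        using that unfolding cocycles_1_iff by (simp add: action_plus)
      show "f (pair_point y z) + h (pair_point y z) - (f (pair_point x z) + h (pair_point x z)) +
          (f (pair_point x y) + h (pair_point x y)) = 0" for x y z
        using cocycle_trans[OF that(1), of x z y] cocycle_trans[OF that(2), of x z y] by simp
    qed
    show "(\<lambda>x. scale c (f x)) \<in> cocycles \<sigma> 1 W" if "f \<in> cocycles \<sigma> 1 W" for f c
      unfolding cocycles_1_iff
    proof (intro conjI allI)
      show "(\<lambda>x. scale c (f x)) \<in> cochains 2 W"
        by (rule cochains_scale[OF scale cocycles_cochains[OF that] W_scale])
      show "scale c (f (pair_point (g + x) (g + y))) = \<sigma> g (scale c (f (pair_point x y)))" for g x y
        using that unfolding cocycles_1_iff by (simp add: klinear)
      show "scale c (f (pair_point y z)) - scale c (f (pair_point x z)) + scale c (f (pair_point x y)) = 0"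
        for x y z
        using cocycle_trans[OF that, of x z y] by (simp add: S.scale_right_distrib)
    qed
    show "coboundaries \<sigma> 1 W \<subseteq> cocycles \<sigma> 1 W"
      unfolding B
    proof (rule image_subsetI)
      show "orbit_coboundary v \<in> cocycles \<sigma> 1 W" if "v \<in> W" for v
        by (rule orbit_coboundary_cocycles[OF W_diff[OF W_action[OF that] W_action[OF that]]])
    qed
    show "coboundaries \<sigma> 1 W \<noteq> {}"
      unfolding B using W_0 by blast
    show "(\<lambda>x. f x + h x) \<in> coboundaries \<sigma> 1 W"
      if "f \<in> coboundaries \<sigma> 1 W" "h \<in> coboundaries \<sigma> 1 W" for f h
      using that W_add unfolding B by (auto simp: orbit_coboundary_add)
    show "(\<lambda>x. scale c (f x)) \<in> coboundaries \<sigma> 1 W" if f: "f \<in> coboundaries \<sigma> 1 W" for f c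
    proof -
      obtain v where v: "v \<in> W" "f = orbit_coboundary v"
        using f unfolding B by blast
      have "(\<lambda>x. scale c (f x)) = orbit_coboundary (scale c v)"
        by (auto simp: v orbit_coboundary_def klinear S.scale_right_diff_distrib)
      then show ?thesis
        unfolding B using v(1) W_scale by blast
    qed
  qed
qed

end

section \<open>Restriction along a homomorphism, corrected by a coboundary\<close>

locale group_hom_action = continuous_action \<rho> M
  for \<rho> :: "'g::topological_group_add \<Rightarrow> 'v::banach \<Rightarrow> 'v" and M +
  fixes \<iota> :: "'h::topological_group_add \<Rightarrow> 'g"
  assumes hom_add: "\<iota> (a + b) = \<iota> a + \<iota> b"
    and hom_continuous: "continuous_on UNIV \<iota>"
begin

lemma hom_0: "\<iota> 0 = 0"
proof -
  have "\<iota> 0 + \<iota> 0 = \<iota> 0 + 0"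
    using hom_add[of 0 0] by simp
  then show ?thesis
    by (simp only: add_left_cancel)
qed

sublocale restricted: continuous_action "\<lambda>h. \<rho> (\<iota> h)" M
proof (rule continuous_action.intro)
  show "continuous_on UNIV (\<lambda>h. \<rho> (\<iota> h) v)" for v
    using continuous_on_compose2[OF continuous_orbit hom_continuous] by simp
qed (simp_all add: bounded_linear hom_add hom_0 action_add action_0 norm_action_le bound_nonneg)

text \<open>Passes to the same class over the full space, with \<open>v\<close> free to move the
  values into a smaller module. At \<open>(0, h)\<close> it takes the value
  \<open>f (0, \<iota> h) + \<rho> (\<iota> h) v - v\<close>.\<close>

definition corrected :: "((nat \<Rightarrow> 'g) \<Rightarrow> 'v) \<Rightarrow> 'v \<Rightarrow> (nat \<Rightarrow> 'h) \<Rightarrow> 'v" where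
  "corrected f v = (\<lambda>x. pullback 2 \<iota> f x + restricted.orbit_coboundary v x)"

lemma corrected_pair_point:
  "corrected f v (pair_point a b) = f (pair_point (\<iota> a) (\<iota> b)) + (\<rho> (\<iota> b) v - \<rho> (\<iota> a) v)"
  by (simp add: corrected_def)

text \<open>It suffices that the values at the points \<open>(0, h)\<close> lie in \<open>W\<close>:
  every other value is the translate of such a value by some \<open>\<rho> (\<iota> a)\<close>, and
  \<open>W\<close> is invariant.\<close>

lemma corrected_cocycles:
  assumes f: "f \<in> cocycles \<rho> 1 W'"
    and W: "\<And>h. f (pair_point 0 (\<iota> h)) + \<rho> (\<iota> h) v - v \<in> W"
    and W_action: "\<And>h w. w \<in> W \<Longrightarrow> \<rho> (\<iota> h) w \<in> W"
  shows "corrected f v \<in> cocycles (\<lambda>h. \<rho> (\<iota> h)) 1 W"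
  unfolding cocycles_1_iff
proof (intro conjI allI)
  \<comment> \<open>Continuity is obtained with the whole space as codomain, since the two summands
    need not take values in \<open>W\<close> separately.\<close>
  have cochain: "corrected f v \<in> cochains 2 UNIV"
    unfolding corrected_def
    by (intro cochains_add pullback_cochains[OF hom_continuous cocycles_cochains[OF f]]
        restricted.orbit_coboundary_cochains) auto
  have in_W: "corrected f v (pair_point a b) \<in> W" for a b
  proof -
    have "f (pair_point (\<iota> a) (\<iota> a + \<iota> (- a + b))) = \<rho> (\<iota> a) (f (pair_point 0 (\<iota> (- a + b))))"
      by (rule cocycle_translate[OF f])
    moreover have "\<iota> a + \<iota> (- a + b) = \<iota> b"
      by (simp flip: hom_add add.assoc)
    moreover have "\<rho> (\<iota> b) v = \<rho> (\<iota> a) (\<rho> (\<iota> (- a + b)) v)"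
      by (simp flip: action_add hom_add add.assoc)
    ultimately have "corrected f v (pair_point a b) =
        \<rho> (\<iota> a) (f (pair_point 0 (\<iota> (- a + b))) + \<rho> (\<iota> (- a + b)) v - v)"
      by (simp add: corrected_pair_point action_plus action_diff)
    then show ?thesis
      using W W_action by simp
  qed
  show "corrected f v \<in> cochains 2 W"
  proof (rule cochainsI[OF cochains_continuous_map[OF cochain]])
    show "corrected f v x \<in> W" if "x \<in> topspace (group_power 2)" for x
      using that in_W by (metis pair_point_cases)
  qed (rule cochains_outside[OF cochain])
  show "corrected f v (pair_point (g + x) (g + y)) = \<rho> (\<iota> g) (corrected f v (pair_point x y))" for g x y
    using f unfolding cocycles_1_iff
    by (simp add: corrected_pair_point hom_add action_plus action_diff action_add)
  show "corrected f v (pair_point y z) - corrected f v (pair_point x z) + corrected f v (pair_point x y) = 0"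
    for x y z
    using cocycle_trans[OF f, of "\<iota> x" "\<iota> z" "\<iota> y"] by (simp add: corrected_pair_point)
qed

lemma corrected_add:
  "corrected (\<lambda>x. f x + h x) (v + w) = (\<lambda>x. corrected f v x + corrected h w x)"
  by (auto simp: corrected_def pullback_def restricted.orbit_coboundary_def action_plus)

lemma corrected_scale:
  fixes scale :: "'k::real_or_complex \<Rightarrow> 'v \<Rightarrow> 'v"
  assumes "banach_space_over scale" "\<And>g v. \<rho> g (scale c v) = scale c (\<rho> g v)"
  shows "corrected (\<lambda>x. scale c (f x)) (scale c v) = (\<lambda>x. scale c (corrected f v x))"
proof -
  interpret S: banach_space_over scale by fact
  show ?thesis
    by (auto simp: corrected_def pullback_def restricted.orbit_coboundary_def assms(2)
        S.scale_right_distrib S.scale_right_diff_distrib)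
qed

text \<open>\<open>- w\<close> is the vector that \<open>corrector\<close> assigns to this
  coboundary, so the retractions send coboundaries to zero exactly.\<close>

lemma corrected_orbit_coboundary: "corrected (orbit_coboundary w) (- w) = (\<lambda>_. 0)"
proof -
  have "\<rho> g (- w) = - \<rho> g w" for g
    using action_diff[of g 0 w] action_diff[of g 0 0] by simp
  then show ?thesis
    by (auto simp: corrected_def pullback_def restricted.orbit_coboundary_def orbit_coboundary_def
        topspace_group_power)
qed

text \<open>In the constant \<open>1 + 2 * M * R\<close>, the \<open>1\<close> accounts for the
  restriction of \<open>f\<close>, and each of the two orbit terms contributes \<open>M * R\<close>.
  \<open>K0\<close> is the compact set that controls \<open>v f\<close>, whatever compact set is
  tested on the target side.\<close>

lemma continuous_map_corrected:
  assumes Z: "Z \<subseteq> cochains 2 W" and K0: "compactin (group_power 2) K0" and R: "R \<ge> 0"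
    and v: "\<And>f h B. \<lbrakk>f \<in> Z; h \<in> Z; B \<ge> 0; \<forall>x\<in>K0. dist (f x) (h x) \<le> B\<rbrakk> \<Longrightarrow> norm (v f - v h) \<le> R * B"
    and W': "\<And>f. f \<in> Z \<Longrightarrow> corrected f (v f) \<in> cochains 2 W'"
  shows "continuous_map (subtopology (compact_open 2 W) Z) (compact_open 2 W') (\<lambda>f. corrected f (v f))"
proof (rule continuous_map_compact_open_lipschitz[OF Z W'])
  fix K' :: "(nat \<Rightarrow> 'h) set" assume K': "compactin (group_power 2) K'"
  let ?K = "(\<lambda>x. \<lambda>i\<in>{..<2}. \<iota> (x i)) ` K' \<union> K0"
  have "compactin (group_power 2) ?K"
    by (intro compactin_Un K0 image_compactin[OF K' continuous_map_group_power_map[OF hom_continuous]])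
  moreover have "dist (corrected f (v f) x) (corrected h (v h) x) \<le> (1 + 2 * M * R) * B"
    if fh: "f \<in> Z" "h \<in> Z" "B \<ge> 0" "\<forall>x\<in>?K. dist (f x) (h x) \<le> B" and x: "x \<in> K'" for f h x B
  proof -
    have "x \<in> topspace (group_power 2)"
      using compactin_subset_topspace[OF K'] x by blast
    then obtain a b where ab: "x = pair_point a b"
      by (rule pair_point_cases)
    have vB: "norm (v f - v h) \<le> R * B"
      using fh by (intro v) auto
    have act: "norm (\<rho> g (v f - v h)) \<le> M * (R * B)" for g
      using norm_action_le[of g "v f - v h"] mult_left_mono[OF vB bound_nonneg] by linarith
    have "(\<lambda>i\<in>{..<2}. \<iota> (x i)) = pair_point (\<iota> a) (\<iota> b)"
      by (simp add: ab pair_point_eqI)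
    then have "dist (f (pair_point (\<iota> a) (\<iota> b))) (h (pair_point (\<iota> a) (\<iota> b))) \<le> B"
      using fh(4) x by (metis UnI1 imageI)
    then have "norm (f (pair_point (\<iota> a) (\<iota> b)) - h (pair_point (\<iota> a) (\<iota> b))) \<le> B"
      by (simp add: dist_norm)
    moreover have "corrected f (v f) x - corrected h (v h) x =
        (f (pair_point (\<iota> a) (\<iota> b)) - h (pair_point (\<iota> a) (\<iota> b))) +
        (\<rho> (\<iota> b) (v f - v h) - \<rho> (\<iota> a) (v f - v h))"
      by (simp add: ab corrected_pair_point action_diff)
    moreover have "norm (d + (p - q)) \<le> norm d + (norm p + norm q)" for d p q :: 'v
      using norm_triangle_ineq[of d "p - q"] norm_triangle_ineq4[of p q] by linarith
    ultimately have "norm (corrected f (v f) x - corrected h (v h) x) \<le> B + (M * (R * B) + M * (R * B))"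
      using act[of "\<iota> a"] act[of "\<iota> b"] by (smt (verit))
    then show ?thesis
      by (simp add: dist_norm algebra_simps)
  qed
  ultimately show "\<exists>K C. compactin (group_power 2) K \<and> C \<ge> 0 \<and> (\<forall>f\<in>Z. \<forall>h\<in>Z. \<forall>B\<ge>0.
      (\<forall>x\<in>K. dist (f x) (h x) \<le> B) \<longrightarrow>
      (\<forall>x\<in>K'. dist (corrected f (v f) x) (corrected h (v h) x) \<le> C * B))"
    using R bound_nonneg by (intro exI[of _ ?K] exI[of _ "1 + 2 * M * R"]) auto
qed

end

text \<open>Meant for the two projections: a vector fixed by one factor is moved by the product only
  through the other factor, so equivariance for that factor gives equivariance for the
  product.\<close>

lemma pullback_cocycles:
  assumes \<pi>: "\<And>x y. \<pi> (x + y) = \<pi> x + \<pi> y" "continuous_on UNIV \<pi>"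
    and f: "f \<in> cocycles \<sigma> 1 W" and eq: "\<And>x w. w \<in> W \<Longrightarrow> \<rho> x w = \<sigma> (\<pi> x) w"
  shows "pullback 2 \<pi> f \<in> cocycles \<rho> 1 UNIV"
  unfolding cocycles_1_iff
proof (intro conjI allI)
  show "pullback 2 \<pi> f \<in> cochains 2 UNIV"
    by (rule pullback_cochains[OF \<pi>(2) cocycles_cochains[OF f]]) simp
  show "pullback 2 \<pi> f (pair_point (g + x) (g + y)) = \<rho> g (pullback 2 \<pi> f (pair_point x y))" for g x y
    using f eq cochains_in[OF cocycles_cochains[OF f] pair_point_in]
    unfolding cocycles_1_iff by (simp add: \<pi>(1))
  show "pullback 2 \<pi> f (pair_point y z) - pullback 2 \<pi> f (pair_point x z) + pullback 2 \<pi> f (pair_point x y) = 0"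
    for x y z
    using f unfolding cocycles_1_iff by simp
qed

section \<open>Averages of an action and of cocycle identities\<close>

locale averaged_action = continuous_action \<sigma> M + compactly_carried \<mu> N K
  for \<sigma> :: "'g::topological_group_add \<Rightarrow> 'v::banach \<Rightarrow> 'v" and M and \<mu> :: "'g measure" and N K
begin

definition average :: "'v \<Rightarrow> 'v" where
  "average v = weak_integral \<mu> (\<lambda>g. \<sigma> g v)"

lemma average_klinear:
  fixes scale :: "'k::real_or_complex \<Rightarrow> 'v \<Rightarrow> 'v"
  assumes "banach_space_over scale" "\<And>g c v. \<sigma> g (scale c v) = scale c (\<sigma> g v)"
  shows "markov_operator scale \<sigma> \<mu> = average" "bounded_klinear scale scale average"
  using markov_operator_eq_weak_integral[OF assms(1), of \<sigma> M] assms(2)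
  by (simp_all add: bounded_klinear_def bounded_linear norm_action_le continuous_orbit average_def[abs_def])

lemma average_commute:
  assumes "bounded_linear T" "\<And>g v. T (\<sigma> g v) = \<sigma> g (T v)"
  shows "T (average v) = average (T v)"
  using weak_integral_bounded_linear[OF continuous_orbit assms(1), of v]
  by (simp add: average_def assms(2))

text \<open>Both sides of \<open>compat\<close> are integrated over \<open>g\<close>. For a cocycle,
  \<open>c\<close> is its restriction to the averaged factor, and \<open>T\<close> acts through the
  other factor.\<close>

lemma average_diff_eq:
  assumes c: "continuous_on UNIV c" and T: "bounded_linear T"
    and compat: "\<And>g. b - \<sigma> g b = c g - T (c g)"
  shows "b - average b = weak_integral \<mu> c - T (weak_integral \<mu> c)"
proof -
  have "b - average b = weak_integral \<mu> (\<lambda>g. b - \<sigma> g b)"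
    by (simp add: average_def weak_integral_diff weak_integral_const continuous_orbit)
  also have "\<dots> = weak_integral \<mu> c - T (weak_integral \<mu> c)"
    unfolding compat
    by (simp add: weak_integral_diff weak_integral_bounded_linear c T continuous_on_bounded_linear)
  finally show ?thesis .
qed

text \<open>Writing \<open>A\<close> for the average,
  \<open>(1 - A) b = (1 - T) (1 - A) v = (1 - A) (v - T v)\<close>, because \<open>A\<close> and
  \<open>T\<close> commute. Hence \<open>1 - A\<close> annihilates
  \<open>b + T v - v\<close>.\<close>

lemma average_fixes_corrected:
  assumes c: "continuous_on UNIV c" and T: "bounded_linear T" "\<And>g v. T (\<sigma> g v) = \<sigma> g (T v)"
    and compat: "\<And>g. b - \<sigma> g b = c g - T (c g)"
    and avg: "bounded_linear average" and v: "v - average v = weak_integral \<mu> c"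
  shows "average (b + T v - v) = b + T v - v"
proof -
  interpret A: bounded_linear average by fact
  interpret T: bounded_linear T by fact
  have "b - average b = (v - average v) - (T v - average (T v))"
    unfolding average_diff_eq[OF c T(1) compat] v[symmetric] T.diff average_commute[OF T] ..
  then show ?thesis
    by (simp add: A.add A.diff algebra_simps)
qed

end

section \<open>Modules over a product\<close>

lemma uniformly_bounded_module_continuous_action:
  fixes scale :: "'k \<Rightarrow> 'v::banach \<Rightarrow> 'v" and \<rho> :: "'g::topological_group_add \<Rightarrow> 'v \<Rightarrow> 'v"
  assumes module: "uniformly_bounded_module scale \<rho>" and cont: "strongly_operator_continuous \<rho>"
  obtains M where "continuous_action \<rho> M"
proof -
  let ?M = "SUP g. onorm (\<rho> g)"
  have bij: "bij (\<rho> g)" and lin: "bounded_linear (\<rho> g)" for g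
    using module by (auto simp: uniformly_bounded_module_def GL_def bounded_klinear_def)
  have comp: "\<rho> (g + h) v = \<rho> g (\<rho> h v)" for g h v
    using module by (simp add: uniformly_bounded_module_def)
  have le: "onorm (\<rho> g) \<le> ?M" for g
    using module by (intro cSUP_upper) (auto simp: uniformly_bounded_module_def)
  have "continuous_action \<rho> ?M"
  proof (rule continuous_action.intro)
    show "\<rho> 0 v = v" for v
    proof -
      \<comment> \<open>An injective idempotent map is the identity.\<close>
      have "\<rho> 0 (\<rho> 0 v) = \<rho> 0 v"
        using comp[of 0 0 v] by simp
      then show ?thesis
        using bij_is_inj[OF bij] by (simp add: inj_eq)
    qed
    show "norm (\<rho> g v) \<le> ?M * norm v" for g v
      using onorm[OF lin, of g v] mult_right_mono[OF le[of g] norm_ge_zero[of v]] by linarith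
    show "?M \<ge> 0"
      using le[of 0] onorm_pos_le[OF lin] order_trans by blast
    show "continuous_on UNIV (\<lambda>g. \<rho> g v)" for v
      using cont by (simp add: strongly_operator_continuous_def)
  qed (use lin comp in auto)
  then show thesis
    by (rule that)
qed

locale product_module = continuous_action \<rho> M +
  G1: compactly_carried \<mu>1 N1 K1 + G2: compactly_carried \<mu>2 N2 K2
  for \<rho> :: "'g1::topological_group_add \<times> 'g2::topological_group_add \<Rightarrow> 'v::banach \<Rightarrow> 'v"
    and M and \<mu>1 :: "'g1 measure" and N1 K1 and \<mu>2 :: "'g2 measure" and N2 K2 +
  fixes scale :: "'k::real_or_complex \<Rightarrow> 'v \<Rightarrow> 'v"
  assumes scale: "banach_space_over scale"
    and klinear: "\<rho> g (scale c v) = scale c (\<rho> g v)"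
    and contraction: "onorm (markov_operator scale (restrict_left \<rho>) \<mu>1 \<circ>
                markov_operator scale (restrict_right \<rho>) \<mu>2) < 1"
    and fixed_left:
      "{v. markov_operator scale (restrict_left \<rho>) \<mu>1 v = v} = fixed_vectors (restrict_left \<rho>)"
    and fixed_right:
      "{v. markov_operator scale (restrict_right \<rho>) \<mu>2 v = v} = fixed_vectors (restrict_right \<rho>)"
begin

sublocale H1: group_hom_action \<rho> M "\<lambda>g. (g, 0)"
  by unfold_locales (auto intro!: continuous_intros)

sublocale H2: group_hom_action \<rho> M "\<lambda>h. (0, h)"
  by unfold_locales (auto intro!: continuous_intros)

sublocale A1: averaged_action "\<lambda>g. \<rho> (g, 0)" M \<mu>1 N1 K1
  by unfold_locales

sublocale A2: averaged_action "\<lambda>h. \<rho> (0, h)" M \<mu>2 N2 K2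
  by unfold_locales

abbreviation "P1 \<equiv> A1.average"
abbreviation "P2 \<equiv> A2.average"

lemma restrict_left: "restrict_left \<rho> = (\<lambda>g. \<rho> (g, 0))"
  and restrict_right: "restrict_right \<rho> = (\<lambda>h. \<rho> (0, h))"
  by (auto simp: restrict_left_def restrict_right_def)

lemma markov_left: "markov_operator scale (restrict_left \<rho>) \<mu>1 = P1"
  and P1_klinear: "bounded_klinear scale scale P1"
  using A1.average_klinear[OF scale klinear] by (simp_all add: restrict_left)

lemma markov_right: "markov_operator scale (restrict_right \<rho>) \<mu>2 = P2"
  and P2_klinear: "bounded_klinear scale scale P2"
  using A2.average_klinear[OF scale klinear] by (simp_all add: restrict_right)

lemma bounded_linear_P: "bounded_linear P1" "bounded_linear P2"
  using P1_klinear P2_klinear by (simp_all add: bounded_klinear_def)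

lemma actions_commute: "\<rho> (g, 0) (\<rho> (0, h) v) = \<rho> (0, h) (\<rho> (g, 0) v)"
  by (simp flip: action_add)

lemma P1_commute: "P1 (\<rho> (0, h) v) = \<rho> (0, h) (P1 v)"
  by (rule A1.average_commute[symmetric, OF bounded_linear]) (simp add: actions_commute)

lemma P2_commute: "P2 (\<rho> (g, 0) v) = \<rho> (g, 0) (P2 v)"
  by (rule A2.average_commute[symmetric, OF bounded_linear]) (simp add: actions_commute)

sublocale commuting_contraction P1 P2
proof (rule commuting_contraction.intro)
  show "P1 (P2 v) = P2 (P1 v)" for v
    by (rule A2.average_commute[OF bounded_linear_P(1) P1_commute])
  show "onorm (P1 \<circ> P2) < 1"
    using contraction by (simp add: markov_left markov_right)
qed (rule bounded_linear_P)+

abbreviation "V1 \<equiv> fixed_vectors (restrict_left \<rho>)"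
abbreviation "V2 \<equiv> fixed_vectors (restrict_right \<rho>)"

text \<open>The hypotheses \<open>fixed_left\<close> and \<open>fixed_right\<close> enter here:
  being fixed by an average is promoted to being fixed by the group.\<close>

lemma V1_iff: "v \<in> V1 \<longleftrightarrow> P1 v = v" and V2_iff: "v \<in> V2 \<longleftrightarrow> P2 v = v"
  using fixed_left fixed_right unfolding markov_left markov_right by blast+

lemma V1_fixed: "v \<in> V1 \<Longrightarrow> \<rho> (g, 0) v = v" and V2_fixed: "v \<in> V2 \<Longrightarrow> \<rho> (0, h) v = v"
  by (simp_all add: fixed_vectors_def restrict_left restrict_right)

lemma V1_action: "v \<in> V1 \<Longrightarrow> \<rho> (0, h) v \<in> V1" and V2_action: "v \<in> V2 \<Longrightarrow> \<rho> (g, 0) v \<in> V2"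
  by (simp_all add: V1_iff V2_iff P1_commute P2_commute)

lemma V1_eq: "v \<in> V1 \<Longrightarrow> \<rho> x v = \<rho> (0, snd x) v" and V2_eq: "v \<in> V2 \<Longrightarrow> \<rho> x v = \<rho> (fst x, 0) v"
  using action_add[of "(0, snd x)" "(fst x, 0)" v] action_add[of "(fst x, 0)" "(0, snd x)" v]
  by (simp_all add: V1_fixed V2_fixed)

section \<open>Means of a cocycle and the correcting vector\<close>

abbreviation Z :: "((nat \<Rightarrow> 'g1 \<times> 'g2) \<Rightarrow> 'v) set" where "Z \<equiv> cocycles \<rho> 1 UNIV"

definition mean1 :: "((nat \<Rightarrow> 'g1 \<times> 'g2) \<Rightarrow> 'v) \<Rightarrow> 'v" where
  "mean1 f = weak_integral \<mu>1 (\<lambda>g. f (pair_point 0 (g, 0)))"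

definition mean2 :: "((nat \<Rightarrow> 'g1 \<times> 'g2) \<Rightarrow> 'v) \<Rightarrow> 'v" where
  "mean2 f = weak_integral \<mu>2 (\<lambda>h. f (pair_point 0 (0, h)))"

lemma Z_cochains: "Z \<subseteq> cochains 2 UNIV"
  using cocycles_cochains by blast

lemma Z_continuous1: "f \<in> Z \<Longrightarrow> continuous_on UNIV (\<lambda>g. f (pair_point 0 (g, 0)))"
  and Z_continuous2: "f \<in> Z \<Longrightarrow> continuous_on UNIV (\<lambda>h. f (pair_point 0 (0, h)))"
  by (rule continuous_on_cochain_pair_point[OF cocycles_cochains]; auto intro!: continuous_intros)+

text \<open>The path from the neutral element to \<open>(g, h)\<close> is split at
  \<open>(g, 0)\<close> and at \<open>(0, h)\<close>. Comparing the two expansions yields the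
  relation between the restrictions to the factors.\<close>

lemma cocycle_product:
  assumes f: "f \<in> Z"
  shows "f (pair_point 0 (g, h)) = f (pair_point 0 (g, 0)) + \<rho> (g, 0) (f (pair_point 0 (0, h)))"
    and "f (pair_point 0 (g, h)) = f (pair_point 0 (0, h)) + \<rho> (0, h) (f (pair_point 0 (g, 0)))"
  using cocycle_trans[OF f, of 0 "(g, h)" "(g, 0)"] cocycle_translate[OF f, of "(g, 0)" "(0, h)"]
    cocycle_trans[OF f, of 0 "(g, h)" "(0, h)"] cocycle_translate[OF f, of "(0, h)" "(g, 0)"]
  by simp_all

lemma cocycle_compat:
  assumes f: "f \<in> Z"
  shows "f (pair_point 0 (g, 0)) - \<rho> (0, h) (f (pair_point 0 (g, 0))) =
    f (pair_point 0 (0, h)) - \<rho> (g, 0) (f (pair_point 0 (0, h)))"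
  using cocycle_product[OF f, of g h] by (simp add: algebra_simps)

text \<open>The cocycle relation is averaged over the first factor with
  \<open>T = \<rho> (0, h)\<close>, and the result over the second factor with
  \<open>T = P1\<close>; no product measure and no exchange of integrals is involved.\<close>

lemma means_compat:
  assumes f: "f \<in> Z"
  shows "mean1 f - P2 (mean1 f) = mean2 f - P1 (mean2 f)"
  unfolding mean2_def
proof (rule A2.average_diff_eq[OF Z_continuous2[OF f] bounded_linear_P(1)])
  fix h
  have "f (pair_point 0 (0, h)) - P1 (f (pair_point 0 (0, h))) = mean1 f - \<rho> (0, h) (mean1 f)"
    unfolding mean1_def
    by (rule A1.average_diff_eq[OF Z_continuous1[OF f] bounded_linear]) (rule cocycle_compat[OF f, symmetric])
  then show "mean1 f - \<rho> (0, h) (mean1 f) = f (pair_point 0 (0, h)) - P1 (f (pair_point 0 (0, h)))" ..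
qed

text \<open>Proper on cocycles: \<open>means_compat\<close> provides a solution, and
  \<open>solves_unique\<close> says that it is the only one. Linearity follows because sums and
  multiples of solutions solve the corresponding equations.\<close>

definition corrector :: "((nat \<Rightarrow> 'g1 \<times> 'g2) \<Rightarrow> 'v) \<Rightarrow> 'v" where
  "corrector f = (THE v. solves (mean1 f) (mean2 f) v)"

lemma corrector_eqI: "solves (mean1 f) (mean2 f) v \<Longrightarrow> corrector f = v"
  unfolding corrector_def by (rule the_equality) (auto intro: solves_unique)

lemma solves_corrector:
  assumes "f \<in> Z"
  shows "solves (mean1 f) (mean2 f) (corrector f)"
proof -
  obtain v where "solves (mean1 f) (mean2 f) v"
    using solves_exists[OF means_compat[OF assms]] by blast
  with corrector_eqI[OF this] show ?thesis
    by simp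
qed

lemma Z_add: "f \<in> Z \<Longrightarrow> h \<in> Z \<Longrightarrow> (\<lambda>x. f x + h x) \<in> Z"
  and Z_scale: "f \<in> Z \<Longrightarrow> (\<lambda>x. scale c (f x)) \<in> Z"
proof -
  interpret Q: cochain_quotient scale 2 UNIV Z "coboundaries \<rho> 1 UNIV"
    by (rule cochain_quotient_cohomology[OF scale klinear]) auto
  show "f \<in> Z \<Longrightarrow> h \<in> Z \<Longrightarrow> (\<lambda>x. f x + h x) \<in> Z"
    by (rule Q.Z_add)
  show "f \<in> Z \<Longrightarrow> (\<lambda>x. scale c (f x)) \<in> Z"
    by (rule Q.Z_scale)
qed

lemma corrector_add:
  assumes "f \<in> Z" "h \<in> Z"
  shows "corrector (\<lambda>x. f x + h x) = corrector f + corrector h"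
proof (rule corrector_eqI)
  have "mean1 (\<lambda>x. f x + h x) = mean1 f + mean1 h" "mean2 (\<lambda>x. f x + h x) = mean2 f + mean2 h"
    unfolding mean1_def mean2_def
    by (rule G1.weak_integral_add[OF Z_continuous1 Z_continuous1]
        G2.weak_integral_add[OF Z_continuous2 Z_continuous2]; rule assms)+
  then show "solves (mean1 (\<lambda>x. f x + h x)) (mean2 (\<lambda>x. f x + h x)) (corrector f + corrector h)"
    using solves_add[OF solves_corrector solves_corrector] assms by simp
qed

lemma corrector_scale:
  assumes "f \<in> Z"
  shows "corrector (\<lambda>x. scale c (f x)) = scale c (corrector f)"
proof (rule corrector_eqI)
  interpret S: banach_space_over scale by (rule scale)
  have "mean1 (\<lambda>x. scale c (f x)) = scale c (mean1 f)" "mean2 (\<lambda>x. scale c (f x)) = scale c (mean2 f)"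
    unfolding mean1_def mean2_def
    by (rule G1.weak_integral_bounded_linear[OF Z_continuous1 S.bounded_linear_scale]
        G2.weak_integral_bounded_linear[OF Z_continuous2 S.bounded_linear_scale]; rule assms)+
  then show "solves (mean1 (\<lambda>x. scale c (f x))) (mean2 (\<lambda>x. scale c (f x))) (scale c (corrector f))"
    using solves_corrector[OF assms] P1_klinear P2_klinear
    by (auto simp: solves_def bounded_klinear_def simp flip: S.scale_right_diff_distrib)
qed

text \<open>The two means are \<open>P1 w - w\<close> and \<open>P2 w - w\<close>, for which
  \<open>- w\<close> is visibly a solution.\<close>

lemma corrector_orbit_coboundary: "corrector (orbit_coboundary w) = - w"
proof (rule corrector_eqI)
  have "mean1 (orbit_coboundary w) = P1 w - w" "mean2 (orbit_coboundary w) = P2 w - w"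
    unfolding mean1_def mean2_def A1.average_def A2.average_def
    using G1.weak_integral_diff[OF H1.restricted.continuous_orbit continuous_on_const, of w w]
      G2.weak_integral_diff[OF H2.restricted.continuous_orbit continuous_on_const, of w w]
    by (simp_all add: action_0 G1.weak_integral_const G2.weak_integral_const flip: zero_prod_def)
  then show "solves (mean1 (orbit_coboundary w)) (mean2 (orbit_coboundary w)) (- w)"
    using linear_neg[OF bounded_linear.linear[OF bounded_linear_P(1)], of w]
      linear_neg[OF bounded_linear.linear[OF bounded_linear_P(2)], of w]
    by (simp add: solves_def)
qed

text \<open>The points at which the integrands of the means see \<open>f\<close>, cut down to the
  compact carriers. Values on this one compact set control \<open>corrector\<close>.\<close>

definition probes :: "(nat \<Rightarrow> 'g1 \<times> 'g2) set" where
  "probes = (\<lambda>g. pair_point 0 (g, 0)) ` K1 \<union> (\<lambda>h. pair_point 0 (0, h)) ` K2"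

lemma compactin_probes: "compactin (group_power 2) probes"
  unfolding probes_def
  by (intro compactin_Un compactin_pair_point G1.compact G2.compact) (auto intro!: continuous_intros)

lemma corrector_lipschitz:
  assumes fh: "f \<in> Z" "h \<in> Z" and B: "\<forall>x\<in>probes. dist (f x) (h x) \<le> B"
  shows "norm (corrector f - corrector h) \<le> resolvent_bound * B"
proof (rule norm_solves_le)
  show "solves (mean1 f - mean1 h) (mean2 f - mean2 h) (corrector f - corrector h)"
    by (intro solves_diff solves_corrector fh)
  have "mean1 f - mean1 h = weak_integral \<mu>1 (\<lambda>g. f (pair_point 0 (g, 0)) - h (pair_point 0 (g, 0)))"
    unfolding mean1_def by (rule G1.weak_integral_diff[OF Z_continuous1 Z_continuous1, symmetric]; rule fh)
  also have "norm \<dots> \<le> B"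
    using B by (intro G1.norm_weak_integral_le continuous_on_diff Z_continuous1 fh) (auto simp: probes_def dist_norm)
  finally show "norm (mean1 f - mean1 h) \<le> B" .
  have "mean2 f - mean2 h = weak_integral \<mu>2 (\<lambda>g. f (pair_point 0 (0, g)) - h (pair_point 0 (0, g)))"
    unfolding mean2_def by (rule G2.weak_integral_diff[OF Z_continuous2 Z_continuous2, symmetric]; rule fh)
  also have "norm \<dots> \<le> B"
    using B by (intro G2.norm_weak_integral_le continuous_on_diff Z_continuous2 fh) (auto simp: probes_def dist_norm)
  finally show "norm (mean2 f - mean2 h) \<le> B" .
qed

text \<open>The average runs over the second factor while \<open>T = \<rho> (g, 0)\<close> comes
  from the first; therefore \<open>mean2\<close> and the second equation of \<open>solves\<close>
  govern the values on the first factor, and vice versa in \<open>corrected_in_V1\<close>.\<close>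

lemma corrected_in_V2:
  assumes f: "f \<in> Z"
  shows "f (pair_point 0 (g, 0)) + \<rho> (g, 0) (corrector f) - corrector f \<in> V2"
  unfolding V2_iff
proof (rule A2.average_fixes_corrected[OF Z_continuous2[OF f] bounded_linear _ cocycle_compat[OF f] bounded_linear_P(2)])
  show "\<rho> (g, 0) (\<rho> (0, h) v) = \<rho> (0, h) (\<rho> (g, 0) v)" for h v
    by (rule actions_commute)
  show "corrector f - P2 (corrector f) = weak_integral \<mu>2 (\<lambda>h. f (pair_point 0 (0, h)))"
    using solves_corrector[OF f] by (simp add: solves_def mean2_def)
qed

lemma corrected_in_V1:
  assumes f: "f \<in> Z"
  shows "f (pair_point 0 (0, h)) + \<rho> (0, h) (corrector f) - corrector f \<in> V1"
  unfolding V1_iff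
proof (rule A1.average_fixes_corrected[OF Z_continuous1[OF f] bounded_linear _ cocycle_compat[OF f, symmetric]
      bounded_linear_P(1)])
  show "\<rho> (0, h) (\<rho> (g, 0) v) = \<rho> (g, 0) (\<rho> (0, h) v)" for g v
    by (rule actions_commute[symmetric])
  show "corrector f - P1 (corrector f) = weak_integral \<mu>1 (\<lambda>g. f (pair_point 0 (g, 0)))"
    using solves_corrector[OF f] by (simp add: solves_def mean1_def)
qed

section \<open>The maps between the cocycle spaces and their compositions\<close>

abbreviation "Z1 \<equiv> cocycles (restrict_left \<rho>) 1 V2"
abbreviation "Z2 \<equiv> cocycles (restrict_right \<rho>) 1 V1"

text \<open>Both components use the same vector \<open>corrector f\<close>. This is why a common
  solution of the two equations is needed: it lets the recombined cocycle differ from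
  \<open>f\<close> by a single coboundary.\<close>

definition \<Pi>1 :: "((nat \<Rightarrow> 'g1 \<times> 'g2) \<Rightarrow> 'v) \<Rightarrow> (nat \<Rightarrow> 'g1) \<Rightarrow> 'v" where
  "\<Pi>1 f = H1.corrected f (corrector f)"

definition \<Pi>2 :: "((nat \<Rightarrow> 'g1 \<times> 'g2) \<Rightarrow> 'v) \<Rightarrow> (nat \<Rightarrow> 'g2) \<Rightarrow> 'v" where
  "\<Pi>2 f = H2.corrected f (corrector f)"

definition J :: "((nat \<Rightarrow> 'g1) \<Rightarrow> 'v) \<times> ((nat \<Rightarrow> 'g2) \<Rightarrow> 'v) \<Rightarrow> (nat \<Rightarrow> 'g1 \<times> 'g2) \<Rightarrow> 'v" where
  "J p = (\<lambda>x. pullback 2 fst (fst p) x + pullback 2 snd (snd p) x)"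

lemma \<Pi>1_Z:
  assumes f: "f \<in> Z"
  shows "\<Pi>1 f \<in> Z1"
  using H1.corrected_cocycles[OF f corrected_in_V2[OF f] V2_action]
  unfolding \<Pi>1_def restrict_left .

lemma \<Pi>2_Z:
  assumes f: "f \<in> Z"
  shows "\<Pi>2 f \<in> Z2"
  using H2.corrected_cocycles[OF f corrected_in_V1[OF f] V1_action]
  unfolding \<Pi>2_def restrict_right .

lemma J_Z:
  assumes f: "f1 \<in> Z1" "f2 \<in> Z2"
  shows "J (f1, f2) \<in> Z"
proof -
  have "pullback 2 fst f1 \<in> Z"
  proof (rule pullback_cocycles[OF _ _ f(1)])
    show "\<rho> x w = restrict_left \<rho> (fst x) w" if "w \<in> V2" for x w
      unfolding restrict_left_def using that by (rule V2_eq)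
  qed (auto intro!: continuous_intros)
  moreover have "pullback 2 snd f2 \<in> Z"
  proof (rule pullback_cocycles[OF _ _ f(2)])
    show "\<rho> x w = restrict_right \<rho> (snd x) w" if "w \<in> V1" for x w
      unfolding restrict_right_def using that by (rule V1_eq)
  qed (auto intro!: continuous_intros)
  ultimately show ?thesis
    unfolding J_def fst_conv snd_conv by (rule Z_add)
qed

lemma J_pair_point: "J (f1, f2) (pair_point a b) = f1 (pair_point (fst a) (fst b)) + f2 (pair_point (snd a) (snd b))"
  by (simp add: J_def)

lemma J_add: "J (\<lambda>x. f1 x + h1 x, \<lambda>x. f2 x + h2 x) = (\<lambda>x. J (f1, f2) x + J (h1, h2) x)"
  by (auto simp: J_def pullback_def)

lemma coboundaries_eq: "coboundaries \<rho> 1 UNIV = range orbit_coboundary"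
  by (rule coboundaries_1) simp

lemma coboundaries_left: "coboundaries (restrict_left \<rho>) 1 V2 = H1.restricted.orbit_coboundary ` V2"
  and coboundaries_right: "coboundaries (restrict_right \<rho>) 1 V1 = H2.restricted.orbit_coboundary ` V1"
  using H1.restricted.coboundaries_1[OF V2_action] H2.restricted.coboundaries_1[OF V1_action]
  unfolding restrict_left restrict_right by simp_all

text \<open>Both sides of the rearranged equation are cocycles, so points \<open>(0, (g, h))\<close>
  suffice. There the corrected value \<open>u\<close> on the second factor lies in \<open>V1\<close>
  and may be replaced by \<open>\<rho> (g, 0) u\<close>; the terms \<open>\<rho> (g, 0) v\<close>
  then cancel, and \<open>cocycle_product\<close> leaves \<open>f\<close> plus the coboundary of
  \<open>v\<close>.\<close>

lemma J_\<Pi>: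
  assumes f: "f \<in> Z"
  shows "(\<lambda>x. J (\<Pi>1 f, \<Pi>2 f) x - f x) = orbit_coboundary (corrector f)"
proof -
  let ?v = "corrector f"
  have cob: "orbit_coboundary ?v \<in> Z"
    by (rule orbit_coboundary_cocycles) simp
  have "J (\<Pi>1 f, \<Pi>2 f) = (\<lambda>x. f x + orbit_coboundary ?v x)"
  proof (rule cocycles_eqI[OF J_Z[OF \<Pi>1_Z[OF f] \<Pi>2_Z[OF f]] Z_add[OF f cob]])
    fix x :: "'g1 \<times> 'g2"
    obtain g h where x: "x = (g, h)"
      by (rule prod.exhaust)
    let ?u = "f (pair_point 0 (0, h)) + \<rho> (0, h) ?v - ?v"
    have "\<rho> (g, 0) ?u = ?u"
      by (rule V1_fixed[OF corrected_in_V1[OF f]])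
    then have "\<rho> (g, 0) (f (pair_point 0 (0, h))) + \<rho> (g, 0) (\<rho> (0, h) ?v) - \<rho> (g, 0) ?v = ?u"
      by (simp add: action_plus action_diff)
    moreover have "\<rho> (g, h) ?v = \<rho> (g, 0) (\<rho> (0, h) ?v)"
      by (simp flip: action_add)
    ultimately show "J (\<Pi>1 f, \<Pi>2 f) (pair_point 0 x) = f (pair_point 0 x) + orbit_coboundary ?v (pair_point 0 x)"
      using cocycle_product(1)[OF f, of g h]
      by (simp add: x J_pair_point \<Pi>1_def \<Pi>2_def H1.corrected_pair_point H2.corrected_pair_point
          action_0 algebra_simps flip: zero_prod_def)
  qed
  then show ?thesis
    by (simp add: fun_eq_iff)
qed

text \<open>Integration keeps \<open>mean1\<close> in \<open>V2\<close> and \<open>mean2\<close> in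
  \<open>V1\<close>, so each mean is compatible with \<open>0\<close> and the two systems can be
  solved separately. The zero right-hand sides say that \<open>v1\<close> lies in \<open>V2\<close>
  and \<open>v2\<close> in \<open>V1\<close>. Over the first factor \<open>v2\<close> is fixed and
  drops out of the coboundary of \<open>v1 + v2\<close>; over the second factor \<open>v1\<close>
  does.\<close>

lemma \<Pi>_J:
  assumes f1: "f1 \<in> Z1" and f2: "f2 \<in> Z2"
  obtains v1 v2 where "v1 \<in> V2" "v2 \<in> V1"
    "(\<lambda>x. \<Pi>1 (J (f1, f2)) x - f1 x) = H1.restricted.orbit_coboundary v1"
    "(\<lambda>x. \<Pi>2 (J (f1, f2)) x - f2 x) = H2.restricted.orbit_coboundary v2"
proof -
  let ?f = "J (f1, f2)"
  have f: "?f \<in> Z"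
    using f1 f2 by (rule J_Z)
  \<comment> \<open>The other summand is evaluated on the diagonal, where a cocycle
    vanishes.\<close>
  have J1: "?f (pair_point (a, 0) (b, 0)) = f1 (pair_point a b)"
    and J2: "?f (pair_point (0, c) (0, d)) = f2 (pair_point c d)" for a b c d
    using cocycle_diagonal[OF f1] cocycle_diagonal[OF f2] by (simp_all add: J_pair_point)
  have J01: "?f (pair_point 0 (b, 0)) = f1 (pair_point 0 b)"
    and J02: "?f (pair_point 0 (0, d)) = f2 (pair_point 0 d)" for b d
    using J1[of 0] J2[of 0] by (simp_all flip: zero_prod_def)
  have in1: "?f (pair_point 0 (b, 0)) \<in> V2" and in2: "?f (pair_point 0 (0, d)) \<in> V1" for b d
    unfolding J01 J02 using cochains_in[OF cocycles_cochains[OF f1] pair_point_in]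
      cochains_in[OF cocycles_cochains[OF f2] pair_point_in] by auto
  have "P2 (mean1 ?f) = mean1 ?f"
    using G1.weak_integral_bounded_linear[OF Z_continuous1[OF f] bounded_linear_P(2)] in1
    by (simp add: mean1_def V2_iff)
  moreover have "P1 (mean2 ?f) = mean2 ?f"
    using G2.weak_integral_bounded_linear[OF Z_continuous2[OF f] bounded_linear_P(1)] in2
    by (simp add: mean2_def V1_iff)
  moreover have "P1 0 = 0" "P2 0 = 0"
    by (rule linear_0[OF bounded_linear.linear[OF bounded_linear_P(1)]]
        linear_0[OF bounded_linear.linear[OF bounded_linear_P(2)]])+
  ultimately obtain v1 v2 where v: "solves (mean1 ?f) 0 v1" "solves 0 (mean2 ?f) v2"
    using solves_exists[of "mean1 ?f" 0] solves_exists[of 0 "mean2 ?f"] by auto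
  then have in_V: "v1 \<in> V2" "v2 \<in> V1"
    by (auto simp: solves_def V1_iff V2_iff)
  have c: "corrector ?f = v1 + v2"
    using solves_add[OF v] by (intro corrector_eqI) simp
  have "\<Pi>1 ?f x - f1 x = H1.restricted.orbit_coboundary v1 x" for x
  proof (cases "x \<in> topspace (group_power 2)")
    case True
    then show ?thesis
      by (rule pair_point_cases)
        (simp add: \<Pi>1_def H1.corrected_pair_point J1 c action_plus V1_fixed[OF in_V(2)])
  next
    case False
    then show ?thesis
      using cochains_outside[OF cocycles_cochains[OF f1] False]
        cochains_outside[OF cocycles_cochains[OF \<Pi>1_Z[OF f]] False]
      by (simp add: H1.restricted.orbit_coboundary_def)
  qed
  moreover have "\<Pi>2 ?f x - f2 x = H2.restricted.orbit_coboundary v2 x" for x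
  proof (cases "x \<in> topspace (group_power 2)")
    case True
    then show ?thesis
      by (rule pair_point_cases)
        (simp add: \<Pi>2_def H2.corrected_pair_point J2 c action_plus V2_fixed[OF in_V(1)])
  next
    case False
    then show ?thesis
      using cochains_outside[OF cocycles_cochains[OF f2] False]
        cochains_outside[OF cocycles_cochains[OF \<Pi>2_Z[OF f]] False]
      by (simp add: H2.restricted.orbit_coboundary_def)
  qed
  ultimately show thesis
    using in_V by (intro that[of v1 v2]) auto
qed

section \<open>Continuity on cocycles and passage to cohomology\<close>

lemma continuous_map_\<Pi>1:
  "continuous_map (subtopology (compact_open 2 UNIV) Z) (subtopology (compact_open 2 V2) Z1) \<Pi>1"
  unfolding continuous_map_in_subtopology
proof
  show "continuous_map (subtopology (compact_open 2 UNIV) Z) (compact_open 2 V2) \<Pi>1"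
    unfolding \<Pi>1_def[abs_def]
    by (rule H1.continuous_map_corrected[OF Z_cochains compactin_probes resolvent_bound_nonneg])
      (use corrector_lipschitz cocycles_cochains[OF \<Pi>1_Z] in \<open>auto simp: \<Pi>1_def\<close>)
qed (use \<Pi>1_Z in auto)

lemma continuous_map_\<Pi>2:
  "continuous_map (subtopology (compact_open 2 UNIV) Z) (subtopology (compact_open 2 V1) Z2) \<Pi>2"
  unfolding continuous_map_in_subtopology
proof
  show "continuous_map (subtopology (compact_open 2 UNIV) Z) (compact_open 2 V1) \<Pi>2"
    unfolding \<Pi>2_def[abs_def]
    by (rule H2.continuous_map_corrected[OF Z_cochains compactin_probes resolvent_bound_nonneg])
      (use corrector_lipschitz cocycles_cochains[OF \<Pi>2_Z] in \<open>auto simp: \<Pi>2_def\<close>)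
qed (use \<Pi>2_Z in auto)

lemma continuous_map_J:
  "continuous_map (prod_topology (subtopology (compact_open 2 V2) Z1) (subtopology (compact_open 2 V1) Z2))
    (subtopology (compact_open 2 UNIV) Z) J" (is "continuous_map ?X _ _")
  unfolding continuous_map_in_subtopology
proof
  have Z12: "Z1 \<subseteq> cochains 2 V2" "Z2 \<subseteq> cochains 2 V1"
    using cocycles_cochains by blast+
  have fst: "continuous_map ?X (compact_open 2 UNIV :: ((nat \<Rightarrow> 'g1 \<times> 'g2) \<Rightarrow> 'v) topology)
      (pullback 2 fst \<circ> fst)"
    by (rule continuous_map_compose[OF continuous_map_fst continuous_map_pullback[OF _ Z12(1)]])
      (auto intro!: continuous_intros)
  have snd: "continuous_map ?X (compact_open 2 UNIV :: ((nat \<Rightarrow> 'g1 \<times> 'g2) \<Rightarrow> 'v) topology)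
      (pullback 2 snd \<circ> snd)"
    by (rule continuous_map_compose[OF continuous_map_snd continuous_map_pullback[OF _ Z12(2)]])
      (auto intro!: continuous_intros)
  have "continuous_map ?X (compact_open 2 UNIV)
      ((\<lambda>p x. fst p x + snd p x) \<circ> (\<lambda>p. ((pullback 2 fst \<circ> fst) p, (pullback 2 snd \<circ> snd) p)))"
    by (rule continuous_map_compose[OF continuous_map_pairedI[OF fst snd] continuous_map_compact_open_add]) simp
  then show "continuous_map ?X (compact_open 2 UNIV) J"
    by (simp add: J_def[abs_def] o_def)
  show "J \<in> topspace ?X \<rightarrow> Z"
    using J_Z by auto
qed

lemma V1_subspace: "0 \<in> V1" "v \<in> V1 \<Longrightarrow> w \<in> V1 \<Longrightarrow> v + w \<in> V1" "v \<in> V1 \<Longrightarrow> scale c v \<in> V1"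
  and V2_subspace: "0 \<in> V2" "v \<in> V2 \<Longrightarrow> w \<in> V2 \<Longrightarrow> v + w \<in> V2" "v \<in> V2 \<Longrightarrow> scale c v \<in> V2"
  using P1_klinear P2_klinear linear_0[OF bounded_linear.linear[OF bounded_linear_P(1)]]
    linear_0[OF bounded_linear.linear[OF bounded_linear_P(2)]]
  by (simp_all add: V1_iff V2_iff P_add Q_add bounded_klinear_def)

theorem cohomology_isomorphism:
  "topologically_isomorphic
     (continuous_cohomology scale \<rho> 1 UNIV)
     (direct_sum
       (continuous_cohomology scale (restrict_left \<rho>) 1 V2)
       (continuous_cohomology scale (restrict_right \<rho>) 1 V1))"
  unfolding continuous_cohomology_def Suc_1
proof (rule topological_isomorphism_of_quotients)
  show "cochain_quotient scale 2 UNIV Z (coboundaries \<rho> 1 UNIV)"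
    by (rule cochain_quotient_cohomology[OF scale klinear]) auto
  show "cochain_quotient scale 2 V2 Z1 (coboundaries (restrict_left \<rho>) 1 V2)"
    using H1.restricted.cochain_quotient_cohomology[OF scale klinear V2_subspace V2_action]
    by (simp only: restrict_left)
  show "cochain_quotient scale 2 V1 Z2 (coboundaries (restrict_right \<rho>) 1 V1)"
    using H2.restricted.cochain_quotient_cohomology[OF scale klinear V1_subspace V1_action]
    by (simp only: restrict_right)
  show "continuous_map (subtopology (compact_open 2 UNIV) Z) (subtopology (compact_open 2 V2) Z1) \<Pi>1"
    by (rule continuous_map_\<Pi>1)
  show "continuous_map (subtopology (compact_open 2 UNIV) Z) (subtopology (compact_open 2 V1) Z2) \<Pi>2"
    by (rule continuous_map_\<Pi>2)
  show "continuous_map (prod_topology (subtopology (compact_open 2 V2) Z1) (subtopology (compact_open 2 V1) Z2))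
      (subtopology (compact_open 2 UNIV) Z) J"
    by (rule continuous_map_J)
  show "\<Pi>1 (\<lambda>x. f x + h x) = (\<lambda>x. \<Pi>1 f x + \<Pi>1 h x)" if "f \<in> Z" "h \<in> Z" for f h
    unfolding \<Pi>1_def corrector_add[OF that] by (rule H1.corrected_add)
  show "\<Pi>2 (\<lambda>x. f x + h x) = (\<lambda>x. \<Pi>2 f x + \<Pi>2 h x)" if "f \<in> Z" "h \<in> Z" for f h
    unfolding \<Pi>2_def corrector_add[OF that] by (rule H2.corrected_add)
  show "\<Pi>1 (\<lambda>x. scale c (f x)) = (\<lambda>x. scale c (\<Pi>1 f x))" if "f \<in> Z" for f c
    unfolding \<Pi>1_def corrector_scale[OF that] by (rule H1.corrected_scale[OF scale klinear])
  show "\<Pi>2 (\<lambda>x. scale c (f x)) = (\<lambda>x. scale c (\<Pi>2 f x))" if "f \<in> Z" for f c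
    unfolding \<Pi>2_def corrector_scale[OF that] by (rule H2.corrected_scale[OF scale klinear])
  have zero1: "(\<lambda>_. 0) \<in> coboundaries (restrict_left \<rho>) 1 V2"
    unfolding coboundaries_left using V2_subspace(1)
    by (intro image_eqI[of _ _ 0]) (auto simp: H1.restricted.orbit_coboundary_def linear_0 bounded_linear.linear bounded_linear)
  have zero2: "(\<lambda>_. 0) \<in> coboundaries (restrict_right \<rho>) 1 V1"
    unfolding coboundaries_right using V1_subspace(1)
    by (intro image_eqI[of _ _ 0]) (auto simp: H2.restricted.orbit_coboundary_def linear_0 bounded_linear.linear bounded_linear)
  fix b assume "b \<in> coboundaries \<rho> 1 UNIV"
  then obtain w where b: "b = orbit_coboundary w"
    unfolding coboundaries_eq by blast
  show "\<Pi>1 b \<in> coboundaries (restrict_left \<rho>) 1 V2"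
    unfolding b \<Pi>1_def corrector_orbit_coboundary H1.corrected_orbit_coboundary by (rule zero1)
  show "\<Pi>2 b \<in> coboundaries (restrict_right \<rho>) 1 V1"
    unfolding b \<Pi>2_def corrector_orbit_coboundary H2.corrected_orbit_coboundary by (rule zero2)
next
  fix f1 f2 h1 h2 assume "f1 \<in> Z1" "f2 \<in> Z2" "h1 \<in> Z1" "h2 \<in> Z2"
  show "J (\<lambda>x. f1 x + h1 x, \<lambda>x. f2 x + h2 x) = (\<lambda>x. J (f1, f2) x + J (h1, h2) x)"
    by (rule J_add)
next
  fix b1 b2 assume "b1 \<in> coboundaries (restrict_left \<rho>) 1 V2" "b2 \<in> coboundaries (restrict_right \<rho>) 1 V1"
  then obtain w1 w2 where w: "w1 \<in> V2" "b1 = H1.restricted.orbit_coboundary w1"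
      "w2 \<in> V1" "b2 = H2.restricted.orbit_coboundary w2"
    unfolding coboundaries_left coboundaries_right by blast
  \<comment> \<open>On \<open>V2\<close> the product acts through \<open>fst\<close> and on
    \<open>V1\<close> through \<open>snd\<close>, so the pulled back coboundaries are the
    coboundaries of \<open>w1\<close> and \<open>w2\<close> over the whole product.\<close>
  have "J (b1, b2) x = orbit_coboundary (w1 + w2) x" for x
  proof (cases "x \<in> topspace (group_power 2)")
    case True
    then obtain a b where x: "x = pair_point a b"
      by (rule pair_point_cases)
    show ?thesis
      using V2_eq[OF w(1), of a] V2_eq[OF w(1), of b] V1_eq[OF w(3), of a] V1_eq[OF w(3), of b]
      by (simp add: x J_pair_point w(2,4) action_plus)
  next
    case False
    then show ?thesis
      by (simp add: J_def pullback_def orbit_coboundary_def)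
  qed
  then show "J (b1, b2) \<in> coboundaries \<rho> 1 UNIV"
    unfolding coboundaries_eq by (intro image_eqI[of _ _ "w1 + w2"]) auto
next
  fix f assume "f \<in> Z"
  show "(\<lambda>x. J (\<Pi>1 f, \<Pi>2 f) x - f x) \<in> coboundaries \<rho> 1 UNIV"
    unfolding coboundaries_eq J_\<Pi>[OF \<open>f \<in> Z\<close>] by (rule rangeI)
next
  fix f1 f2 assume "f1 \<in> Z1" "f2 \<in> Z2"
  then obtain v1 v2 where v: "v1 \<in> V2" "v2 \<in> V1"
      "(\<lambda>x. \<Pi>1 (J (f1, f2)) x - f1 x) = H1.restricted.orbit_coboundary v1"
      "(\<lambda>x. \<Pi>2 (J (f1, f2)) x - f2 x) = H2.restricted.orbit_coboundary v2"
    by (rule \<Pi>_J)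
  show "(\<lambda>x. \<Pi>1 (J (f1, f2)) x - f1 x) \<in> coboundaries (restrict_left \<rho>) 1 V2"
    unfolding coboundaries_left v(3) using v(1) by (rule imageI)
  show "(\<lambda>x. \<Pi>2 (J (f1, f2)) x - f2 x) \<in> coboundaries (restrict_right \<rho>) 1 V1"
    unfolding coboundaries_right v(4) using v(2) by (rule imageI)
qed

end

theorem theorem2:
  fixes scale :: "'k::real_or_complex \<Rightarrow> 'v::banach \<Rightarrow> 'v"
    and \<rho> :: "'g1::topological_group_add \<times> 'g2::topological_group_add \<Rightarrow> 'v \<Rightarrow> 'v"
    and \<mu>1 :: "'g1 measure" and \<mu>2 :: "'g2 measure"
    and N1 :: "'g1 set" and N2 :: "'g2 set"
  assumes "banach_space_over scale"
    and "uniformly_bounded_module scale \<rho>"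
    and "strongly_operator_continuous \<rho>"
    and "baire_prob \<mu>1" and "baire_prob \<mu>2"
    and "N1 \<in> null_sets \<mu>1" and "\<exists>K. compact K \<and> UNIV - N1 \<subseteq> K"
    and "N2 \<in> null_sets \<mu>2" and "\<exists>K. compact K \<and> UNIV - N2 \<subseteq> K"
    and "onorm (markov_operator scale (restrict_left \<rho>) \<mu>1 \<circ>
                markov_operator scale (restrict_right \<rho>) \<mu>2) < 1"
    and "{v. markov_operator scale (restrict_left \<rho>) \<mu>1 v = v} = fixed_vectors (restrict_left \<rho>)"
    and "{v. markov_operator scale (restrict_right \<rho>) \<mu>2 v = v} = fixed_vectors (restrict_right \<rho>)"
  shows "topologically_isomorphic
           (continuous_cohomology scale \<rho> 1 UNIV)
           (direct_sum
             (continuous_cohomology scale (restrict_left \<rho>) 1 (fixed_vectors (restrict_right \<rho>)))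
             (continuous_cohomology scale (restrict_right \<rho>) 1 (fixed_vectors (restrict_left \<rho>))))"
proof -
  obtain M where M: "continuous_action \<rho> M"
    using uniformly_bounded_module_continuous_action[OF assms(2,3)] .
  obtain K1 K2 where K: "compact K1" "UNIV - N1 \<subseteq> K1" "compact K2" "UNIV - N2 \<subseteq> K2"
    using assms(7,9) by blast
  have klinear: "\<rho> g (scale c v) = scale c (\<rho> g v)" for g c v
  proof -
    have "\<rho> g \<in> GL scale"
      using assms(2) by (auto simp: uniformly_bounded_module_def)
    then show ?thesis
      by (simp add: GL_def bounded_klinear_def)
  qed
  interpret product_module \<rho> M \<mu>1 N1 K1 \<mu>2 N2 K2 scale
    by (intro product_module.intro compactly_carried.intro product_module_axioms.intro)
      (fact assms M K klinear)+
  show ?thesis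
    by (rule cohomology_isomorphism)
qed

end
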